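(* Let $V$ be a real vector space of dimension $2n$ and let $\omega\in(\Lambda^2V^\vee)^0$. Consider the following maps. - $r:\mathsf{Met}(V)\times\{\omega\}\to\mathcal{J}^\omega$, where $r(b,\omega)$ is the unique complex structure $J$ on $V$ that preserves both $b$ and $\omega$ and for which $b_{\omega,J}$ is positive definite symmetric. - $\beta:\mathcal{J}^\omega\to \mathsf{Met}(V)\times\{\omega\}$, which associates to $J$ the metric $b_{\omega,J}$, i.e. $\beta(J)=(b_{\omega,J},\omega)$. - $\rho:\mathsf{Met}(V)\times(\Lambda^2V^\vee)^0\to\mathsf{CohPair}(V)$, $\rho(b,\omega)=(b_{\omega,J},\omega)$ with $J=r(b,\omega)$ (so $\rho=\beta\circ r$ on each $\mathsf{Met}(V)\times\{\omega\}$). - $j:\mathrm{Sp}(n,\mathbb{R})/\mathrm{U}(n)\to\mathrm{GL}^+(2n,\mathbb{R})/\mathrm{SO}(2n)$, induced by the inclusion of groups. Then: (a) The image of $\beta$ lies in $\mathsf{CohPair}(V)$; $\beta$ is a bijection $\mathcal{J}^\omega\cong\mathrm{Im}(\beta)$ and $j$ is a bijection onto $\mathrm{Im}(j)$. After choosing a basis of $V$ in which $\omega$ becomes the standard symplectic form $\omega_o$, there are isomorphisms $\mathsf{Met}(V)\times\{\omega\}\cong\mathrm{GL}^+(2n,\mathbb{R})/\mathrm{SO}(2n)$ and $\mathcal{J}^\omega\cong\mathrm{Sp}(n,\mathbb{R})/\mathrm{U}(n)$, given by ${}^{\mathsf T}TT\leftrightarrow [T]$ and $T^{-1}\mathbf{J}T\leftrightarrow[T]$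 respectively, under which $\beta$ corresponds to $j$ and $\mathrm{Im}(\beta)$ to $\mathrm{Im}(j)$. The diagram formed by these maps together with the inclusions $\mathrm{Im}(\beta)\subset\mathsf{Met}(V)\times\{\omega\}\subset\mathsf{Met}(V)\times(\Lambda^2V^\vee)^0$, $\mathrm{Im}(\beta)\subset\mathsf{CohPair}(V)\subset\mathsf{Met}(V)\times(\Lambda^2V^\vee)^0$ and $\mathrm{Im}(j)\subset\mathrm{GL}^+(2n,\mathbb{R})/\mathrm{SO}(2n)$ commutes. (b) The group $\mathrm{GL}^+(2n,\mathbb{R})\times\mathrm{GL}^+(2n,\mathbb{R})$ operates naturally on $\mathsf{Met}(V)\times(\Lambda^2V^\vee)^0$. The diagonal subgroup permutes the columns $(\mathsf{Met}(V)\times\{\omega\},\ \mathrm{Im}(\beta),\ \mathcal{J}^{\omega})$ belonging to the various symplectic forms $\omega$ (with $\gamma$ acting by $J\mapsto\gamma^{-1}J\gamma$ on complex structures), while the subgroup $\mathrm{Sp}(n,\mathbb{R})\times\{\mathrm{id}\}$ preserves the column belonging to $\omega=\omega_o$, the standard symplectic form. (c) The map $r$ is a retraction for the inclusion defined by $\beta$, i.e. $r\circ\beta=\mathrm{id}_{\mathcal{J}^\omega}$. The fibres of $r$ are translates of a real $n^2$-dimensional cone isomorphic to $$\mathcal{K}_n=\{Z\in\mathbb{C}^{n\times n}\mid Z^*=Z,\ \mathrm{Re}(Z)>0\}.$$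
   Context: A complex structure on a real vector space $V$ is an $\mathbb{R}$-linear $J$ with $J^2=-\mathrm{id}$. $\mathsf{Met}(V)$ is the set of positive definite symmetric bilinear forms (metrics) on $V$, and $(\Lambda^2V^\vee)^0\subset\Lambda^2V^\vee$ is the open subset of non-degenerate skew forms (symplectic forms). For a skew form $\omega$ and complex structure $J$ put $b_{\omega,J}(x,y)=\omega(x,Jy)$. $\mathcal{J}^\omega$ is the set of complex structures $J$ on $V$ tamed by $\omega$, meaning $\omega(Jx,Jy)=\omega(x,y)$ for all $x,y$ and $\omega(x,Jx)>0$ for $x\neq0$. It is a fact that for every $(b,\omega)\in\mathsf{Met}(V)\times(\Lambda^2V^\vee)^0$ there is a unique complex structure $J$ preserving $b$ and $\omega$ with $b_{\omega,J}$ positive definite symmetric. Two metrics are conformally equivalent if they differ by a positive constant factor. The pair $(b,\omega)$ is coherent if, for this unique $J$, the metric $b_{\omega,J}$ is conformally equivalent to $b$. $\mathsf{CohPair}(V)$ is the set of coherent pairs. On $\mathbb{R}^{2n}$ let $\mathbf{J}=\begin{pmatrix}0&\mathbf 1_n\\-\mathbf 1_n&0\end{pmatrix}$ and $\omega_o(x,y)={}^{\mathsf T}y\,\mathbf{J}x$. $\mathrm{Sp}(n,\mathbb{R})$ is the group of real $2n\times2n$ matrices $T$ with ${}^{\mathsf T}T\mathbf{J}T=\mathbf{J}$, and $\mathrm{U}(n)=\mathrm{Sp}(n,\mathbb{R})\cap\mathrm{SO}(2n)$, the centralizer of $\mathbf{J}$ in $\mathrm{Sp}(n,\mathbb R)$.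 The quotients $\mathrm{Sp}(n,\mathbb{R})/\mathrm{U}(n)$ and $\mathrm{GL}^+(2n,\mathbb{R})/\mathrm{SO}(2n)$ denote the spaces of cosets $[T]=HT$, with $H=\mathrm{U}(n)$ or $\mathrm{SO}(2n)$ respectively. The group $\mathrm{GL}^+(2n,\mathbb{R})\cong\mathrm{GL}^+(V)$ acts on metrics and skew forms by $b_\gamma(x,y)=b(\gamma x,\gamma y)$, $\omega_\gamma(x,y)=\omega(\gamma x,\gamma y)$. Complex $n\times n$ matrices $A+\mathrm{i}B$ are identified with real matrices $\begin{pmatrix}A&B\\-B&A\end{pmatrix}$; $Z^*$ is the conjugate transpose, and $\mathrm{Re}(Z)>0$ means that the real part of $Z$ is positive definite. Translates of the cone are taken under the natural action $b\mapsto{}^{\mathsf T}T\,b\,T$ of symplectic matrices on metrics.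
   Formalization: The fibres are translates of the cone of positive definite Hermitian Z; with Re(Z) read entrywise, K_n contains lines for n ≥ 2 and is not linearly isomorphic to that cone, so "isomorphic to K_n" is stated as a positively homogeneous homeomorphism. *)

theory Defs
  imports "HOL-Analysis.Analysis" "HOL-Algebra.Coset"
begin

section \<open>Metrics, symplectic forms and complex structures\<close>

type_synonym 'v form = "'v \<Rightarrow> 'v \<Rightarrow> real"

definition Met :: "'v::real_vector form set" where
  "Met = {b. bilinear b \<and> (\<forall>x y. b x y = b y x) \<and> (\<forall>x. x \<noteq> 0 \<longrightarrow> b x x > 0)}"

definition Symp :: "'v::real_vector form set" where
  "Symp = {\<omega>. bilinear \<omega> \<and> (\<forall>x y. \<omega> x y = - \<omega> y x) \<and> (\<forall>x. (\<forall>y. \<omega> x y = 0) \<longrightarrow> x = 0)}"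

definition complex_structure :: "('v::real_vector \<Rightarrow> 'v) \<Rightarrow> bool" where
  "complex_structure J \<longleftrightarrow> linear J \<and> (\<forall>x. J (J x) = - x)"

definition preserves :: "('v \<Rightarrow> 'v) \<Rightarrow> 'v form \<Rightarrow> bool" where
  "preserves J b \<longleftrightarrow> (\<forall>x y. b (J x) (J y) = b x y)"

definition bform :: "'v form \<Rightarrow> ('v \<Rightarrow> 'v) \<Rightarrow> 'v form" where
  "bform \<omega> J = (\<lambda>x y. \<omega> x (J y))"

definition tamed :: "'v::real_vector form \<Rightarrow> ('v \<Rightarrow> 'v) set" where
  "tamed \<omega> = {J. complex_structure J \<and> preserves J \<omega> \<and> (\<forall>x. x \<noteq> 0 \<longrightarrow> \<omega> x (J x) > 0)}"

definition compatible :: "'v::real_vector form \<Rightarrow> 'v form \<Rightarrow> ('v \<Rightarrow> 'v) \<Rightarrow> bool" where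
  "compatible b \<omega> J \<longleftrightarrow>
     complex_structure J \<and> preserves J b \<and> preserves J \<omega> \<and> bform \<omega> J \<in> Met"

definition rmap :: "'v::real_vector form \<times> 'v form \<Rightarrow> ('v \<Rightarrow> 'v)" where
  "rmap = (\<lambda>(b, \<omega>). THE J. compatible b \<omega> J)"

definition beta :: "'v form \<Rightarrow> ('v \<Rightarrow> 'v) \<Rightarrow> 'v form \<times> 'v form" where
  "beta \<omega> J = (bform \<omega> J, \<omega>)"

definition rho :: "'v::real_vector form \<times> 'v form \<Rightarrow> 'v form \<times> 'v form" where
  "rho = (\<lambda>(b, \<omega>). (bform \<omega> (rmap (b, \<omega>)), \<omega>))"

definition conformal :: "'v form \<Rightarrow> 'v form \<Rightarrow> bool" where
  "conformal b b' \<longleftrightarrow> (\<exists>c>0. \<forall>x y. b' x y = c * b x y)"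

definition CohPair :: "('v::real_vector form \<times> 'v form) set" where
  "CohPair = {(b, \<omega>). b \<in> Met \<and> \<omega> \<in> Symp \<and> conformal b (bform \<omega> (rmap (b, \<omega>)))}"

definition pull :: "('v \<Rightarrow> 'v) \<Rightarrow> 'v form \<Rightarrow> 'v form" where
  "pull \<gamma> b = (\<lambda>x y. b (\<gamma> x) (\<gamma> y))"

definition conj_cs :: "('v \<Rightarrow> 'v) \<Rightarrow> ('v \<Rightarrow> 'v) \<Rightarrow> ('v \<Rightarrow> 'v)" where
  "conj_cs \<gamma> J = inv_into UNIV \<gamma> \<circ> J \<circ> \<gamma>"


section \<open>Matrix groups\<close>

text \<open>The index type of the standard space of dimension \<open>2n\<close> is \<open>'n + 'n\<close>, so that
  a \<open>2n \<times> 2n\<close> matrix is literally a \<open>2 \<times> 2\<close> array of \<open>n \<times> n\<close> blocks.\<close>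

type_synonym ('a, 'm) sqmat = "'a^'m^'m"

definition block ::
  "('a, 'n) sqmat \<Rightarrow> ('a, 'n) sqmat \<Rightarrow> ('a, 'n) sqmat \<Rightarrow> ('a, 'n) sqmat \<Rightarrow> ('a, 'n::finite + 'n) sqmat" where
  "block A B C D = (\<chi> i j.
     case i of
       Inl k \<Rightarrow> (case j of Inl l \<Rightarrow> A $ k $ l | Inr l \<Rightarrow> B $ k $ l)
     | Inr k \<Rightarrow> (case j of Inl l \<Rightarrow> C $ k $ l | Inr l \<Rightarrow> D $ k $ l))"

definition Jstd :: "(real, 'n::finite + 'n) sqmat" where
  "Jstd = block 0 (mat 1) (- mat 1) 0"

definition omega_std :: "real^('n::finite + 'n) \<Rightarrow> real^('n + 'n) \<Rightarrow> real" where
  "omega_std x y = y \<bullet> (Jstd *v x)"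

abbreviation mat_monoid :: "(real, 'm::finite) sqmat set \<Rightarrow> (real, 'm) sqmat monoid" where
  "mat_monoid S \<equiv> \<lparr>carrier = S, mult = (**), one = mat 1\<rparr>"

definition GLp :: "(real, 'm::finite) sqmat monoid" where
  "GLp = mat_monoid {A. det A > 0}"

definition SO :: "(real, 'm::finite) sqmat set" where
  "SO = {A. rotation_matrix A}"

definition Sp :: "(real, 'n::finite + 'n) sqmat monoid" where
  "Sp = mat_monoid {T. transpose T ** Jstd ** T = Jstd}"

definition Ugrp :: "(real, 'n::finite + 'n) sqmat set" where
  "Ugrp = carrier Sp \<inter> SO"

text \<open>Since \<open>Ugrp \<subseteq> SO\<close>, the set product \<open>SO (Ugrp T)\<close> is the coset \<open>SO T\<close>: this is the map
  of coset spaces induced by the inclusion of groups.\<close>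

definition jmap :: "(real, 'n::finite + 'n) sqmat set \<Rightarrow> (real, 'n + 'n) sqmat set" where
  "jmap C = SO <#>\<^bsub>GLp\<^esub> C"

text \<open>The quotient topology on the space of cosets \<open>H T\<close> of a matrix group.\<close>

definition coset_topology ::
  "(real, 'm::finite) sqmat monoid \<Rightarrow> (real, 'm) sqmat set \<Rightarrow> (real, 'm) sqmat set topology" where
  "coset_topology G H = topology (\<lambda>U. U \<subseteq> rcosets\<^bsub>G\<^esub> H \<and>
     openin (top_of_set (carrier G)) {T \<in> carrier G. H #>\<^bsub>G\<^esub> T \<in> U})"


section \<open>Bases and coordinates\<close>

definition is_basis :: "('m::finite \<Rightarrow> 'v::real_vector) \<Rightarrow> bool" where
  "is_basis e \<longleftrightarrow> inj e \<and> independent (range e) \<and> span (range e) = UNIV"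

definition frame :: "('m::finite \<Rightarrow> 'v::real_vector) \<Rightarrow> real^'m \<Rightarrow> 'v" where
  "frame e x = (\<Sum>i\<in>UNIV. (x $ i) *\<^sub>R e i)"

definition coords :: "('m::finite \<Rightarrow> 'v::real_vector) \<Rightarrow> 'v \<Rightarrow> real^'m" where
  "coords e = inv_into UNIV (frame e)"

definition endo :: "('m::finite \<Rightarrow> 'v::real_vector) \<Rightarrow> (real, 'm) sqmat \<Rightarrow> 'v \<Rightarrow> 'v" where
  "endo e A = (\<lambda>v. frame e (A *v coords e v))"

definition form_of :: "('m::finite \<Rightarrow> 'v::real_vector) \<Rightarrow> (real, 'm) sqmat \<Rightarrow> 'v form" where
  "form_of e M = (\<lambda>v w. coords e v \<bullet> (M *v coords e w))"

definition symplectic_basis :: "'v form \<Rightarrow> ('n::finite + 'n \<Rightarrow> 'v::real_vector) \<Rightarrow> bool" where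
  "symplectic_basis \<omega> e \<longleftrightarrow>
     is_basis e \<and> (\<forall>x y. \<omega> (frame e x) (frame e y) = omega_std x y)"

text \<open>The usual topologies on the finite-dimensional spaces of bilinear forms and of
  endomorphisms, restricted to a subset; they do not depend on the basis \<open>e\<close>.\<close>

definition met_topology ::
  "('m::finite \<Rightarrow> 'v::real_vector) \<Rightarrow> ('v form \<times> 'v form) set \<Rightarrow> ('v form \<times> 'v form) topology" where
  "met_topology e S =
     pullback_topology S (\<lambda>p. (\<chi> i j. fst p (e i) (e j)) :: (real, 'm) sqmat) euclidean"

definition endo_topology ::
  "('m::finite \<Rightarrow> 'v::real_vector) \<Rightarrow> ('v \<Rightarrow> 'v) set \<Rightarrow> ('v \<Rightarrow> 'v) topology" where
  "endo_topology e S =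
     pullback_topology S (\<lambda>J. matrix (\<lambda>x. coords e (J (frame e x)))) euclidean"


section \<open>Actions and columns\<close>

text \<open>\<open>b\<^sub>\<gamma>(x, y) = b(\<gamma> x, \<gamma> y)\<close> satisfies \<open>b\<^sub>\<gamma>\<^sub>\<delta> = (b\<^sub>\<gamma>)\<^sub>\<delta>\<close>, hence the actions are right actions.\<close>

definition right_action :: "('g, 'z) monoid_scheme \<Rightarrow> 'x set \<Rightarrow> ('g \<Rightarrow> 'x \<Rightarrow> 'x) \<Rightarrow> bool" where
  "right_action G X act \<longleftrightarrow> Group.group G \<and>
     (\<forall>g\<in>carrier G. \<forall>x\<in>X. act g x \<in> X) \<and>
     (\<forall>x\<in>X. act \<one>\<^bsub>G\<^esub> x = x) \<and>
     (\<forall>g\<in>carrier G. \<forall>h\<in>carrier G. \<forall>x\<in>X. act (g \<otimes>\<^bsub>G\<^esub> h) x = act h (act g x))"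

definition pair_act :: "('m::finite \<Rightarrow> 'v::real_vector) \<Rightarrow> (real, 'm) sqmat \<times> (real, 'm) sqmat
    \<Rightarrow> 'v form \<times> 'v form \<Rightarrow> 'v form \<times> 'v form" where
  "pair_act e = (\<lambda>(g, h) (b, \<omega>). (pull (endo e g) b, pull (endo e h) \<omega>))"

type_synonym 'v column = "('v form \<times> 'v form) set \<times> ('v form \<times> 'v form) set \<times> ('v \<Rightarrow> 'v) set"

definition form_column :: "'v::real_vector form \<Rightarrow> 'v column" where
  "form_column \<omega> = (Met \<times> {\<omega>}, beta \<omega> ` tamed \<omega>, tamed \<omega>)"

text \<open>A pair \<open>(g, h)\<close> moves pairs of forms by \<open>pair_act\<close>, and complex structures
  by conjugation with its first component.\<close>

definition column_act :: "('m::finite \<Rightarrow> 'v::real_vector) \<Rightarrow> (real, 'm) sqmat \<times> (real, 'm) sqmat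
    \<Rightarrow> 'v column \<Rightarrow> 'v column" where
  "column_act e p = (\<lambda>(X, Y, Z).
     (pair_act e p ` X, pair_act e p ` Y, conj_cs (endo e (fst p)) ` Z))"


section \<open>Cones of Hermitian matrices\<close>

definition hermitian :: "(complex, 'n::finite) sqmat \<Rightarrow> bool" where
  "hermitian Z \<longleftrightarrow> (\<chi> i j. cnj (Z $ j $ i)) = Z"

definition Re_mat :: "(complex, 'n::finite) sqmat \<Rightarrow> (real, 'n) sqmat" where
  "Re_mat Z = (\<chi> i j. Re (Z $ i $ j))"

definition Im_mat :: "(complex, 'n::finite) sqmat \<Rightarrow> (real, 'n) sqmat" where
  "Im_mat Z = (\<chi> i j. Im (Z $ i $ j))"

definition Kcone :: "(complex, 'n::finite) sqmat set" where
  "Kcone = {Z. hermitian Z \<and> (\<forall>x. x \<noteq> 0 \<longrightarrow> x \<bullet> (Re_mat Z *v x) > 0)}"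

text \<open>\<open>Kcone\<close> takes ``real part positive definite'' literally, i.e. entrywise. The symmetric
  matrix \<open>realify Z\<close> is positive definite iff the Hermitian form \<open>z\<^sup>* Z z\<close> is, equivalently iff
  the real part \<open>(Z + Z\<^sup>*)/2\<close> in the operator sense is. This is a stronger condition when \<open>n \<ge> 2\<close>,
  and the two cones are then not linearly isomorphic, because \<open>Kcone\<close> contains affine lines.\<close>

definition herm_pos_cone :: "(complex, 'n::finite) sqmat set" where
  "herm_pos_cone = {Z. hermitian Z \<and>
     (\<forall>z. z \<noteq> 0 \<longrightarrow> Re (\<Sum>i\<in>UNIV. cnj (z $ i) * (Z *v z) $ i) > 0)}"

definition realify :: "(complex, 'n::finite) sqmat \<Rightarrow> (real, 'n + 'n) sqmat" where
  "realify Z = block (Re_mat Z) (Im_mat Z) (- Im_mat Z) (Re_mat Z)"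

text \<open>\<open>cone\<close> of the library requires \<open>0\<close> to belong to the set, which excludes the cones of positive definite matrices.\<close>

definition blunt_convex_cone :: "'a::real_vector set \<Rightarrow> bool" where
  "blunt_convex_cone C \<longleftrightarrow> C \<noteq> {} \<and> convex C \<and> (\<forall>x\<in>C. \<forall>t>0. t *\<^sub>R x \<in> C)"

text \<open>Positively homogeneous homeomorphism.\<close>

definition cone_isomorphic :: "'a::real_normed_vector set \<Rightarrow> 'b::real_normed_vector set \<Rightarrow> bool" where
  "cone_isomorphic C D \<longleftrightarrow> (\<exists>f g. homeomorphism C D f g \<and>
     (\<forall>x\<in>C. \<forall>t>0. f (t *\<^sub>R x) = t *\<^sub>R f x))"

end

theory Submission
  imports Defs
begin

text \<open>
  In a basis, metrics become positive definite matrices \<open>P\<close>, symplectic forms become invertible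
  skew matrices, and everything rests on the positive square root of a positive definite matrix:
  it exists, is unique, and commutes with every matrix that commutes with \<open>P\<close> (\<open>posdef_sqrt\<close>,
  \<open>posdef_sqrt_unique\<close>). These facts follow from the spectral theorem for self-adjoint maps,
  which is obtained by maximising the Rayleigh quotient.

  The complex structure attached to a pair of forms comes from a polar decomposition. If the
  metric is Euclidean and the symplectic form has the skew matrix \<open>S\<close>, then \<open>S K\<close> must be the
  positive root of \<open>- S\<^sup>2\<close>, which determines \<open>K\<close>; the general case follows by a change of basis
  (\<open>compatible_matrix_ex1\<close>). For a tamed \<open>J\<close> the metric \<open>b\<^bsub>\<omega>,J\<^esub>\<close> is itself compatible with \<open>\<omega>\<close> and \<open>J\<close>,
  so uniqueness gives \<open>r \<circ> \<beta> = id\<close>, the injectivity of \<open>\<beta>\<close>, and coherence with constant \<open>1\<close>.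

  A symplectic basis exists by Darboux' inductive construction. In such a basis the tamed
  structures are the \<open>J P\<close> with \<open>P\<close> positive definite and symplectic, and the root of such a \<open>P\<close> is
  again symplectic (\<open>symplectic_sqrt\<close>). Hence metrics and tamed structures are the images of
  \<open>GL\<^sup>+\<close> and \<open>Sp\<close> under \<open>T \<mapsto> T\<^sup>t T\<close> and \<open>T \<mapsto> T\<^sup>-\<^sup>1 J T = J T\<^sup>t T\<close>. The fibres of these maps are the
  cosets of \<open>SO\<close> and \<open>U\<close>, and both maps correspond to each other under \<open>\<beta>\<close> and \<open>j\<close>. That \<open>Sp\<close> lies
  in \<open>GL\<^sup>+\<close> at all is \<open>symplectic_det_pos\<close>. The bijections are homeomorphisms because \<open>T \<mapsto> T\<^sup>t T\<close> is
  a closed map: matrices with bounded Gram matrix are bounded (\<open>quotient_map_gram\<close>).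

  The group actions are treated without coordinates, by transport along a linear automorphism.

  For the fibres of \<open>r\<close>, conjugation by a symplectic \<open>T\<close> reduces to the structure \<open>Jstd\<close>, which
  preserves exactly the metrics \<open>M\<close> that commute with it; these are the realifications of the positive
  definite Hermitian matrices (\<open>fibre_rmap\<close>, \<open>realify_herm_pos_cone\<close>). Finally, that cone sits in
  \<open>Kcone\<close> as a family of open balls, one over each real part \<open>A\<close>, inside the space of all
  imaginary parts \<open>B\<close>; stretching the balls radially identifies the two cones
  (\<open>homeomorphism_herm_pos_cone_Kcone\<close>).
\<close>

declare transpose_matrix_vector [simp del] vector_transpose_matrix [simp del]

section \<open>Positive definite matrices and their square roots\<close>

lemma matrix_mult_minus_left [simp]: "(- A) ** B = - (A ** (B :: 'a^'p^'n))" for A :: "'a::ring_1^'n^'m"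
  by (simp add: matrix_matrix_mult_def vec_eq_iff sum_negf)

lemma matrix_mult_minus_right [simp]: "A ** (- B) = - (A ** (B :: 'a^'p^'n))" for A :: "'a::ring_1^'n^'m"
  by (simp add: matrix_matrix_mult_def vec_eq_iff sum_negf)

lemma transpose_minus [simp]: "transpose (- A) = - transpose (A :: 'a::ab_group_add^'n^'m)"
  by (simp add: transpose_def vec_eq_iff)

lemma transpose_diff: "transpose (A - B) = transpose A - transpose (B :: real^'n^'m)"
  by (simp add: transpose_def vec_eq_iff)

lemma matrix_vector_mult_minus [simp]: "(- A) *v x = - (A *v x)" for A :: "real^'n^'m"
  by (simp add: matrix_vector_mult_def vec_eq_iff sum_negf)

lemma inner_matrix_transpose: "(A *v x) \<bullet> y = x \<bullet> (transpose A *v y)" for A :: "real^'n^'m"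
  by (metis dot_lmul_matrix vector_transpose_matrix transpose_transpose)

lemma matrix_eqI_inner:
  fixes A B :: "real^'n^'m"
  assumes "\<And>x y. x \<bullet> (A *v y) = x \<bullet> (B *v y)"
  shows "A = B"
  by (metis assms matrix_eq vector_eq_rdot inner_commute)

lemma transpose_eqI:
  fixes A :: "real^'n^'n"
  assumes "\<And>x y. (A *v x) \<bullet> y = x \<bullet> (A *v y)"
  shows "transpose A = A"
  by (rule matrix_eqI_inner) (metis assms inner_matrix_transpose)

lemma matrix_inv_unique:
  fixes A B :: "real^'n^'n"
  assumes "A ** B = mat 1"
  shows "matrix_inv A = B"
proof -
  have "B ** A = mat 1" using assms matrix_left_right_inverse by blast
  then have "A ** matrix_inv A = mat 1 \<and> matrix_inv A ** A = mat 1"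
    unfolding matrix_inv_def using assms by (metis (mono_tags, lifting) someI_ex)
  then show ?thesis
    by (metis \<open>B ** A = mat 1\<close> matrix_mul_assoc matrix_mul_lid matrix_mul_rid)
qed

lemma matrix_inv_mult:
  fixes A :: "real^'n^'n"
  assumes "invertible A"
  shows "A ** matrix_inv A = mat 1" "matrix_inv A ** A = mat 1"
  using assms matrix_inv_unique unfolding invertible_def by metis+

lemma matrix_inv_cancel:
  fixes A :: "real^'n^'n"
  assumes "invertible A"
  shows "matrix_inv A ** (A ** B) = B" "A ** (matrix_inv A ** B) = B"
    "B ** matrix_inv A ** A = B" "B ** A ** matrix_inv A = B"
  using matrix_inv_mult[OF assms] by (simp_all add: matrix_mul_assoc) (simp_all add: matrix_mul_assoc[symmetric])

lemma invertible_matrix_inv: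
  fixes A :: "real^'n^'n"
  assumes "invertible A"
  shows "invertible (matrix_inv A)"
  using matrix_inv_mult[OF assms] invertible_def by blast

lemma matrix_inv_matrix_inv:
  fixes A :: "real^'n^'n"
  assumes "invertible A"
  shows "matrix_inv (matrix_inv A) = A"
  by (rule matrix_inv_unique) (simp add: matrix_inv_mult assms)

lemma matrix_inv_mul:
  fixes A B :: "real^'n^'n"
  assumes A: "invertible A" and B: "invertible B"
  shows "matrix_inv (A ** B) = matrix_inv B ** matrix_inv A"
proof (rule matrix_inv_unique)
  have "A ** B ** (matrix_inv B ** matrix_inv A) = A ** (B ** matrix_inv B) ** matrix_inv A"
    by (simp add: matrix_mul_assoc)
  then show "A ** B ** (matrix_inv B ** matrix_inv A) = mat 1"
    by (simp add: matrix_inv_mult A B)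
qed

lemma transpose_matrix_inv:
  fixes A :: "real^'n^'n"
  assumes "invertible A"
  shows "transpose (matrix_inv A) = matrix_inv (transpose A)"
  by (rule matrix_inv_unique[symmetric]) (metis assms matrix_inv_mult(2) matrix_transpose_mul transpose_mat)

definition posdef :: "real^'n^'n \<Rightarrow> bool" where
  "posdef M \<longleftrightarrow> transpose M = M \<and> (\<forall>x. x \<noteq> 0 \<longrightarrow> x \<bullet> (M *v x) > 0)"

lemma posdef_invertible: "posdef M \<Longrightarrow> invertible M"
  unfolding posdef_def invertible_left_inverse matrix_left_invertible_ker
  by (metis inner_zero_right less_irrefl)

lemma posdef_congruence:
  fixes M T :: "real^'n^'n"
  assumes "posdef M" "invertible T"
  shows "posdef (transpose T ** M ** T)"
  unfolding posdef_def
proof (intro conjI allI impI)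
  show "transpose (transpose T ** M ** T) = transpose T ** M ** T"
    using assms(1) by (simp add: posdef_def matrix_transpose_mul matrix_mul_assoc)
next
  fix x :: "real^'n" assume "x \<noteq> 0"
  then have "T *v x \<noteq> 0"
    using assms(2) unfolding invertible_left_inverse matrix_left_invertible_ker by blast
  then have "(T *v x) \<bullet> (M *v (T *v x)) > 0" using assms(1) posdef_def by blast
  then show "x \<bullet> ((transpose T ** M ** T) *v x) > 0"
    by (simp add: inner_matrix_transpose matrix_vector_mul_assoc matrix_mul_assoc)
qed

lemma posdef_mat1: "posdef (mat 1)"
  by (simp add: posdef_def)

lemma posdef_gram: "invertible T \<Longrightarrow> posdef (transpose T ** T)" for T :: "real^'n^'n"
  using posdef_congruence[OF posdef_mat1, of T] by simp

text \<open>A maximum of \<open>x \<bullet> f x\<close> on the unit sphere of the subspace is a critical point, hence an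
  eigenvector.\<close>

lemma selfadjoint_eigenvector:
  fixes f :: "'a::euclidean_space \<Rightarrow> 'a"
  assumes lin: "linear f" and sa: "\<And>x y. f x \<bullet> y = x \<bullet> f y"
    and S: "subspace S" "f ` S \<subseteq> S" "S \<noteq> {0}"
  obtains v l where "v \<in> S" "norm v = 1" "f v = l *\<^sub>R v"
proof -
  let ?C = "sphere 0 1 \<inter> S"
  obtain u where u: "u \<in> S" "u \<noteq> 0" using S subspace_0 by blast
  then have "(1 / norm u) *\<^sub>R u \<in> ?C" using S(1) by (simp add: subspace_scale)
  then have ne: "?C \<noteq> {}" by blast
  have "compact ?C" using S(1) by (simp add: closed_subspace compact_Int_closed)
  moreover have "continuous_on ?C (\<lambda>x. x \<bullet> f x)"
    by (intro continuous_intros linear_continuous_on linear_conv_bounded_linear[THEN iffD1] lin)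
  ultimately obtain v where v: "v \<in> ?C" and mx: "\<And>y. y \<in> ?C \<Longrightarrow> y \<bullet> f y \<le> v \<bullet> f v"
    using continuous_attains_sup[OF _ ne] by blast
  define l where "l = v \<bullet> f v"
  have nv: "v \<bullet> v = 1" using v by (simp add: dot_square_norm)
  have ge: "w \<bullet> f w \<le> l * (w \<bullet> w)" if "w \<in> S" for w
  proof (cases "w = 0")
    case False
    let ?w = "(1 / norm w) *\<^sub>R w"
    have "?w \<in> ?C" using that False S(1) by (simp add: subspace_scale)
    from mx[OF this] have "w \<bullet> f w / (norm w)\<^sup>2 \<le> l"
      by (simp add: linear_scale[OF lin] l_def power2_eq_square)
    then show ?thesis using False by (simp add: divide_simps dot_square_norm)
  qed (simp add: lin linear_0)
  have crit: "(l *\<^sub>R v - f v) \<bullet> w = 0" if w: "w \<in> S" for w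
  proof (rule ccontr)
    define a where "a = (l *\<^sub>R v - f v) \<bullet> w"
    define g where "g = l * (w \<bullet> w) - w \<bullet> f w"
    assume "(l *\<^sub>R v - f v) \<bullet> w \<noteq> 0"
    then have a: "a \<noteq> 0" by (simp add: a_def)
    have g: "g \<ge> 0" using ge[OF w] by (simp add: g_def)
    have q: "0 \<le> 2 * t * a + t\<^sup>2 * g" for t
    proof -
      have "v + t *\<^sub>R w \<in> S" using v w S(1) by (simp add: subspace_add subspace_scale)
      from ge[OF this]
      have "(v + t *\<^sub>R w) \<bullet> (f v + t *\<^sub>R f w) \<le> l * ((v + t *\<^sub>R w) \<bullet> (v + t *\<^sub>R w))"
        by (simp add: linear_add[OF lin] linear_scale[OF lin])
      moreover have e1: "(v + t *\<^sub>R w) \<bullet> (f v + t *\<^sub>R f w) = l + 2 * t * (f v \<bullet> w) + t\<^sup>2 * (w \<bullet> f w)"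
        unfolding l_def inner_add_left inner_add_right inner_scaleR_left inner_scaleR_right
          sa[of v w] sa[of w v, symmetric] inner_commute[of "f w" v]
        by (simp add: power2_eq_square algebra_simps)
      moreover have e2: "(v + t *\<^sub>R w) \<bullet> (v + t *\<^sub>R w) = 1 + 2 * t * (v \<bullet> w) + t\<^sup>2 * (w \<bullet> w)"
        unfolding inner_add_left inner_add_right inner_scaleR_left inner_scaleR_right
          nv inner_commute[of w v]
        by (simp add: power2_eq_square algebra_simps)
      ultimately have "l + 2 * t * (f v \<bullet> w) + t\<^sup>2 * (w \<bullet> f w) \<le> l * (1 + 2 * t * (v \<bullet> w) + t\<^sup>2 * (w \<bullet> w))"
        by (simp only: e1 e2)
      then show ?thesis
        by (simp add: a_def g_def inner_diff_left algebra_simps)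
    qed
    \<comment> \<open>A negative multiple of \<open>a\<close>, small enough for the linear term to dominate.\<close>
    define t where "t = - a / (g + 1)"
    have t: "t * (g + 1) = - a" using g by (simp add: t_def)
    have "(2 * t * a + t\<^sup>2 * g) * (g + 1) = t * (2 * (a * (g + 1)) + g * (t * (g + 1)))"
      by (simp add: power2_eq_square algebra_simps)
    also have "\<dots> = t * (2 * (a * (g + 1)) - g * a)" unfolding t by simp
    also have "\<dots> = a * (t * (g + 1)) + t * a" by (simp add: algebra_simps)
    finally have "(2 * t * a + t\<^sup>2 * g) * (g + 1) = - (a * a) + t * a" by (simp add: t)
    moreover have "t * a \<le> 0" using g by (simp add: t_def)
    moreover have "a * a > 0" using a not_real_square_gt_zero by blast
    moreover have "0 \<le> (2 * t * a + t\<^sup>2 * g) * (g + 1)" using q[of t] g by simp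
    ultimately show False by linarith
  qed
  have "l *\<^sub>R v - f v \<in> S" using v S by (simp add: subspace_diff subspace_scale image_subset_iff)
  from crit[OF this] have "f v = l *\<^sub>R v" by simp
  with v show ?thesis by (intro that) auto
qed

text \<open>The orthogonal complement, within the subspace, of an eigenvector is again invariant and has smaller
  dimension.\<close>

lemma selfadjoint_eigenbasis:
  fixes f :: "'a::euclidean_space \<Rightarrow> 'a"
  assumes lin: "linear f" and sa: "\<And>x y. f x \<bullet> y = x \<bullet> f y"
  shows "subspace S \<Longrightarrow> f ` S \<subseteq> S \<Longrightarrow>
    \<exists>B. pairwise orthogonal B \<and> (\<forall>v\<in>B. norm v = 1) \<and> span B = S \<and> (\<forall>v\<in>B. \<exists>l. f v = l *\<^sub>R v)"
proof (induction "dim S" arbitrary: S rule: less_induct)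
  case less
  show ?case
  proof (cases "S = {0}")
    case True
    then show ?thesis by (intro exI[of _ "{}"]) (auto simp: pairwise_def)
  next
    case False
    obtain v l where v: "v \<in> S" "norm v = 1" "f v = l *\<^sub>R v"
      using selfadjoint_eigenvector[OF lin sa less.prems False] by blast
    have vv: "v \<bullet> v = 1" using v by (simp add: dot_square_norm)
    let ?S = "{x \<in> S. x \<bullet> v = 0}"
    have sub: "subspace ?S"
      using less.prems(1) by (auto simp: subspace_def inner_add_left)
    have inv: "f ` ?S \<subseteq> ?S" using less.prems(2) by (auto simp: sa v)
    have "?S \<subset> S" using v vv by force
    then have "dim ?S < dim S"
      using dim_psubset[of ?S S] sub less.prems(1) by (simp add: span_eq_iff[THEN iffD2])
    from less.hyps[OF this sub inv] obtain B where
      B: "pairwise orthogonal B" "\<forall>v\<in>B. norm v = 1" "span B = ?S" "\<forall>v\<in>B. \<exists>l. f v = l *\<^sub>R v" by blast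
    have "B \<subseteq> ?S" using B(3) span_superset by blast
    then have orth: "pairwise orthogonal (insert v B)"
      using B(1) by (auto simp: pairwise_insert orthogonal_def inner_commute[of v])
    have span: "span (insert v B) = S"
    proof
      show "span (insert v B) \<subseteq> S"
        using v \<open>B \<subseteq> ?S\<close> less.prems(1) by (intro span_minimal) auto
      show "S \<subseteq> span (insert v B)"
      proof
        fix x assume x: "x \<in> S"
        have "x - (x \<bullet> v) *\<^sub>R v \<in> span B"
          using x v vv less.prems(1) unfolding B(3)
          by (simp add: subspace_diff subspace_scale inner_diff_left)
        then show "x \<in> span (insert v B)" by (auto simp: span_insert)
      qed
    qed
    have "\<forall>w\<in>insert v B. norm w = 1" using B(2) v(2) by blast
    moreover have "\<forall>w\<in>insert v B. \<exists>l. f w = l *\<^sub>R w" using B(4) v(3) by blast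
    ultimately show ?thesis using orth span by blast
  qed
qed

lemma symmetric_matrix_eigenbasis:
  fixes A :: "real^'n^'n"
  assumes "transpose A = A"
  obtains B where "pairwise orthogonal B" "\<forall>v\<in>B. norm v = 1" "span B = UNIV" "finite B"
    "\<forall>v\<in>B. A *v v = (v \<bullet> (A *v v)) *\<^sub>R v"
proof -
  obtain B where B: "pairwise orthogonal B" "\<forall>v\<in>B. norm v = 1" "span B = UNIV"
      and ev: "\<forall>v\<in>B. \<exists>l. A *v v = l *\<^sub>R v"
    using selfadjoint_eigenbasis[of "(*v) A" UNIV] inner_matrix_transpose[of A, unfolded assms] by auto
  have "0 \<notin> B" using B(2) by force
  then have "finite B"
    using B(1) independent_imp_finite pairwise_orthogonal_independent by blast
  moreover have "A *v v = (v \<bullet> (A *v v)) *\<^sub>R v" if v: "v \<in> B" for v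
  proof -
    obtain l where l: "A *v v = l *\<^sub>R v" using ev v by blast
    have "v \<bullet> v = 1" using B(2) v by (simp add: dot_square_norm)
    then show ?thesis unfolding l by simp
  qed
  ultimately show ?thesis using that B by blast
qed

text \<open>The root acts on the eigenspace of \<open>P\<close> for the eigenvalue \<open>a\<close> as multiplication by \<open>sqrt a\<close>. A matrix
  commuting with \<open>P\<close> preserves these eigenspaces, and therefore commutes with the root.\<close>

lemma posdef_sqrt:
  fixes P :: "real^'n^'n"
  assumes P: "posdef P"
  obtains S where "posdef S" "S ** S = P" "\<And>W. W ** P = P ** W \<Longrightarrow> W ** S = S ** W"
proof -
  obtain B where B: "pairwise orthogonal B" "\<forall>v\<in>B. norm v = 1" "span B = UNIV" "finite B"
      and ev: "\<forall>v\<in>B. P *v v = (v \<bullet> (P *v v)) *\<^sub>R v"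
    by (rule symmetric_matrix_eigenbasis[OF P[unfolded posdef_def, THEN conjunct1]])
  define l where "l v = v \<bullet> (P *v v)" for v
  have Pv: "P *v v = l v *\<^sub>R v" if "v \<in> B" for v using ev that unfolding l_def by blast
  have lpos: "l v > 0" if "v \<in> B" for v
  proof -
    have "v \<noteq> 0" using B(2) that norm_zero zero_neq_one by metis
    then show ?thesis using P unfolding posdef_def l_def by blast
  qed
  have expand: "(\<Sum>v\<in>B. (v \<bullet> x) *\<^sub>R v) = x" for x
    using orthonormal_basis_expand[OF B(1), of x] B(2-4) by (simp add: inner_commute)
  define g where "g x = (\<Sum>v\<in>B. (sqrt (l v) * (v \<bullet> x)) *\<^sub>R v)" for x
  have ling: "linear g"
    unfolding g_def
    by (intro linear_compose_sum ballI linearI) (simp_all add: inner_add_right distrib_left scaleR_left_distrib)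
  have gsym: "g x \<bullet> y = x \<bullet> g y" for x y
    unfolding g_def inner_sum_left inner_sum_right
    by (intro sum.cong) (simp_all add: inner_commute[of x])
  define S where "S = matrix g"
  have S: "S *v x = g x" for x unfolding S_def by (simp add: ling)
  have eig: "g u = sqrt a *\<^sub>R u" if u: "P *v u = a *\<^sub>R u" for u a
  proof -
    have "(sqrt (l w) * (w \<bullet> u)) *\<^sub>R w = sqrt a *\<^sub>R ((w \<bullet> u) *\<^sub>R w)" if w: "w \<in> B" for w
    proof -
      have "l w * (w \<bullet> u) = (P *v w) \<bullet> u" using Pv[OF w] by simp
      also have "\<dots> = w \<bullet> (P *v u)"
        by (simp only: inner_matrix_transpose P[unfolded posdef_def, THEN conjunct1])
      also have "\<dots> = a * (w \<bullet> u)" by (simp add: u)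
      finally have "w \<bullet> u = 0 \<or> l w = a" by simp
      then show ?thesis by auto
    qed
    then have "g u = (\<Sum>w\<in>B. sqrt a *\<^sub>R ((w \<bullet> u) *\<^sub>R w))" unfolding g_def by (intro sum.cong) auto
    also have "\<dots> = sqrt a *\<^sub>R u" by (simp only: scaleR_sum_right[symmetric] expand)
    finally show ?thesis .
  qed
  have ext: "M = N" if "\<And>v. v \<in> B \<Longrightarrow> M *v v = N *v v" for M N :: "real^'n^'n"
    unfolding matrix_eq
    using linear_eq_on_span[OF matrix_vector_mul_linear matrix_vector_mul_linear that] B(3) by blast
  have gv: "S *v v = sqrt (l v) *\<^sub>R v" if "v \<in> B" for v using eig[OF Pv[OF that]] S by simp
  have SS: "S ** S = P"
  proof (rule ext)
    fix v assume v: "v \<in> B"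
    have "(S ** S) *v v = (sqrt (l v) * sqrt (l v)) *\<^sub>R v"
      by (simp add: matrix_vector_mul_assoc[symmetric] gv[OF v] matrix_vector_mult_scaleR)
    also have "\<dots> = P *v v" using lpos[OF v] by (simp add: Pv[OF v])
    finally show "(S ** S) *v v = P *v v" .
  qed
  have pS: "posdef S"
    unfolding posdef_def
  proof (intro conjI allI impI)
    show "transpose S = S" by (rule transpose_eqI) (simp add: S gsym)
  next
    fix x :: "real^'n" assume "x \<noteq> 0"
    obtain w where w: "w \<in> B" "w \<bullet> x \<noteq> 0"
    proof (rule ccontr)
      assume "\<not> thesis"
      then have "\<forall>w\<in>B. (w \<bullet> x) *\<^sub>R w = 0" using that by auto
      then have "(\<Sum>v\<in>B. (v \<bullet> x) *\<^sub>R v) = 0" by (rule sum.neutral)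
      then show False using expand[of x] \<open>x \<noteq> 0\<close> by simp
    qed
    have "(v \<bullet> x)\<^sup>2 * sqrt (l v) \<ge> 0" if "v \<in> B" for v using lpos[OF that] by simp
    moreover have "(w \<bullet> x)\<^sup>2 * sqrt (l w) > 0" using lpos[OF w(1)] w(2) by simp
    ultimately have "(\<Sum>v\<in>B. (v \<bullet> x)\<^sup>2 * sqrt (l v)) > 0"
      by (intro sum_pos2[OF B(4) w(1)])
    moreover have "x \<bullet> (S *v x) = (\<Sum>v\<in>B. (v \<bullet> x)\<^sup>2 * sqrt (l v))"
      unfolding S g_def inner_sum_right
      by (intro sum.cong) (auto simp: power2_eq_square inner_commute[of x])
    ultimately show "x \<bullet> (S *v x) > 0" by simp
  qed
  have comm: "W ** S = S ** W" if W: "W ** P = P ** W" for W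
  proof (rule ext)
    fix v assume v: "v \<in> B"
    have "P *v (W *v v) = l v *\<^sub>R (W *v v)"
      by (simp add: matrix_vector_mul_assoc W[symmetric])
        (simp add: matrix_vector_mul_assoc[symmetric] Pv[OF v] matrix_vector_mult_scaleR)
    from eig[OF this] have "S *v (W *v v) = sqrt (l v) *\<^sub>R (W *v v)" by (simp only: S)
    then show "(W ** S) *v v = (S ** W) *v v"
      using v by (simp add: matrix_vector_mul_assoc[symmetric] gv matrix_vector_mult_scaleR)
  qed
  from pS SS comm show ?thesis by (rule that)
qed

text \<open>For square roots \<open>S\<close> and \<open>R\<close> of the same matrix, \<open>D = S - R\<close> satisfies \<open>S D + D R = 0\<close>; on an
  eigenvector of \<open>D\<close> this forces the eigenvalue to vanish.\<close>

lemma posdef_sqrt_unique: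
  fixes S R :: "real^'n^'n"
  assumes S: "posdef S" and R: "posdef R" and eq: "S ** S = R ** R"
  shows "S = R"
proof -
  let ?D = "S - R"
  have tr: "transpose ?D = ?D"
    using S R by (simp add: posdef_def transpose_diff)
  obtain B where B: "\<forall>v\<in>B. norm v = 1" "span B = UNIV"
      and ev: "\<forall>v\<in>B. ?D *v v = (v \<bullet> (?D *v v)) *\<^sub>R v"
    by (rule symmetric_matrix_eigenbasis[OF tr])
  have "?D *v v = 0" if v: "v \<in> B" for v
  proof -
    define m where "m = v \<bullet> (?D *v v)"
    have Dv: "?D *v v = m *\<^sub>R v" using ev v unfolding m_def by blast
    then have Sv: "S *v v = R *v v + m *\<^sub>R v"
      by (metis add_diff_cancel_left' diff_add_cancel matrix_vector_mult_diff_rdistrib add.commute)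
    have v0: "v \<noteq> 0" using B(1) v norm_zero zero_neq_one by metis
    have "S *v (S *v v) = R *v (R *v v)" by (simp add: matrix_vector_mul_assoc eq)
    then have "v \<bullet> (S *v (S *v v)) = v \<bullet> (R *v (R *v v))" by simp
    then have "(S *v v) \<bullet> (S *v v) = (R *v v) \<bullet> (R *v v)"
      using S R by (simp add: posdef_def inner_matrix_transpose)
    moreover have "(S *v v) \<bullet> (S *v v) = (R *v v + m *\<^sub>R v) \<bullet> (S *v v)" by (simp add: Sv)
    moreover have "(R *v v) \<bullet> (R *v v) = (R *v v) \<bullet> (S *v v - m *\<^sub>R v)" by (simp add: Sv)
    ultimately have "m * (v \<bullet> (S *v v) + v \<bullet> (R *v v)) = 0"
      by (simp add: inner_add_left inner_diff_right inner_commute[of "R *v v" v] distrib_left)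
    moreover have "v \<bullet> (S *v v) > 0" "v \<bullet> (R *v v) > 0" using S R v0 by (auto simp: posdef_def)
    ultimately have "m = 0" by auto
    then show ?thesis using Dv by simp
  qed
  then have "?D *v x = 0" for x
    using linear_eq_on_span[of "(*v) ?D" "(*v) 0" B x] B(2) by auto
  then show ?thesis by (simp add: matrix_eq matrix_vector_mult_diff_rdistrib)
qed

text \<open>The determinant is the square of the determinant of the root.\<close>

lemma posdef_det_pos:
  assumes "posdef P"
  shows "det P > 0"
proof -
  obtain S where S: "posdef S" "S ** S = P" using posdef_sqrt[OF assms] by metis
  have "det S \<noteq> 0" using posdef_invertible[OF S(1)] invertible_det_nz by blast
  then show ?thesis unfolding S(2)[symmetric] det_mul using not_real_square_gt_zero by blast
qed

section \<open>Block matrices and the symplectic group\<close>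

lemma matrix_add_rdistrib: "(A + B) ** C = A ** C + B ** C" for A :: "'a::semiring_1^'n^'m"
  by (simp add: matrix_matrix_mult_def vec_eq_iff sum.distrib distrib_right)

lemma transpose_add: "transpose (A + B) = transpose A + transpose (B :: 'a::ab_group_add^'n^'m)"
  by (simp add: transpose_def vec_eq_iff)

lemma mat_mult_component [simp]:
  "(mat c ** A) $ i $ j = c * A $ i $ j" "(A ** mat c) $ i $ j = A $ i $ j * (c :: 'a::semiring_1)"
  by (simp_all add: matrix_matrix_mult_def mat_def if_distrib if_distribR cong: if_cong)

lemma sum_UNIV_Plus:
  fixes f :: "'n::finite + 'm::finite \<Rightarrow> 'a::comm_monoid_add"
  shows "(\<Sum>x\<in>UNIV. f x) = (\<Sum>i\<in>UNIV. f (Inl i)) + (\<Sum>i\<in>UNIV. f (Inr i))"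
  by (simp add: UNIV_Plus_UNIV[symmetric] sum.Plus del: UNIV_Plus_UNIV)

lemma block_nth [simp]:
  "block A B C D $ Inl i $ Inl j = A $ i $ j" "block A B C D $ Inl i $ Inr j = B $ i $ j"
  "block A B C D $ Inr i $ Inl j = C $ i $ j" "block A B C D $ Inr i $ Inr j = D $ i $ j"
  by (simp_all add: block_def)

lemma vec_eq_iff_Plus:
  fixes x y :: "'a^('n::finite + 'm::finite)"
  shows "x = y \<longleftrightarrow> (\<forall>i. x $ Inl i = y $ Inl i) \<and> (\<forall>i. x $ Inr i = y $ Inr i)"
  unfolding vec_eq_iff by (metis sum.exhaust)

lemma block_eq_iff [simp]:
  "block A B C D = block A' B' C' D' \<longleftrightarrow> A = A' \<and> B = B' \<and> C = C' \<and> D = D'"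
  by (simp add: vec_eq_iff_Plus) (auto simp: vec_eq_iff)

lemma block_cases:
  obtains A B C D where "M = block A B C D"
proof
  show "M = block (\<chi> i j. M $ Inl i $ Inl j) (\<chi> i j. M $ Inl i $ Inr j)
    (\<chi> i j. M $ Inr i $ Inl j) (\<chi> i j. M $ Inr i $ Inr j)"
    by (simp add: vec_eq_iff_Plus)
qed

lemma block_mult:
  "block A B C D ** block A' B' C' D' =
     block (A ** A' + B ** C') (A ** B' + B ** D') (C ** A' + D ** C') (C ** B' + D ** D')"
  by (simp add: vec_eq_iff_Plus matrix_matrix_mult_def sum_UNIV_Plus)

lemma mat_block: "mat c = block (mat c) 0 0 (mat c)"
  by (simp add: vec_eq_iff_Plus) (simp add: mat_def)

lemma transpose_block: "transpose (block A B C D) =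
    block (transpose A) (transpose C) (transpose B) (transpose D)"
  by (simp add: vec_eq_iff_Plus transpose_def)

lemma minus_block: "- block A B C D = block (- A) (- B) (- C) (- (D :: 'a::ab_group_add^'n^'n))"
  by (simp add: vec_eq_iff_Plus)

lemma transpose_zero [simp]: "transpose 0 = 0"
  by (simp add: transpose_def vec_eq_iff)

lemma Jstd_square: "Jstd ** Jstd = - mat 1"
  by (simp add: Jstd_def block_mult mat_block[where c = "1::real"] minus_block)

lemma Jstd_cancel [simp]: "A ** Jstd ** Jstd = - A" "Jstd ** (Jstd ** A) = - A"
  by (simp_all add: matrix_mul_assoc[symmetric] Jstd_square)
    (simp add: matrix_mul_assoc Jstd_square)

lemma transpose_Jstd [simp]: "transpose Jstd = - Jstd"
  by (simp add: Jstd_def transpose_block minus_block)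

lemma commutes_Jstd_iff:
  "M ** Jstd = Jstd ** M \<longleftrightarrow> (\<exists>A B. M = block A B (- B) A)"
proof -
  obtain A B C D where M: "M = block A B C D" by (rule block_cases)
  show ?thesis
    unfolding M by (auto simp: Jstd_def block_mult)
qed

text \<open>The function \<open>h B = det (block 1 B 0 1)\<close> satisfies \<open>h (B + C) = h B * h C\<close> and, by conjugation
  with \<open>block 2 0 0 1\<close>, also \<open>h (2 B) = h B\<close>; hence \<open>(h B)\<^sup>2 = h B\<close>.\<close>

lemma det_block_unitriangular:
  fixes B :: "'a::field_char_0^'n^'n"
  shows "det (block (mat 1) B 0 (mat 1)) = 1"
proof -
  define h where "h B = det (block (mat 1) B 0 (mat 1))" for B :: "'a^'n^'n"
  have add: "h (B + C) = h B * h C" for B C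
    by (simp add: h_def det_mul[symmetric] block_mult add.commute)
  have "h 0 = 1" by (simp add: h_def mat_block[symmetric])
  then have nz: "h B \<noteq> 0" using add[of B "- B"] by auto
  let ?D = "block (mat 2) 0 0 (mat 1) :: 'a^('n+'n)^('n+'n)"
  let ?D' = "block (mat (1/2)) 0 0 (mat 1) :: 'a^('n+'n)^('n+'n)"
  have m2: "mat 2 ** (mat (1/2) :: 'a^'n^'n) = mat 1"
    by (simp add: vec_eq_iff) (simp add: mat_def)
  have m2': "mat 2 ** B = B + B"
    by (simp add: vec_eq_iff)
  have "?D ** ?D' = mat 1" by (simp add: block_mult m2 mat_block[symmetric])
  then have dd: "det ?D * det ?D' = 1" by (metis det_mul det_I)
  have "?D ** block (mat 1) B 0 (mat 1) ** ?D' = block (mat 1) (B + B) 0 (mat 1)"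
    by (simp add: block_mult m2 m2')
  then have "det ?D * h B * det ?D' = h (B + B)" unfolding h_def by (metis det_mul)
  then have "h B * (det ?D * det ?D') = h B * h B" by (simp only: add mult_ac)
  then have "h B = 1" using nz dd by simp
  then show ?thesis by (simp add: h_def)
qed

lemma det_map_matrix_of_real: "det (map_matrix complex_of_real M) = complex_of_real (det M)"
  by (simp add: det_def of_real_sum of_real_prod)

lemma det_map_matrix_cnj: "det (map_matrix cnj M) = cnj (det M)"
  by (simp add: det_def)

text \<open>Over \<open>\<complex>\<close> a matrix commuting with \<open>Jstd\<close> is similar to \<open>block Z B 0 (cnj Z)\<close> with \<open>Z = A + \<i> B\<close>,
  so its determinant is \<open>\<bar>det Z\<bar>\<^sup>2\<close>.\<close>

lemma det_commutes_Jstd_nonneg: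
  fixes M :: "real^('n::finite + 'n)^('n + 'n)"
  assumes "M ** Jstd = Jstd ** M"
  shows "det M \<ge> 0"
proof -
  obtain A B where M: "M = block A B (- B) A" using assms commutes_Jstd_iff by blast
  define a where "a = map_matrix complex_of_real A"
  define b where "b = map_matrix complex_of_real B"
  define f where "f X = det (block X 0 0 (mat 1))" for X :: "complex^'n^'n"
  let ?Z = "a + mat \<i> ** b" and ?Z' = "a - mat \<i> ** b"
  have cM: "map_matrix complex_of_real M = block a b (- b) a"
    by (simp add: vec_eq_iff_Plus M a_def b_def)
  let ?L = "block (mat 1) 0 (mat \<i>) (mat 1) :: complex^('n+'n)^('n+'n)"
  let ?L' = "block (mat 1) 0 (mat (- \<i>)) (mat 1) :: complex^('n+'n)^('n+'n)"
  have mm: "mat (- \<i>) + mat \<i> = (0 :: complex^'n^'n)" by (simp add: vec_eq_iff mat_def)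
  have "?L' ** ?L = mat 1" by (simp add: block_mult mm mat_block[symmetric])
  then have LL: "det ?L' * det ?L = 1" by (metis det_mul det_I)
  have "?L' ** block a b (- b) a ** ?L = block ?Z b 0 ?Z'"
    unfolding block_mult block_eq_iff by (simp add: vec_eq_iff algebra_simps)
  moreover have "block ?Z b 0 ?Z' =
      block (mat 1) 0 0 ?Z' ** block (mat 1) b 0 (mat 1) ** block ?Z 0 0 (mat 1)"
    by (simp add: block_mult)
  ultimately have "det (?L' ** block a b (- b) a ** ?L) = det (block (mat 1) 0 0 ?Z') * f ?Z"
    by (simp only: det_mul det_block_unitriangular f_def mult_1_right)
  moreover have "det (?L' ** block a b (- b) a ** ?L) = (det ?L' * det ?L) * det (block a b (- b) a)"
    unfolding det_mul by (simp only: mult_ac)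
  ultimately have 1: "det (block a b (- b) a) = det (block (mat 1) 0 0 ?Z') * f ?Z"
    unfolding LL by simp
  let ?K = "block 0 (mat 1) (mat 1) 0 :: complex^('n+'n)^('n+'n)"
  have "?K ** ?K = mat 1" by (simp add: block_mult mat_block[symmetric])
  then have KK: "det ?K * det ?K = 1" by (metis det_mul det_I)
  have "?K ** block (mat 1) 0 0 ?Z' ** ?K = block ?Z' 0 0 (mat 1)"
    by (simp add: block_mult)
  then have "f ?Z' = det ?K * det (block (mat 1) 0 0 ?Z') * det ?K" unfolding f_def by (metis det_mul)
  also have "\<dots> = det (block (mat 1) 0 0 ?Z') * (det ?K * det ?K)" by (simp only: mult_ac)
  finally have 2: "f ?Z' = det (block (mat 1) 0 0 ?Z')" by (simp add: KK)
  have "block ?Z' 0 0 (mat 1) = map_matrix cnj (block ?Z 0 0 (mat 1))"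
    by (simp add: vec_eq_iff_Plus a_def b_def) (simp add: mat_def)
  then have "f ?Z' = cnj (f ?Z)" by (simp add: f_def det_map_matrix_cnj)
  with 1 2 have "complex_of_real (det M) = cnj (f ?Z) * f ?Z"
    by (simp add: det_map_matrix_of_real[symmetric] cM)
  also have "\<dots> = complex_of_real ((cmod (f ?Z))\<^sup>2)"
    by (simp only: complex_norm_square mult.commute)
  finally have "det M = (cmod (f ?Z))\<^sup>2" by (simp only: of_real_eq_iff)
  then show ?thesis by simp
qed

definition symplectic :: "real^('n::finite + 'n)^('n + 'n) \<Rightarrow> bool" where
  "symplectic T \<longleftrightarrow> transpose T ** Jstd ** T = Jstd"

lemma symplectic_inv:
  assumes "symplectic T"
  shows "invertible T" "matrix_inv T = - (Jstd ** transpose T ** Jstd)"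
proof -
  have "(- (Jstd ** transpose T ** Jstd)) ** T = - (Jstd ** (transpose T ** Jstd ** T))"
    by (simp add: matrix_mul_assoc)
  also have "\<dots> = mat 1" using assms by (simp add: symplectic_def Jstd_square)
  finally have 1: "(- (Jstd ** transpose T ** Jstd)) ** T = mat 1" .
  then show "invertible T" using invertible_left_inverse by blast
  show "matrix_inv T = - (Jstd ** transpose T ** Jstd)"
    using 1 matrix_left_right_inverse matrix_inv_unique by blast
qed

lemma symplectic_mult: "symplectic S \<Longrightarrow> symplectic T \<Longrightarrow> symplectic (S ** T)"
  unfolding symplectic_def matrix_transpose_mul by (metis matrix_mul_assoc)

lemma symplectic_mat1: "symplectic (mat 1)"
  by (simp add: symplectic_def)

lemma symplectic_matrix_inv:
  assumes "symplectic T"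
  shows "symplectic (matrix_inv T)"
proof -
  note inv = symplectic_inv(1)[OF assms]
  have "transpose (matrix_inv T) ** (transpose T ** Jstd ** T) ** matrix_inv T = Jstd"
    by (simp add: matrix_mul_assoc matrix_inv_cancel inv transpose_matrix_inv
        matrix_inv_mult transpose_invertible)
  then show ?thesis using assms by (simp add: symplectic_def)
qed

text \<open>The identity \<open>T\<^sup>t T + 1 = T\<^sup>t (T - J T J)\<close> exhibits a positive definite matrix as a product of \<open>T\<^sup>t\<close>
  and a matrix commuting with \<open>J\<close>.\<close>

lemma symplectic_det_pos:
  assumes T: "symplectic T"
  shows "det T > 0"
proof -
  let ?N = "T - Jstd ** T ** Jstd"
  have "?N ** Jstd = Jstd ** ?N"
    unfolding diff_conv_add_uminus matrix_add_rdistrib matrix_add_ldistrib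
    by (simp add: matrix_mul_assoc Jstd_square)
  then have N: "det ?N \<ge> 0" by (rule det_commutes_Jstd_nonneg)
  have "transpose T ** ?N = transpose T ** T - transpose T ** Jstd ** T ** Jstd"
    unfolding diff_conv_add_uminus matrix_add_ldistrib by (simp add: matrix_mul_assoc)
  also have "\<dots> = transpose T ** T + mat 1"
    using T by (simp add: symplectic_def Jstd_square)
  finally have eq: "transpose T ** ?N = transpose T ** T + mat 1" .
  have "posdef (transpose T ** T)" by (rule posdef_gram[OF symplectic_inv(1)[OF T]])
  then have "posdef (transpose T ** T + mat 1)"
    by (auto simp: posdef_def transpose_add matrix_vector_mult_add_rdistrib inner_add_right add_pos_pos)
  from posdef_det_pos[OF this] have "det T * det ?N > 0"
    by (simp add: eq[symmetric] det_mul det_transpose)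
  with N show ?thesis by (simp add: zero_less_mult_iff)
qed

lemma posdef_matrix_inv:
  assumes "posdef S"
  shows "posdef (matrix_inv S)"
proof -
  note inv = posdef_invertible[OF assms]
  have "transpose (matrix_inv S) ** S ** matrix_inv S = transpose (matrix_inv S)"
    by (simp add: matrix_inv_cancel inv)
  also have "\<dots> = matrix_inv S" using assms by (simp add: transpose_matrix_inv inv posdef_def)
  finally show ?thesis using posdef_congruence[OF assms invertible_matrix_inv[OF inv]] by simp
qed

lemma Jstd_congruence_posdef: "posdef S \<Longrightarrow> posdef (- (Jstd ** S ** Jstd))"
  using posdef_congruence[of S Jstd] symplectic_inv(1)[of Jstd]
  by (simp add: symplectic_def Jstd_square)

text \<open>For symplectic \<open>P\<close> one has \<open>P\<^sup>-\<^sup>1 = - J P J\<close>. So if \<open>S\<close> is the root of \<open>P\<close>, then \<open>- J S\<^sup>-\<^sup>1 J\<close> is another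
  one, and the two coincide.\<close>

lemma symplectic_sqrt:
  assumes P: "posdef P" "symplectic P" and S: "posdef S" "S ** S = P"
  shows "symplectic S"
proof -
  note inv = posdef_invertible[OF S(1)] and invP = posdef_invertible[OF P(1)]
  let ?R = "- (Jstd ** matrix_inv S ** Jstd)"
  have R: "posdef ?R" by (intro Jstd_congruence_posdef posdef_matrix_inv S)
  have "?R ** ?R = - (Jstd ** (matrix_inv S ** matrix_inv S) ** Jstd)"
    by (simp add: matrix_mul_assoc)
  also have "matrix_inv S ** matrix_inv S = matrix_inv P"
    by (simp add: S(2)[symmetric] matrix_inv_mul inv)
  also have "matrix_inv P = - (Jstd ** P ** Jstd)"
    using symplectic_inv(2)[OF P(2)] P(1) by (simp add: posdef_def)
  also have "- (Jstd ** - (Jstd ** P ** Jstd) ** Jstd) = P"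
    by (simp add: matrix_mul_assoc Jstd_square)
  finally have "?R = S" using posdef_sqrt_unique[OF R S(1)] S(2) by simp
  then have "S ** Jstd ** ?R = S ** Jstd ** S" by simp
  then have "S ** Jstd ** S = Jstd"
    by (simp add: matrix_mul_assoc) (simp add: matrix_inv_mult inv)
  then show ?thesis using S(1) by (simp add: symplectic_def posdef_def)
qed

section \<open>The complex structure determined by a metric and a symplectic form\<close>

text \<open>The Gram matrices \<open>B\<close> and \<open>S\<close> of the two forms and the matrix \<open>K\<close> of the complex structure satisfy this
  condition iff the objects they represent satisfy \<open>compatible\<close>.\<close>

definition compatible_matrix :: "real^'m^'m \<Rightarrow> real^'m^'m \<Rightarrow> real^'m^'m \<Rightarrow> bool" where
  "compatible_matrix B S K \<longleftrightarrow> K ** K = - mat 1 \<and> transpose K ** B ** K = B \<and>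
     transpose K ** S ** K = S \<and> posdef (S ** K)"

text \<open>A change of basis, which will reduce an arbitrary metric to the Euclidean one.\<close>

lemma compatible_matrix_congruence:
  fixes B S K T :: "real^'n^'n"
  assumes T: "invertible T" and K: "compatible_matrix B S K"
  shows "compatible_matrix (transpose T ** B ** T) (transpose T ** S ** T) (matrix_inv T ** K ** T)"
proof -
  note Tt = transpose_invertible[OF T]
  note simps = matrix_mul_assoc matrix_inv_cancel[OF T] matrix_inv_cancel[OF Tt] matrix_inv_mult[OF T]
    matrix_inv_mult[OF Tt] transpose_matrix_inv[OF T] matrix_transpose_mul
  have "matrix_inv T ** K ** T ** (matrix_inv T ** K ** T) = matrix_inv T ** (K ** K) ** T"
    by (simp add: simps)
  also have "\<dots> = - mat 1" using K by (simp add: compatible_matrix_def matrix_inv_mult[OF T])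
  finally have 1: "matrix_inv T ** K ** T ** (matrix_inv T ** K ** T) = - mat 1" .
  have 2: "transpose (matrix_inv T ** K ** T) ** (transpose T ** C ** T) ** (matrix_inv T ** K ** T)
      = transpose T ** (transpose K ** C ** K) ** T" for C
    by (simp add: simps)
  have 3: "transpose T ** S ** T ** (matrix_inv T ** K ** T) = transpose T ** (S ** K) ** T"
    by (simp add: simps)
  show ?thesis
    unfolding compatible_matrix_def 2 3
    using K 1 posdef_congruence[OF _ T] by (auto simp: compatible_matrix_def)
qed

text \<open>An orthogonal \<open>K\<close> with \<open>K\<^sup>2 = - 1\<close> is skew, and then commutes with \<open>S\<close>. So \<open>S K\<close> is a positive definite
  root of \<open>- S\<^sup>2\<close>, of which there is only one.\<close>

lemma compatible_matrix_unique_Euclidean: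
  fixes S K L :: "real^'n^'n"
  assumes S: "invertible S" and K: "compatible_matrix (mat 1) S K" and L: "compatible_matrix (mat 1) S L"
  shows "K = L"
proof -
  have sq: "(S ** K) ** (S ** K) = - (S ** S)" if "compatible_matrix (mat 1) S K" for K
  proof -
    have orth: "transpose K ** K = mat 1" and sq: "K ** K = - mat 1" and c: "transpose K ** S ** K = S"
      using that by (auto simp: compatible_matrix_def)
    have "transpose K ** (K ** K) = (transpose K ** K) ** K" by (simp only: matrix_mul_assoc)
    then have "- transpose K = K" by (simp add: orth sq)
    then have tK: "transpose K = - K" by (metis minus_minus)
    have "K ** S ** K = - S" using c unfolding tK by (metis matrix_mult_minus_left minus_minus)
    then have "S ** (K ** S ** K) = - (S ** S)" by simp
    then show ?thesis by (simp only: matrix_mul_assoc)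
  qed
  have "S ** K = S ** L"
    using posdef_sqrt_unique[of "S ** K" "S ** L"] sq[OF K] sq[OF L] K L
    by (auto simp: compatible_matrix_def)
  then show ?thesis using matrix_inv_cancel(1)[OF S] by metis
qed

text \<open>With \<open>P\<close> the positive root of \<open>S\<^sup>t S = - S\<^sup>2\<close>, the matrix \<open>K = S\<^sup>-\<^sup>1 P\<close> is the inverse of the orthogonal
  factor in the polar decomposition of \<open>S\<close>. It has square \<open>- 1\<close> because \<open>P\<close> commutes with \<open>S\<close>.\<close>

lemma compatible_matrix_exists_Euclidean:
  fixes S :: "real^'n^'n"
  assumes S: "invertible S" and skew: "transpose S = - S"
  shows "\<exists>K. compatible_matrix (mat 1) S K"
proof -
  have "posdef (transpose S ** S)" by (rule posdef_gram[OF S])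
  then obtain P where P: "posdef P" "P ** P = transpose S ** S"
    and comm: "\<And>W. W ** (transpose S ** S) = (transpose S ** S) ** W \<Longrightarrow> W ** P = P ** W"
    by (rule posdef_sqrt) blast
  have PP: "P ** P = - (S ** S)" using P skew by simp
  have SP: "S ** P = P ** S" by (rule comm) (simp add: skew matrix_mul_assoc)
  let ?K = "matrix_inv S ** P"
  have PSi: "matrix_inv S ** P = P ** matrix_inv S"
  proof -
    have "matrix_inv S ** (S ** P) ** matrix_inv S = matrix_inv S ** (P ** S) ** matrix_inv S"
      by (simp only: SP)
    then show ?thesis by (simp add: matrix_mul_assoc matrix_inv_cancel[OF S] matrix_inv_mult[OF S])
  qed
  have KK: "?K ** ?K = - mat 1"
  proof -
    have "?K ** ?K = matrix_inv S ** (P ** matrix_inv S) ** P" by (simp add: matrix_mul_assoc)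
    also have "\<dots> = matrix_inv S ** (matrix_inv S ** P) ** P" by (simp only: PSi)
    also have "\<dots> = matrix_inv S ** matrix_inv S ** (P ** P)" by (simp add: matrix_mul_assoc)
    also have "\<dots> = - mat 1" unfolding PP
      by (simp add: matrix_mul_assoc matrix_inv_cancel[OF S] matrix_inv_mult[OF S])
    finally show ?thesis .
  qed
  have "transpose ?K = transpose P ** transpose (matrix_inv S)" by (simp add: matrix_transpose_mul)
  also have "transpose P = P" using P by (simp add: posdef_def)
  also have "transpose (matrix_inv S) = - matrix_inv S"
    unfolding transpose_matrix_inv[OF S] skew
    by (rule matrix_inv_unique) (simp add: matrix_inv_mult[OF S])
  finally have tK: "transpose ?K = - ?K" by (simp add: PSi)
  have "?K ** S ** ?K = P ** (matrix_inv S ** P)"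
    unfolding PSi by (simp add: matrix_mul_assoc matrix_inv_cancel[OF S])
  also have "\<dots> = (P ** P) ** matrix_inv S" unfolding PSi by (simp add: matrix_mul_assoc)
  also have "\<dots> = - S" by (simp add: PP matrix_inv_cancel[OF S])
  finally have KSK: "?K ** S ** ?K = - S" .
  have "S ** ?K = P" by (simp add: matrix_mul_assoc matrix_inv_mult[OF S])
  then have "compatible_matrix (mat 1) S ?K"
    unfolding compatible_matrix_def tK using P(1) KK KSK by simp
  then show ?thesis by blast
qed

text \<open>The inverse of the root \<open>R\<close> of \<open>B\<close> is a change of basis that turns \<open>B\<close> into the Euclidean metric.\<close>

lemma compatible_matrix_ex1:
  fixes B S :: "real^'n^'n"
  assumes B: "posdef B" and S: "invertible S" and skew: "transpose S = - S"
  shows "\<exists>!K. compatible_matrix B S K"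
proof -
  obtain R where R: "posdef R" "R ** R = B" using posdef_sqrt[OF B] by metis
  note inv = posdef_invertible[OF R(1)]
  let ?T = "matrix_inv R"
  have iT: "invertible ?T" by (rule invertible_matrix_inv[OF inv])
  have tT: "transpose ?T = ?T" using posdef_matrix_inv[OF R(1)] by (simp add: posdef_def)
  have tR: "transpose R = R" using R(1) by (simp add: posdef_def)
  let ?S = "transpose ?T ** S ** ?T"
  have B1: "transpose ?T ** B ** ?T = mat 1"
    by (simp add: R(2)[symmetric] tT matrix_mul_assoc matrix_inv_mult[OF inv])
  have S1: "invertible ?S" using iT S by (intro invertible_mult transpose_invertible)
  have S2: "transpose ?S = - ?S" using skew by (simp add: matrix_transpose_mul matrix_mul_assoc)
  have B3: "transpose R ** mat 1 ** R = B" by (simp add: tR R)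
  have S3: "transpose R ** ?S ** R = S"
    by (simp add: tT tR matrix_mul_assoc matrix_inv_mult[OF inv] matrix_inv_cancel[OF inv])
  obtain K where "compatible_matrix (mat 1) ?S K"
    using compatible_matrix_exists_Euclidean[OF S1 S2] by blast
  from compatible_matrix_congruence[OF inv this]
  have ex: "compatible_matrix B S (matrix_inv R ** K ** R)" unfolding B3 S3 .
  moreover have "L = M" if "compatible_matrix B S L" "compatible_matrix B S M" for L M
  proof -
    have "matrix_inv ?T ** L ** ?T = matrix_inv ?T ** M ** ?T"
      using that[THEN compatible_matrix_congruence[OF iT]] unfolding B1
      by (rule compatible_matrix_unique_Euclidean[OF S1])
    then have "matrix_inv R ** (R ** L ** matrix_inv R) ** R = matrix_inv R ** (R ** M ** matrix_inv R) ** R"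
      by (simp add: matrix_inv_matrix_inv[OF inv])
    then show ?thesis by (simp add: matrix_mul_assoc matrix_inv_mult[OF inv] matrix_inv_cancel[OF inv])
  qed
  ultimately show ?thesis by blast
qed

section \<open>Coordinates\<close>

lemma frame_add: "frame e (x + y) = frame e x + frame e y"
  by (simp add: frame_def scaleR_left_distrib sum.distrib)

lemma frame_scaleR: "frame e (c *\<^sub>R x) = c *\<^sub>R frame e x"
  by (simp add: frame_def scaleR_sum_right)

lemma linear_frame: "linear (frame e)"
  by (intro linearI frame_add frame_scaleR)

lemma frame_axis: "frame e (axis i 1) = e i"
proof -
  have "frame e (axis i 1) = (\<Sum>j\<in>UNIV. if j = i then e j else 0)"
    unfolding frame_def by (intro sum.cong) (auto simp: axis_def)
  then show ?thesis by simp
qed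

lemma range_eq_frame_image: "range e = frame e ` Basis"
  by (auto simp: Basis_vec_def frame_axis image_iff)

lemma inj_frame_imp_independent:
  assumes inj: "inj (frame e)"
  shows "inj e" "independent (range e)"
proof -
  show "inj e"
  proof (rule injI)
    fix i j assume "e i = e j"
    then have "frame e (axis i 1) = frame e (axis j 1)" by (simp add: frame_axis)
    then have "axis i (1::real) = axis j 1" using inj by (meson injD)
    then show "i = j" by (simp add: axis_eq_axis)
  qed
  show "independent (range e)"
    unfolding range_eq_frame_image
    by (rule linear_independent_injective_image[OF linear_frame independent_Basis])
      (simp add: span_Basis inj)
qed

lemma is_basis_iff_bij_frame: "is_basis e \<longleftrightarrow> bij (frame e)"
proof
  assume e: "is_basis e"
  have "x = 0" if "frame e x = 0" for x
  proof -
    have "(\<Sum>v\<in>range e. (x $ inv_into UNIV e v) *\<^sub>R v) = frame e x"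
      using e unfolding frame_def is_basis_def by (simp add: sum.reindex)
    then have "\<forall>v\<in>range e. x $ inv_into UNIV e v = 0"
      using independentD[of "range e" "range e" "\<lambda>v. x $ inv_into UNIV e v"] e that
      by (auto simp: is_basis_def)
    then show ?thesis using e by (simp add: vec_eq_iff is_basis_def)
  qed
  then have "inj (frame e)" using linear_injective_0[OF linear_frame] by blast
  moreover have "surj (frame e)"
  proof -
    have "v \<in> range (frame e)" for v
    proof -
      have "v \<in> span (range e)" using e by (simp add: is_basis_def)
      then obtain u where u: "v = (\<Sum>w\<in>range e. u w *\<^sub>R w)" by (auto simp: span_finite)
      also have "\<dots> = frame e (\<chi> i. u (e i))"
        using e by (simp add: frame_def is_basis_def sum.reindex)
      finally show ?thesis by blast
    qed
    then show ?thesis by blast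
  qed
  ultimately show "bij (frame e)" by (simp add: bij_def)
next
  assume b: "bij (frame e)"
  note ind = inj_frame_imp_independent[OF bij_is_inj[OF b]]
  have "span (range e) = UNIV"
    unfolding range_eq_frame_image linear_span_image[OF linear_frame] span_Basis using b by (simp add: bij_is_surj)
  then show "is_basis e" using ind by (simp add: is_basis_def)
qed

context
  fixes e :: "'m::finite \<Rightarrow> 'v::real_vector"
  assumes e: "is_basis e"
begin

lemma coords_frame: "coords e (frame e x) = x"
  using e unfolding coords_def is_basis_iff_bij_frame by (simp add: bij_is_inj)

lemma frame_coords: "frame e (coords e v) = v"
  using e unfolding coords_def is_basis_iff_bij_frame by (simp add: bij_is_surj surj_f_inv_f)

lemma linear_coords: "linear (coords e)"
  by (intro linearI; metis coords_frame frame_add frame_scaleR frame_coords)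

lemma coords_basis: "coords e (e i) = axis i 1"
  using coords_frame[of "axis i 1"] by (simp add: frame_axis)

lemma coords_eq_0_iff: "coords e v = 0 \<longleftrightarrow> v = 0"
  by (metis frame_coords coords_frame linear_0 linear_frame)

lemma form_of_entry: "form_of e M (e i) (e j) = M $ i $ j"
  by (simp add: form_of_def coords_basis matrix_vector_mul_component inner_axis'
      inner_axis)

lemma form_of_eq_iff: "form_of e M = form_of e N \<longleftrightarrow> M = N"
  by (metis form_of_entry vec_eq_iff)

lemma bilinear_form_of: "bilinear (form_of e M)"
  unfolding bilinear_def form_of_def
  by (auto intro!: linearI simp: linear_add[OF linear_coords] linear_scale[OF linear_coords]
      inner_add_left inner_add_right matrix_vector_right_distrib matrix_vector_mult_scaleR)

lemma form_of_gram:
  assumes b: "bilinear b"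
  shows "form_of e (\<chi> i j. b (e i) (e j)) = b"
proof (intro ext)
  fix v w
  have l: "linear (\<lambda>x. b x y)" "linear (b x)" for x y using b by (auto simp: bilinear_def)
  have "b (frame e x) (frame e y) = (\<Sum>i\<in>UNIV. \<Sum>j\<in>UNIV. x $ i * (y $ j * b (e i) (e j)))" for x y
  proof -
    have "b (frame e x) (frame e y) = (\<Sum>i\<in>UNIV. x $ i * b (e i) (frame e y))"
      unfolding frame_def[of e x] by (simp add: linear_sum[OF l(1)] linear_scale[OF l(1)])
    also have "\<dots> = (\<Sum>i\<in>UNIV. \<Sum>j\<in>UNIV. x $ i * (y $ j * b (e i) (e j)))"
      unfolding frame_def by (simp add: linear_sum[OF l(2)] linear_scale[OF l(2)] sum_distrib_left)
    finally show ?thesis .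
  qed
  from this[of "coords e v" "coords e w"]
  show "form_of e (\<chi> i j. b (e i) (e j)) v w = b v w"
    by (simp add: frame_coords form_of_def inner_vec_def matrix_vector_mult_def sum_distrib_left mult_ac)
qed

lemma form_of_in_Met_iff: "form_of e M \<in> Met \<longleftrightarrow> posdef M"
proof
  assume M: "form_of e M \<in> Met"
  have "M $ i $ j = M $ j $ i" for i j
    using M unfolding Met_def by (metis (mono_tags, lifting) form_of_entry mem_Collect_eq)
  then have "transpose M = M" by (simp add: vec_eq_iff transpose_def)
  moreover have "x \<bullet> (M *v x) > 0" if "x \<noteq> 0" for x
  proof -
    have "frame e x \<noteq> 0" using that by (metis coords_eq_0_iff coords_frame)
    then have "form_of e M (frame e x) (frame e x) > 0" using M by (simp add: Met_def)
    then show ?thesis by (simp add: form_of_def coords_frame)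
  qed
  ultimately show "posdef M" by (simp add: posdef_def)
next
  assume M: "posdef M"
  have "form_of e M x y = form_of e M y x" for x y
    unfolding form_of_def using M by (metis inner_commute inner_matrix_transpose posdef_def)
  moreover have "form_of e M x x > 0" if "x \<noteq> 0" for x
    unfolding form_of_def using M that coords_eq_0_iff posdef_def by blast
  ultimately show "form_of e M \<in> Met" by (simp add: Met_def bilinear_form_of)
qed

lemma Met_cases:
  assumes "b \<in> Met" obtains B where "posdef B" "b = form_of e B"
proof -
  have eq: "form_of e (\<chi> i j. b (e i) (e j)) = b"
    using assms by (intro form_of_gram) (simp add: Met_def)
  then have "posdef (\<chi> i j. b (e i) (e j))"
    by (simp only: form_of_in_Met_iff[symmetric] eq assms)
  then show ?thesis by (rule that) (rule eq[symmetric])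
qed

lemma Symp_cases:
  assumes \<sigma>: "\<sigma> \<in> Symp" obtains S where "invertible S" "transpose S = - S" "\<sigma> = form_of e S"
proof -
  let ?S = "\<chi> i j. \<sigma> (e i) (e j)"
  have eq: "\<sigma> = form_of e ?S" 
    by (rule form_of_gram[symmetric]) (use \<sigma> in \<open>unfold Symp_def, blast\<close>)
  have "transpose ?S $ i $ j = (- ?S) $ i $ j" for i j
  proof -
    have "\<sigma> (e j) (e i) = - \<sigma> (e i) (e j)" using \<sigma> unfolding Symp_def by blast
    then show ?thesis by (simp add: transpose_def)
  qed
  then have skew: "transpose ?S = - ?S" unfolding vec_eq_iff by blast
  have "x = 0" if "transpose ?S *v x = 0" for x
  proof -
    have "\<sigma> (frame e x) y = 0" for y
    proof -
      have "\<sigma> (frame e x) y = x \<bullet> (?S *v coords e y)"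
        by (subst eq) (simp only: form_of_def coords_frame)
      also have "\<dots> = (transpose ?S *v x) \<bullet> coords e y"
        by (simp only: inner_matrix_transpose transpose_transpose)
      finally show ?thesis by (simp only: that inner_zero_left)
    qed
    then have "frame e x = 0" using \<sigma> unfolding Symp_def by blast
    then show ?thesis by (metis coords_eq_0_iff coords_frame)
  qed
  then have "invertible (transpose ?S)"
    unfolding invertible_left_inverse matrix_left_invertible_ker by blast
  then have "invertible ?S" using transpose_invertible[of "transpose ?S"] by simp
  with eq skew that show ?thesis by blast
qed

lemma linear_endo: "linear (endo e A)"
  unfolding endo_def
  by (auto intro!: linearI simp: linear_add[OF linear_coords] linear_scale[OF linear_coords]
      matrix_vector_right_distrib matrix_vector_mult_scaleR frame_add frame_scaleR)

lemma endo_mult: "endo e (A ** B) = endo e A \<circ> endo e B"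
  by (simp add: endo_def fun_eq_iff coords_frame matrix_vector_mul_assoc)

lemma endo_mat1: "endo e (mat 1) = id"
  by (simp add: endo_def fun_eq_iff frame_coords)

lemma matrix_endo: "matrix (\<lambda>x. coords e (endo e A (frame e x))) = A"
  by (simp add: endo_def coords_frame matrix_of_matrix_vector_mul)

lemma endo_eq_iff: "endo e A = endo e B \<longleftrightarrow> A = B"
  by (metis matrix_endo)

lemma endo_matrix:
  assumes "linear J" shows "endo e (matrix (\<lambda>x. coords e (J (frame e x)))) = J"
proof -
  have "linear (\<lambda>x. coords e (J (frame e x)))"
    using linear_compose[OF linear_compose[OF linear_frame assms] linear_coords] by (simp add: o_def)
  then show ?thesis by (simp add: endo_def fun_eq_iff frame_coords)
qed

lemma endo_inverse:
  assumes "invertible A"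
  shows "endo e (matrix_inv A) \<circ> endo e A = id" "endo e A \<circ> endo e (matrix_inv A) = id"
  by (simp_all add: endo_mult[symmetric] matrix_inv_mult assms endo_mat1)

lemma inv_endo: "invertible A \<Longrightarrow> inv_into UNIV (endo e A) = endo e (matrix_inv A)"
  using endo_inverse by (metis inv_unique_comp)

lemma conj_cs_endo: "invertible g \<Longrightarrow> conj_cs (endo e g) (endo e K) = endo e (matrix_inv g ** K ** g)"
  by (simp add: conj_cs_def inv_endo endo_mult)

lemma complex_structure_endo_iff: "complex_structure (endo e K) \<longleftrightarrow> K ** K = - mat 1"
proof -
  have "endo e (- mat 1) = uminus"
    by (simp add: endo_def fun_eq_iff linear_neg[OF linear_frame] frame_coords)
  then have "complex_structure (endo e K) \<longleftrightarrow> endo e (K ** K) = endo e (- mat 1)"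
    by (simp add: complex_structure_def linear_endo endo_mult fun_eq_iff)
  then show ?thesis by (simp add: endo_eq_iff)
qed

lemma pull_form_of: "pull (endo e g) (form_of e M) = form_of e (transpose g ** M ** g)"
  by (simp add: pull_def form_of_def endo_def coords_frame fun_eq_iff inner_matrix_transpose
      matrix_vector_mul_assoc matrix_mul_assoc)

lemma preserves_form_of_iff: "preserves (endo e K) (form_of e M) \<longleftrightarrow> transpose K ** M ** K = M"
  by (simp add: form_of_eq_iff[symmetric] pull_form_of[symmetric] pull_def preserves_def fun_eq_iff)

lemma bform_form_of: "bform (form_of e S) (endo e K) = form_of e (S ** K)"
  by (simp add: bform_def form_of_def endo_def coords_frame fun_eq_iff matrix_vector_mul_assoc)

lemma compatible_endo_iff:
  "compatible (form_of e B) (form_of e S) (endo e K) \<longleftrightarrow> compatible_matrix B S K"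
  by (auto simp: compatible_def compatible_matrix_def complex_structure_endo_iff
      preserves_form_of_iff bform_form_of form_of_in_Met_iff)

lemma compatible_ex1:
  fixes b \<sigma> :: "'v form"
  assumes "b \<in> Met" "\<sigma> \<in> Symp"
  shows "\<exists>!J. compatible b \<sigma> J"
proof -
  obtain B where B: "posdef B" "b = form_of e B" using Met_cases[OF assms(1)] .
  obtain S where S: "invertible S" "transpose S = - S" "\<sigma> = form_of e S" using Symp_cases[OF assms(2)] .
  obtain K where K: "compatible_matrix B S K" and uniq: "\<forall>L. compatible_matrix B S L \<longrightarrow> L = K"
    using compatible_matrix_ex1[OF B(1) S(1,2)] unfolding Ex1_def by (elim exE conjE)
  show ?thesis
  proof (rule ex1I[of _ "endo e K"])
    show "compatible b \<sigma> (endo e K)" unfolding B(2) S(3) compatible_endo_iff by (rule K)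
  next
    fix J assume J: "compatible b \<sigma> J"
    let ?L = "matrix (\<lambda>x. coords e (J (frame e x)))"
    have L: "endo e ?L = J"
      using J by (intro endo_matrix) (simp add: compatible_def complex_structure_def)
    then have "compatible_matrix B S ?L"
      using J unfolding B(2) S(3) by (simp only: compatible_endo_iff[symmetric])
    then show "J = endo e K" using uniq L by metis
  qed
qed

end

section \<open>Symplectic bases\<close>

lemma omega_std_form: "omega_std x y = x \<bullet> (- Jstd *v y)"
  using inner_matrix_transpose[of Jstd x y] by (simp add: omega_std_def inner_commute)

lemma symplectic_basis_iff: "symplectic_basis \<omega> e \<longleftrightarrow> is_basis e \<and> \<omega> = form_of e (- Jstd)"
  unfolding symplectic_basis_def
  by (auto simp: fun_eq_iff form_of_def omega_std_form coords_frame) (metis frame_coords)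

lemma inj_frame_imp_is_basis:
  fixes e :: "'m::finite \<Rightarrow> 'v::real_vector"
  assumes dim: "dim (UNIV :: 'v set) = CARD('m)" and inj: "inj (frame e)"
  shows "is_basis e"
proof -
  note ind = inj_frame_imp_independent(2)[OF inj]
  have "inj e" by (rule inj_frame_imp_independent(1)[OF inj])
  then have card: "card (range e) = CARD('m)" by (simp add: card_image)
  obtain B :: "'v set" where B: "B \<subseteq> UNIV" "independent B" "UNIV \<subseteq> span B" "card B = dim (UNIV :: 'v set)"
    by (rule basis_exists[of "UNIV :: 'v set"])
  then have "card B > 0" using dim by simp
  then have "finite B" by (rule card_ge_0_finite)
  obtain C where C: "range e \<subseteq> C" "independent C" "UNIV \<subseteq> span C"
    by (rule maximal_independent_subset_extend[OF subset_UNIV ind])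
  have "finite C \<and> card C \<le> card B"
    using independent_span_bound[OF \<open>finite B\<close> C(2)] B(3) by blast
  then have "range e = C" using C(1) card B(4) dim by (intro card_seteq) auto
  then show ?thesis using ind C(3) \<open>inj e\<close> by (auto simp: is_basis_def)
qed

text \<open>Subtracting from \<open>y\<close> its components along a partial symplectic basis \<open>f, h\<close> makes it orthogonal to
  that basis. Applied to a vector outside the span and then to a partner of the result, this
  enlarges the partial basis by one pair.\<close>

lemma partial_symplectic_basis:
  fixes \<omega> :: "'v::real_vector form"
  assumes \<omega>: "\<omega> \<in> Symp" and dim: "dim (UNIV :: 'v set) = 2 * n"
  shows "k \<le> n \<Longrightarrow> \<exists>f h. \<forall>i<k. \<forall>j<k. \<omega> (f i) (h j) = (if i = j then 1 else 0) \<and>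
    \<omega> (f i) (f j) = 0 \<and> \<omega> (h i) (h j) = 0"
proof (induction k)
  case (Suc k)
  then obtain f h :: "nat \<Rightarrow> 'v" where fh: "\<And>i j. i < k \<Longrightarrow> j < k \<Longrightarrow> \<omega> (f i) (h j) = (if i = j then 1 else 0)"
    "\<And>i j. i < k \<Longrightarrow> j < k \<Longrightarrow> \<omega> (f i) (f j) = 0" "\<And>i j. i < k \<Longrightarrow> j < k \<Longrightarrow> \<omega> (h i) (h j) = 0"
    by (metis Suc_leD)
  have skew: "\<omega> x y = - \<omega> y x" for x y using \<omega> unfolding Symp_def by blast
  have lin: "linear (\<lambda>x. \<omega> x y)" "linear (\<omega> x)" for x y
    using \<omega> unfolding Symp_def bilinear_def by blast+
  have hf: "\<omega> (h i) (f j) = (if i = j then - 1 else 0)" if "i < k" "j < k" for i j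
    using fh(1)[OF that(2,1)] skew[of "h i" "f j"] by auto
  define p where "p y = y - (\<Sum>i<k. \<omega> y (h i) *\<^sub>R f i) + (\<Sum>i<k. \<omega> y (f i) *\<^sub>R h i)" for y
  have pl: "\<omega> (p y) x = \<omega> y x - (\<Sum>i<k. \<omega> y (h i) * \<omega> (f i) x) + (\<Sum>i<k. \<omega> y (f i) * \<omega> (h i) x)" for x y
    unfolding p_def
    by (simp add: linear_add[OF lin(1)] linear_diff[OF lin(1)] linear_sum[OF lin(1)] linear_scale[OF lin(1)])
  have ph: "\<omega> (p y) (h j) = 0" if "j < k" for y j
  proof -
    have "(\<Sum>i<k. \<omega> y (h i) * \<omega> (f i) (h j)) = (\<Sum>i<k. if i = j then \<omega> y (h i) else 0)"
      using that by (intro sum.cong) (auto simp: fh)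
    moreover have "(\<Sum>i<k. \<omega> y (f i) * \<omega> (h i) (h j)) = 0"
      using that by (intro sum.neutral) (auto simp: fh)
    ultimately show ?thesis using that by (simp add: pl)
  qed
  have pf: "\<omega> (p y) (f j) = 0" if "j < k" for y j
  proof -
    have "(\<Sum>i<k. \<omega> y (f i) * \<omega> (h i) (f j)) = (\<Sum>i<k. if i = j then - \<omega> y (f i) else 0)"
      using that by (intro sum.cong) (auto simp: hf)
    moreover have "(\<Sum>i<k. \<omega> y (h i) * \<omega> (f i) (f j)) = 0"
      using that by (intro sum.neutral) (auto simp: fh)
    ultimately show ?thesis using that by (simp add: pl)
  qed
  let ?A = "f ` {..<k} \<union> h ` {..<k}"
  have "card ?A \<le> card (f ` {..<k}) + card (h ` {..<k})" by (rule card_Un_le)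
  also have "\<dots> \<le> k + k" 
    using card_image_le[of "{..<k}" f] card_image_le[of "{..<k}" h] by simp
  also have "\<dots> < 2 * n" using Suc.prems by simp
  finally have "card ?A < 2 * n" .
  have "span ?A \<noteq> UNIV"
  proof
    assume "span ?A = UNIV"
    then have "dim (UNIV :: 'v set) \<le> card ?A" by (intro dim_le_card) auto
    then show False using \<open>card ?A < 2 * n\<close> dim by simp
  qed
  then obtain y where y: "y \<notin> span ?A" by blast
  have "p y \<noteq> 0"
  proof
    assume "p y = 0"
    then have "y = (\<Sum>i<k. \<omega> y (h i) *\<^sub>R f i) - (\<Sum>i<k. \<omega> y (f i) *\<^sub>R h i)"
      by (simp add: p_def algebra_simps eq_neg_iff_add_eq_0)
    moreover have "\<dots> \<in> span ?A"
      by (intro span_diff span_sum span_scale span_base) auto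
    ultimately show False using y by simp
  qed
  then obtain z where z: "\<omega> (p y) z \<noteq> 0" using \<omega> unfolding Symp_def by blast
  let ?z = "(1 / \<omega> (p y) z) *\<^sub>R z"
  have pz: "\<omega> (p y) (p ?z) = 1"
  proof -
    have "\<omega> (p y) (p ?z) = \<omega> (p y) ?z"
      unfolding p_def[of ?z]
      by (simp add: linear_add[OF lin(2)] linear_diff[OF lin(2)] linear_sum[OF lin(2)]
          linear_scale[OF lin(2)] pf ph)
    then show ?thesis using z by (simp add: linear_scale[OF lin(2)])
  qed
  have zero: "\<omega> x x = 0" for x using skew[of x x] by simp
  let ?f = "f(k := p y)" and ?h = "h(k := p ?z)"
  have "\<omega> (?f i) (?h j) = (if i = j then 1 else 0) \<and> \<omega> (?f i) (?f j) = 0 \<and> \<omega> (?h i) (?h j) = 0"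
    if "i < Suc k" "j < Suc k" for i j
  proof -
    have a: "\<omega> (f j) (p x) = 0" "\<omega> (h j) (p x) = 0" if "j < k" for j x
      using pf[OF that] ph[OF that] skew by (metis minus_zero)+
    show ?thesis
      using that fh[of i j] by (auto simp: less_Suc_eq pz zero pf ph a)
  qed
  then show ?case by blast
qed simp

lemma symplectic_basis_exists:
  fixes \<omega> :: "'v::real_vector form"
  assumes \<omega>: "\<omega> \<in> Symp" and dim: "dim (UNIV :: 'v set) = 2 * CARD('n::finite)"
  shows "\<exists>e :: 'n + 'n \<Rightarrow> 'v. symplectic_basis \<omega> e"
proof -
  let ?n = "CARD('n)"
  obtain f h :: "nat \<Rightarrow> 'v" where fh: "\<And>i j. i < ?n \<Longrightarrow> j < ?n \<Longrightarrow> \<omega> (f i) (h j) = (if i = j then 1 else 0)"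
    "\<And>i j. i < ?n \<Longrightarrow> j < ?n \<Longrightarrow> \<omega> (f i) (f j) = 0" "\<And>i j. i < ?n \<Longrightarrow> j < ?n \<Longrightarrow> \<omega> (h i) (h j) = 0"
    using partial_symplectic_basis[OF \<omega> dim order_refl] by metis
  obtain \<phi> where \<phi>: "bij_betw \<phi> (UNIV :: 'n set) {0..<?n}"
    using ex_bij_betw_finite_nat[OF finite[of "UNIV :: 'n set"]] by (elim exE)
  have lt: "\<phi> i < ?n" for i using bij_betwE[OF \<phi>] by simp
  have eq: "\<phi> i = \<phi> j \<longleftrightarrow> i = j" for i j using bij_betw_imp_inj_on[OF \<phi>] by (simp add: inj_eq)
  have skew: "\<omega> x y = - \<omega> y x" for x y using \<omega> unfolding Symp_def by blast
  have hf: "\<omega> (h i) (f j) = (if i = j then - 1 else 0)" if "i < ?n" "j < ?n" for i j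
    using fh(1)[OF that(2,1)] skew[of "h i" "f j"] by auto
  \<comment> \<open>Since \<open>omega_std x y = y \<bullet> (Jstd *v x)\<close> is \<open>1\<close> for \<open>x = axis (Inr i) 1\<close> and \<open>y = axis (Inl i) 1\<close>, the family
    \<open>h\<close> has to come first.\<close>
  define e where "e = case_sum (h \<circ> \<phi>) (f \<circ> \<phi>)"
  have gram: "(\<chi> i j. \<omega> (e i) (e j)) = - Jstd"
    unfolding Jstd_def minus_block
    by (simp add: vec_eq_iff_Plus e_def fh hf lt eq mat_def)
  have bil: "bilinear \<omega>" using \<omega> unfolding Symp_def by blast
  have lin: "linear (\<lambda>x. \<omega> x y)" for y using bil by (simp add: bilinear_def)
  have "x = 0" if "frame e x = 0" for x
  proof -
    have "(transpose (- Jstd) *v x) $ j = 0" for j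
    proof -
      have "0 = \<omega> (frame e x) (e j)" using that linear_0[OF lin] by simp
      also have "\<dots> = (\<Sum>i\<in>UNIV. x $ i * \<omega> (e i) (e j))"
        unfolding frame_def by (simp add: linear_sum[OF lin] linear_scale[OF lin])
      also have "\<dots> = (transpose (- Jstd) *v x) $ j"
        unfolding gram[symmetric] by (simp add: matrix_vector_mult_def transpose_def mult.commute)
      finally show ?thesis by simp
    qed
    then have "Jstd *v x = 0" by (simp add: vec_eq_iff)
    then have "Jstd *v (Jstd *v x) = 0" by simp
    then show ?thesis by (simp add: matrix_vector_mul_assoc Jstd_square)
  qed
  then have "inj (frame e)" using linear_injective_0[OF linear_frame] by blast
  then have e: "is_basis e" by (intro inj_frame_imp_is_basis) (simp_all add: dim)
  then have "\<omega> = form_of e (- Jstd)" using form_of_gram[OF e bil] gram by simp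
  with e show ?thesis using symplectic_basis_iff by blast
qed

section \<open>Tamed complex structures and compatible metrics\<close>

lemma compatible_imp_tamed: "compatible b \<sigma> J \<Longrightarrow> J \<in> tamed \<sigma>"
  unfolding compatible_def tamed_def bform_def Met_def by blast

text \<open>Invariance under \<open>J\<close> turns \<open>\<sigma> x (J y)\<close> into \<open>- \<sigma> (J x) y = \<sigma> y (J x)\<close>, so the taming condition makes the form
  a metric.\<close>

lemma tamed_imp_compatible:
  assumes J: "J \<in> tamed \<sigma>" and \<sigma>: "\<sigma> \<in> Symp"
  shows "compatible (bform \<sigma> J) \<sigma> J"
proof -
  have lin: "linear J" and JJ: "J (J x) = - x" and pres: "\<sigma> (J x) (J y) = \<sigma> x y"
    and pos: "x \<noteq> 0 \<Longrightarrow> \<sigma> x (J x) > 0" for x y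
    using J by (auto simp: tamed_def complex_structure_def preserves_def)
  have bil: "bilinear \<sigma>" and skew: "\<sigma> x y = - \<sigma> y x" for x y
    using \<sigma> unfolding Symp_def by blast+
  have l: "linear (\<lambda>x. \<sigma> x y)" "linear (\<sigma> x)" for x y using bil by (auto simp: bilinear_def)
  have "linear (\<lambda>y. \<sigma> x (J y))" for x
    using linear_compose[OF lin l(2)] by (simp add: o_def)
  then have "bilinear (bform \<sigma> J)"
    using l(1) by (simp add: bilinear_def bform_def)
  moreover have "\<sigma> x (J y) = \<sigma> y (J x)" for x y
  proof -
    have "\<sigma> x (J y) = \<sigma> (J x) (- y)" using pres[of x "J y"] by (simp add: JJ)
    also have "\<dots> = - \<sigma> (J x) y" by (rule linear_neg[OF l(2)])
    also have "\<dots> = \<sigma> y (J x)" using skew[of y "J x"] by simp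
    finally show ?thesis .
  qed
  ultimately have "bform \<sigma> J \<in> Met" using pos unfolding Met_def bform_def by blast
  then show ?thesis
    using J by (simp add: compatible_def tamed_def preserves_def bform_def)
qed

lemma bform_tamed_Met: "J \<in> tamed \<sigma> \<Longrightarrow> \<sigma> \<in> Symp \<Longrightarrow> bform \<sigma> J \<in> Met"
  using tamed_imp_compatible compatible_def by blast

context
  fixes e :: "'m::finite \<Rightarrow> 'v::real_vector"
  assumes e: "is_basis e"
begin

lemma rmap_eq_iff:
  fixes b \<sigma> :: "'v form"
  assumes "b \<in> Met" "\<sigma> \<in> Symp"
  shows "rmap (b, \<sigma>) = J \<longleftrightarrow> compatible b \<sigma> J"
proof -
  note ex1 = compatible_ex1[OF e assms]
  have "compatible b \<sigma> (rmap (b, \<sigma>))" unfolding rmap_def prod.case by (rule theI'[OF ex1])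
  then show ?thesis using ex1 by (metis (no_types))
qed

lemma rmap_compatible:
  fixes b \<sigma> :: "'v form"
  assumes "b \<in> Met" "\<sigma> \<in> Symp"
  shows "compatible b \<sigma> (rmap (b, \<sigma>))"
  using rmap_eq_iff[OF assms] by blast

lemma rmap_tamed:
  fixes b \<sigma> :: "'v form"
  assumes "b \<in> Met" "\<sigma> \<in> Symp"
  shows "rmap (b, \<sigma>) \<in> tamed \<sigma>"
  using rmap_compatible[OF assms] by (rule compatible_imp_tamed)

lemma rmap_beta:
  fixes \<sigma> :: "'v form"
  assumes "\<sigma> \<in> Symp" "J \<in> tamed \<sigma>"
  shows "rmap (beta \<sigma> J) = J"
  unfolding beta_def using assms
  by (simp add: rmap_eq_iff bform_tamed_Met tamed_imp_compatible)

lemma beta_CohPair: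
  fixes \<sigma> :: "'v form"
  assumes "\<sigma> \<in> Symp" "J \<in> tamed \<sigma>"
  shows "beta \<sigma> J \<in> CohPair"
proof -
  have "rmap (bform \<sigma> J, \<sigma>) = J" using rmap_beta[OF assms] by (simp add: beta_def)
  moreover have "conformal (bform \<sigma> J) (bform \<sigma> J)"
    unfolding conformal_def by (rule exI[of _ 1]) simp
  ultimately show ?thesis using assms by (simp add: CohPair_def beta_def bform_tamed_Met)
qed

lemma rho_eq_beta_rmap: "rho (b, \<sigma>) = beta \<sigma> (rmap (b, \<sigma>))" for b \<sigma> :: "'v form"
  by (simp add: rho_def beta_def)

end

subsection \<open>Naturality under linear automorphisms\<close>

context
  fixes \<gamma> \<delta> :: "'v::real_vector \<Rightarrow> 'v"
  assumes lin: "linear \<gamma>" "linear \<delta>" and inverse: "\<And>x. \<delta> (\<gamma> x) = x" "\<And>x. \<gamma> (\<delta> x) = x"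
begin

lemma conj_cs_eq: "conj_cs \<gamma> J = \<delta> \<circ> J \<circ> \<gamma>"
proof -
  have "inv_into UNIV \<gamma> = \<delta>" by (rule inv_equality[OF inverse])
  then show ?thesis by (simp add: conj_cs_def)
qed

lemma pull_bilinear:
  assumes b: "bilinear b" shows "bilinear (pull \<gamma> b)"
  unfolding bilinear_def pull_def
proof (intro conjI allI)
  fix x
  have l: "linear (b (\<gamma> x))" "linear (\<lambda>y. b y (\<gamma> x))" using b by (simp_all add: bilinear_def)
  show "linear (\<lambda>y. b (\<gamma> x) (\<gamma> y))" using linear_compose[OF lin(1) l(1)] by (simp add: o_def)
  show "linear (\<lambda>y. b (\<gamma> y) (\<gamma> x))" using linear_compose[OF lin(1) l(2)] by (simp add: o_def)
qed

lemma pull_Met: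
  assumes "b \<in> Met" shows "pull \<gamma> b \<in> Met"
proof -
  have "\<gamma> x \<noteq> 0" if "x \<noteq> 0" for x using that inverse(1)[of x] linear_0[OF lin(2)] by metis
  then show ?thesis using assms pull_bilinear[of b] unfolding Met_def mem_Collect_eq
    by (simp add: pull_def)
qed

lemma pull_Symp:
  assumes "\<sigma> \<in> Symp" shows "pull \<gamma> \<sigma> \<in> Symp"
proof -
  have "x = 0" if "\<forall>y. \<sigma> (\<gamma> x) (\<gamma> y) = 0" for x
  proof -
    have "\<forall>y. \<sigma> (\<gamma> x) y = 0" using that inverse(2) by metis
    then have "\<gamma> x = 0" using assms unfolding Symp_def by blast
    then show ?thesis using inverse(1)[of x] linear_0[OF lin(2)] by metis
  qed
  then have "\<forall>x. (\<forall>y. pull \<gamma> \<sigma> x y = 0) \<longrightarrow> x = 0" by (simp add: pull_def)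
  moreover have "\<forall>x y. pull \<gamma> \<sigma> x y = - pull \<gamma> \<sigma> y x"
    using assms unfolding Symp_def pull_def by blast
  moreover have "bilinear \<sigma>" using assms unfolding Symp_def by blast
  ultimately show ?thesis using pull_bilinear[of \<sigma>] unfolding Symp_def mem_Collect_eq by (intro conjI)
qed

lemma complex_structure_conj_cs:
  assumes "complex_structure J" shows "complex_structure (conj_cs \<gamma> J)"
proof -
  have J: "linear J" "J (J x) = - x" for x using assms by (auto simp: complex_structure_def)
  have "linear (\<delta> \<circ> (J \<circ> \<gamma>))" by (intro linear_compose lin J)
  then show ?thesis
    by (simp add: complex_structure_def conj_cs_eq o_assoc inverse J linear_neg[OF lin(2)])
qed

lemma preserves_conj_cs: "preserves J b \<Longrightarrow> preserves (conj_cs \<gamma> J) (pull \<gamma> b)"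
  unfolding preserves_def conj_cs_eq pull_def by (simp add: inverse)

lemma bform_pull: "bform (pull \<gamma> \<sigma>) (conj_cs \<gamma> J) = pull \<gamma> (bform \<sigma> J)"
  unfolding bform_def conj_cs_eq pull_def by (simp add: inverse)

lemma compatible_conj_cs: "compatible b \<sigma> J \<Longrightarrow> compatible (pull \<gamma> b) (pull \<gamma> \<sigma>) (conj_cs \<gamma> J)"
  unfolding compatible_def
  by (simp add: complex_structure_conj_cs preserves_conj_cs bform_pull pull_Met)

lemma tamed_conj_cs:
  assumes "J \<in> tamed \<sigma>" shows "conj_cs \<gamma> J \<in> tamed (pull \<gamma> \<sigma>)"
proof -
  have "pull \<gamma> \<sigma> x (conj_cs \<gamma> J x) > 0" if "x \<noteq> 0" for x
  proof -
    have "\<gamma> x \<noteq> 0" using that inverse(1)[of x] linear_0[OF lin(2)] by metis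
    moreover have "pull \<gamma> \<sigma> x (conj_cs \<gamma> J x) = \<sigma> (\<gamma> x) (J (\<gamma> x))"
      by (simp add: pull_def conj_cs_eq inverse)
    ultimately show ?thesis using assms by (simp add: tamed_def)
  qed
  then show ?thesis
    using assms complex_structure_conj_cs preserves_conj_cs by (simp add: tamed_def)
qed

lemma pull_inverse: "pull \<delta> (pull \<gamma> b) = b"
  by (simp add: pull_def inverse)

end

text \<open>The inverse gives surjectivity: \<open>\<delta>\<close> carries a structure tamed by \<open>\<sigma>\<^sub>\<gamma>\<close> back to one
  tamed by \<open>\<sigma>\<close>.\<close>

lemma column_pull:
  fixes \<gamma> \<delta> :: "'v::real_vector \<Rightarrow> 'v"
  assumes lin: "linear \<gamma>" "linear \<delta>" and inverse: "\<And>x. \<delta> (\<gamma> x) = x" "\<And>x. \<gamma> (\<delta> x) = x"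
  shows "pull \<gamma> ` Met = Met" "conj_cs \<gamma> ` tamed \<sigma> = tamed (pull \<gamma> \<sigma>)"
    "(\<lambda>(b, \<tau>). (pull \<gamma> b, pull \<gamma> \<tau>)) ` beta \<sigma> ` tamed \<sigma> = beta (pull \<gamma> \<sigma>) ` tamed (pull \<gamma> \<sigma>)"
proof -
  note g = lin inverse and d = lin(2,1) inverse(2,1)
  have "b \<in> pull \<gamma> ` Met" if "b \<in> Met" for b
    using pull_Met[OF d that] pull_inverse[OF d, of b] by (metis imageI)
  then show "pull \<gamma> ` Met = Met" using pull_Met[OF g] by blast
  have "J \<in> conj_cs \<gamma> ` tamed \<sigma>" if J: "J \<in> tamed (pull \<gamma> \<sigma>)" for J
  proof -
    have "conj_cs \<delta> J \<in> tamed (pull \<delta> (pull \<gamma> \<sigma>))" by (rule tamed_conj_cs[OF d J])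
    then have "conj_cs \<delta> J \<in> tamed \<sigma>" by (simp only: pull_inverse[OF g])
    moreover have "conj_cs \<gamma> (conj_cs \<delta> J) = J"
      unfolding conj_cs_eq[OF g] conj_cs_eq[OF d] by (simp add: fun_eq_iff inverse)
    ultimately show ?thesis by (metis imageI)
  qed
  then show t: "conj_cs \<gamma> ` tamed \<sigma> = tamed (pull \<gamma> \<sigma>)" using tamed_conj_cs[OF g] by blast
  show "(\<lambda>(b, \<tau>). (pull \<gamma> b, pull \<gamma> \<tau>)) ` beta \<sigma> ` tamed \<sigma> = beta (pull \<gamma> \<sigma>) ` tamed (pull \<gamma> \<sigma>)"
    unfolding t[symmetric] image_image by (simp add: beta_def bform_pull[OF g])
qed

section \<open>The matrix groups and their cosets\<close>

lemma carrier_GLp [simp]: "T \<in> carrier GLp \<longleftrightarrow> det T > 0"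
  by (simp add: GLp_def)

lemma carrier_Sp [simp]: "T \<in> carrier Sp \<longleftrightarrow> symplectic T"
  by (simp add: Sp_def symplectic_def)

lemma mult_GLp [simp]: "S \<otimes>\<^bsub>GLp\<^esub> T = S ** T" and one_GLp [simp]: "\<one>\<^bsub>GLp\<^esub> = mat 1"
  by (simp_all add: GLp_def)

lemma mult_Sp [simp]: "S \<otimes>\<^bsub>Sp\<^esub> T = S ** T" and one_Sp [simp]: "\<one>\<^bsub>Sp\<^esub> = mat 1"
  by (simp_all add: Sp_def)

lemma det_pos_invertible: "det T > 0 \<Longrightarrow> invertible T" for T :: "real^'n^'n"
  by (simp add: invertible_det_nz)

lemma det_matrix_inv_pos:
  fixes T :: "real^'n^'n"
  assumes "det T > 0" shows "det (matrix_inv T) > 0"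
proof -
  have "det T * det (matrix_inv T) = 1"
    using matrix_inv_mult(1)[OF det_pos_invertible[OF assms]] by (metis det_mul det_I)
  then show ?thesis using assms by (metis zero_less_mult_pos zero_less_one)
qed

lemma group_GLp: "Group.group GLp"
proof (rule groupI)
  fix x :: "real^'a^'a" assume "x \<in> carrier GLp"
  then show "\<exists>y\<in>carrier GLp. y \<otimes>\<^bsub>GLp\<^esub> x = \<one>\<^bsub>GLp\<^esub>"
    using det_matrix_inv_pos[of x] matrix_inv_mult(2)[OF det_pos_invertible, of x] by auto
qed (auto simp: det_mul matrix_mul_assoc)

lemma inv_GLp: "det T > 0 \<Longrightarrow> inv\<^bsub>GLp\<^esub> T = matrix_inv T"
  by (rule group.inv_equality[OF group_GLp])
    (simp_all add: matrix_inv_mult det_pos_invertible det_matrix_inv_pos)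

lemma rotation_matrix_inv:
  fixes A :: "real^'n^'n"
  assumes "rotation_matrix A" shows "matrix_inv A = transpose A"
  using assms by (intro matrix_inv_unique) (simp add: rotation_matrix_def orthogonal_matrix_def)

lemma subgroup_SO: "subgroup SO GLp"
proof
  show "SO \<subseteq> carrier GLp" by (auto simp: SO_def rotation_matrix_def)
  show "x \<otimes>\<^bsub>GLp\<^esub> y \<in> SO" if "x \<in> SO" "y \<in> SO" for x y :: "real^'a^'a"
    using that by (simp add: SO_def rotation_matrix_def orthogonal_matrix_mul det_mul)
  show "\<one>\<^bsub>GLp\<^esub> \<in> SO" by (simp add: SO_def rotation_matrix_def orthogonal_matrix_id)
  show "inv\<^bsub>GLp\<^esub> x \<in> SO" if "x \<in> SO" for x :: "real^'a^'a"
    using that inv_GLp[of x] rotation_matrix_inv[of x]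
    by (simp add: SO_def rotation_matrix_def det_transpose)
qed

lemma subgroup_Sp: "subgroup (carrier Sp) GLp"
proof
  show "inv\<^bsub>GLp\<^esub> x \<in> carrier Sp" if "x \<in> carrier Sp" for x
    using that inv_GLp[of x] by (simp add: symplectic_det_pos symplectic_matrix_inv)
qed (auto simp: symplectic_det_pos symplectic_mult symplectic_mat1)

lemma group_Sp: "Group.group (Sp :: (real, 'n::finite + 'n) sqmat monoid)"
proof -
  have "GLp\<lparr>carrier := carrier Sp\<rparr> = (Sp :: (real, 'n + 'n) sqmat monoid)" by (simp add: GLp_def Sp_def)
  then show ?thesis using subgroup.subgroup_is_group[OF subgroup_Sp group_GLp] by metis
qed

lemma inv_Sp: "symplectic T \<Longrightarrow> inv\<^bsub>Sp\<^esub> T = matrix_inv T"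
  by (rule group.inv_equality[OF group_Sp])
    (simp_all add: matrix_inv_mult symplectic_inv(1) symplectic_matrix_inv)

lemma subgroup_Ugrp: "subgroup Ugrp Sp"
proof
  show "Ugrp \<subseteq> carrier Sp" by (auto simp: Ugrp_def)
  show "x \<otimes>\<^bsub>Sp\<^esub> y \<in> Ugrp" if "x \<in> Ugrp" "y \<in> Ugrp" for x y :: "real^('a+'a)^('a+'a)"
    using that subgroup.m_closed[OF subgroup_SO, of x y] by (auto simp: Ugrp_def symplectic_mult)
  show "\<one>\<^bsub>Sp\<^esub> \<in> Ugrp"
    using subgroup.one_closed[OF subgroup_SO] by (simp add: Ugrp_def symplectic_mat1)
  show "inv\<^bsub>Sp\<^esub> x \<in> Ugrp" if "x \<in> Ugrp" for x :: "real^('a+'a)^('a+'a)"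
    using that subgroup.m_inv_closed[OF subgroup_SO, of x] inv_Sp[of x] inv_GLp[of x]
    by (auto simp: Ugrp_def symplectic_matrix_inv symplectic_det_pos)
qed

text \<open>The cosets of the rotation group are the fibres of \<open>T \<mapsto> T\<^sup>t T\<close>; restricted to symplectic matrices, the
  same holds for the cosets of the unitary group.\<close>

lemma gram_eq_iff_rotation:
  fixes S T :: "real^'n^'n"
  assumes "det S > 0" "det T > 0"
  shows "transpose S ** S = transpose T ** T \<longleftrightarrow> rotation_matrix (S ** matrix_inv T)"
proof
  note inv = det_pos_invertible[OF assms(2)]
  let ?R = "S ** matrix_inv T"
  have "transpose ?R ** ?R = transpose (matrix_inv T) ** (transpose S ** S) ** matrix_inv T"
    by (simp add: matrix_transpose_mul matrix_mul_assoc)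
  moreover assume "transpose S ** S = transpose T ** T"
  ultimately have "transpose ?R ** ?R = mat 1"
    by (simp add: matrix_mul_assoc matrix_inv_mult transpose_matrix_inv[OF inv]
        transpose_invertible inv matrix_inv_cancel)
  then have o: "orthogonal_matrix ?R" by (simp add: orthogonal_matrix)
  have "det ?R > 0" using assms by (simp add: det_mul det_matrix_inv_pos)
  then show "rotation_matrix ?R" using det_orthogonal_matrix[OF o] o by (auto simp: rotation_matrix_def)
next
  note inv = det_pos_invertible[OF assms(2)]
  let ?R = "S ** matrix_inv T"
  assume "rotation_matrix ?R"
  then have R: "transpose ?R ** ?R = mat 1" by (simp add: rotation_matrix_def orthogonal_matrix)
  have "S = ?R ** T" by (simp add: matrix_inv_cancel inv)
  then have "transpose S ** S = transpose T ** (transpose ?R ** ?R) ** T"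
    by (metis matrix_transpose_mul matrix_mul_assoc)
  then show "transpose S ** S = transpose T ** T" by (simp add: R)
qed

lemma SO_coset:
  assumes T: "det T > 0"
  shows "SO #>\<^bsub>GLp\<^esub> T = {S \<in> carrier GLp. transpose S ** S = transpose T ** T}"
proof (intro equalityI subsetI)
  note inv = det_pos_invertible[OF T]
  fix S assume "S \<in> SO #>\<^bsub>GLp\<^esub> T"
  then obtain R where R: "rotation_matrix R" "S = R ** T" by (auto simp: r_coset_def SO_def)
  then have "det S > 0" using T by (simp add: det_mul rotation_matrix_def)
  moreover have "S ** matrix_inv T = R" by (simp add: R matrix_inv_cancel inv)
  ultimately show "S \<in> {S \<in> carrier GLp. transpose S ** S = transpose T ** T}"
    using gram_eq_iff_rotation[of S T] R(1) T by simp
next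
  note inv = det_pos_invertible[OF T]
  fix S assume "S \<in> {S \<in> carrier GLp. transpose S ** S = transpose T ** T}"
  then have "rotation_matrix (S ** matrix_inv T)" using gram_eq_iff_rotation[of S T] T by simp
  moreover have "S = S ** matrix_inv T ** T" by (simp add: matrix_inv_cancel inv)
  ultimately show "S \<in> SO #>\<^bsub>GLp\<^esub> T" unfolding r_coset_def SO_def by auto
qed

lemma Ugrp_coset:
  assumes T: "symplectic T"
  shows "Ugrp #>\<^bsub>Sp\<^esub> T = {S \<in> carrier Sp. transpose S ** S = transpose T ** T}"
proof (intro equalityI subsetI)
  fix S assume "S \<in> Ugrp #>\<^bsub>Sp\<^esub> T"
  then obtain R where R: "symplectic R" "R \<in> SO" "S = R ** T" by (auto simp: r_coset_def Ugrp_def)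
  then have "S \<in> SO #>\<^bsub>GLp\<^esub> T" by (auto simp: r_coset_def)
  then show "S \<in> {S \<in> carrier Sp. transpose S ** S = transpose T ** T}"
    using R T by (simp add: SO_coset symplectic_det_pos symplectic_mult)
next
  fix S assume S: "S \<in> {S \<in> carrier Sp. transpose S ** S = transpose T ** T}"
  then have "rotation_matrix (S ** matrix_inv T)"
    using gram_eq_iff_rotation[of S T] T by (simp add: symplectic_det_pos)
  moreover have "S = S ** matrix_inv T ** T" by (simp add: matrix_inv_cancel symplectic_inv(1) T)
  moreover have "symplectic (S ** matrix_inv T)"
    using S T by (simp add: symplectic_mult symplectic_matrix_inv)
  ultimately show "S \<in> Ugrp #>\<^bsub>Sp\<^esub> T" unfolding r_coset_def SO_def Ugrp_def by auto
qed

lemma SO_coset_eq_iff: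
  assumes "det S > 0" "det T > 0"
  shows "SO #>\<^bsub>GLp\<^esub> S = SO #>\<^bsub>GLp\<^esub> T \<longleftrightarrow> transpose S ** S = transpose T ** T"
  using assms by (auto simp: SO_coset)

lemma Ugrp_coset_eq_iff:
  assumes "symplectic S" "symplectic T"
  shows "Ugrp #>\<^bsub>Sp\<^esub> S = Ugrp #>\<^bsub>Sp\<^esub> T \<longleftrightarrow> transpose S ** S = transpose T ** T"
  using assms by (auto simp: Ugrp_coset)

lemma jmap_coset:
  assumes T: "symplectic T"
  shows "jmap (Ugrp #>\<^bsub>Sp\<^esub> T) = SO #>\<^bsub>GLp\<^esub> T"
proof (intro equalityI subsetI)
  fix S assume "S \<in> jmap (Ugrp #>\<^bsub>Sp\<^esub> T)"
  then obtain R U where R: "R \<in> SO" "U \<in> SO" "S = R ** (U ** T)"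
    unfolding jmap_def set_mult_def r_coset_def Ugrp_def by auto
  then have "R ** U \<in> SO" using subgroup.m_closed[OF subgroup_SO R(1,2)] by simp
  moreover have "S = R ** U ** T" by (simp add: R matrix_mul_assoc)
  ultimately show "S \<in> SO #>\<^bsub>GLp\<^esub> T" by (auto simp: r_coset_def)
next
  fix S assume "S \<in> SO #>\<^bsub>GLp\<^esub> T"
  then obtain R where "R \<in> SO" "S = R ** T" by (auto simp: r_coset_def)
  moreover have "T \<in> Ugrp #>\<^bsub>Sp\<^esub> T" using T by (simp add: Ugrp_coset)
  ultimately show "S \<in> jmap (Ugrp #>\<^bsub>Sp\<^esub> T)" unfolding jmap_def set_mult_def by auto
qed

lemma jmap_inj_on: "inj_on jmap (rcosets\<^bsub>Sp\<^esub> Ugrp)"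
proof (rule inj_onI)
  fix C D :: "(real^('a + 'a)^('a + 'a)) set"
  assume "C \<in> rcosets\<^bsub>Sp\<^esub> Ugrp" "D \<in> rcosets\<^bsub>Sp\<^esub> Ugrp"
  then obtain S T where S: "symplectic S" "C = Ugrp #>\<^bsub>Sp\<^esub> S" and T: "symplectic T" "D = Ugrp #>\<^bsub>Sp\<^esub> T"
    unfolding RCOSETS_def by auto
  moreover assume "jmap C = jmap D"
  ultimately show "C = D"
    by (simp add: jmap_coset SO_coset_eq_iff Ugrp_coset_eq_iff symplectic_det_pos)
qed

subsection \<open>Metrics and complex structures as cosets\<close>

lemma posdef_iff_gram: "posdef P \<longleftrightarrow> (\<exists>T. det T > 0 \<and> P = transpose T ** T)"
proof
  assume P: "posdef P"
  obtain S where S: "posdef S" "S ** S = P" by (rule posdef_sqrt[OF P])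
  then show "\<exists>T. det T > 0 \<and> P = transpose T ** T"
    using posdef_det_pos[OF S(1)] by (auto simp: posdef_def)
qed (auto intro: posdef_gram det_pos_invertible)

lemma symplectic_posdef_iff_gram:
  "posdef P \<and> symplectic P \<longleftrightarrow> (\<exists>T. symplectic T \<and> P = transpose T ** T)"
proof
  assume P: "posdef P \<and> symplectic P"
  obtain S where S: "posdef S" "S ** S = P" by (rule posdef_sqrt[OF P[THEN conjunct1]])
  then have "symplectic S" using P symplectic_sqrt by blast
  then show "\<exists>T. symplectic T \<and> P = transpose T ** T" using S by (auto simp: posdef_def)
next
  assume "\<exists>T. symplectic T \<and> P = transpose T ** T"
  then obtain T where T: "symplectic T" "P = transpose T ** T" by blast
  have "- (T ** (Jstd ** transpose T ** Jstd)) ** Jstd = Jstd"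
    using matrix_inv_mult(1)[OF symplectic_inv(1)[OF T(1)]] symplectic_inv(2)[OF T(1)] by simp
  then have "transpose (transpose T) ** Jstd ** transpose T = Jstd" by (simp add: matrix_mul_assoc)
  then have "symplectic (transpose T)" by (simp add: symplectic_def)
  then show "posdef P \<and> symplectic P"
    using T by (simp add: symplectic_mult posdef_gram symplectic_inv(1))
qed

lemma conj_Jstd:
  assumes "symplectic T" shows "matrix_inv T ** Jstd ** T = Jstd ** (transpose T ** T)"
  unfolding symplectic_inv(2)[OF assms] by (simp add: matrix_mul_assoc)

text \<open>The condition \<open>(J P)\<^sup>2 = - 1\<close> reads \<open>P J P = J\<close>, and \<open>P\<close> is the Gram matrix of the metric attached to the
  structure \<open>J P\<close>.\<close>

lemma tamed_symplectic_basis: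
  assumes "symplectic_basis \<omega> e" and \<omega>: "\<omega> \<in> Symp"
  shows "endo e (Jstd ** P) \<in> tamed \<omega> \<longleftrightarrow> posdef P \<and> symplectic P"
    and "bform \<omega> (endo e (Jstd ** P)) = form_of e P"
proof -
  have e: "is_basis e" and om: "\<omega> = form_of e (- Jstd)"
    using assms(1) by (auto simp: symplectic_basis_iff)
  show bf: "bform \<omega> (endo e (Jstd ** P)) = form_of e P"
    unfolding om bform_form_of[OF e] by simp
  show "endo e (Jstd ** P) \<in> tamed \<omega> \<longleftrightarrow> posdef P \<and> symplectic P"
  proof
    assume J: "endo e (Jstd ** P) \<in> tamed \<omega>"
    have P: "posdef P"
      using bform_tamed_Met[OF J \<omega>] by (simp add: bf form_of_in_Met_iff[OF e])
    have "complex_structure (endo e (Jstd ** P))" using J by (simp add: tamed_def)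
    then have "Jstd ** P ** (Jstd ** P) = - mat 1" by (simp add: complex_structure_endo_iff[OF e])
    then have "Jstd ** (Jstd ** P ** (Jstd ** P)) = - Jstd" by simp
    then have "P ** Jstd ** P = Jstd" by (simp add: matrix_mul_assoc Jstd_square)
    then show "posdef P \<and> symplectic P" using P by (simp add: symplectic_def posdef_def)
  next
    assume P: "posdef P \<and> symplectic P"
    then have tP: "transpose P = P" and PJP: "P ** Jstd ** P = Jstd"
      by (auto simp: symplectic_def posdef_def)
    have "Jstd ** P ** (Jstd ** P) = Jstd ** (P ** Jstd ** P)" by (simp add: matrix_mul_assoc)
    then have 1: "complex_structure (endo e (Jstd ** P))"
      by (simp add: complex_structure_endo_iff[OF e] PJP Jstd_square)
    have "transpose (Jstd ** P) ** (- Jstd) ** (Jstd ** P) = - (P ** Jstd ** P)"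
      by (simp add: matrix_transpose_mul tP matrix_mul_assoc)
    then have 2: "preserves (endo e (Jstd ** P)) \<omega>"
      unfolding om preserves_form_of_iff[OF e] by (simp add: PJP)
    have "form_of e P \<in> Met" using P by (simp add: form_of_in_Met_iff[OF e])
    then have "\<omega> x (endo e (Jstd ** P) x) > 0" if "x \<noteq> 0" for x
      using that by (auto simp: bf[symmetric] bform_def Met_def)
    then show "endo e (Jstd ** P) \<in> tamed \<omega>" using 1 2 by (simp add: tamed_def)
  qed
qed

lemma tamed_cases:
  assumes b: "symplectic_basis \<omega> e" and \<omega>: "\<omega> \<in> Symp" and J: "J \<in> tamed \<omega>"
  obtains T where "symplectic T" "J = endo e (matrix_inv T ** Jstd ** T)"
proof -
  have e: "is_basis e" using b by (simp add: symplectic_basis_iff)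
  define K where "K = matrix (\<lambda>x. coords e (J (frame e x)))"
  have JK: "J = endo e (Jstd ** (- (Jstd ** K)))"
    using J endo_matrix[OF e, of J] by (simp add: K_def tamed_def complex_structure_def matrix_mul_assoc Jstd_square)
  then have "posdef (- (Jstd ** K)) \<and> symplectic (- (Jstd ** K))"
    using tamed_symplectic_basis(1)[OF b \<omega>, of "- (Jstd ** K)"] J by simp
  then obtain T where T: "symplectic T" "- (Jstd ** K) = transpose T ** T"
    unfolding symplectic_posdef_iff_gram by blast
  show ?thesis
  proof (rule that[OF T(1)])
    show "J = endo e (matrix_inv T ** Jstd ** T)"
      using JK by (simp only: T(2) conj_Jstd[OF T(1)])
  qed
qed

section \<open>Topology of the coset spaces\<close>

lemma continuous_on_matrix_mult [continuous_intros]: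
  fixes f g :: "'a::topological_space \<Rightarrow> real^'n^'n"
  assumes "continuous_on S f" "continuous_on S g"
  shows "continuous_on S (\<lambda>x. f x ** g x)"
  unfolding matrix_matrix_mult_def
  by (intro continuous_on_vec_lambda continuous_on_sum continuous_on_mult continuous_on_component assms)

lemma continuous_on_transpose [continuous_intros]:
  fixes f :: "'a::topological_space \<Rightarrow> real^'n^'m"
  assumes "continuous_on S f"
  shows "continuous_on S (\<lambda>x. transpose (f x))"
  unfolding transpose_def
  by (intro continuous_on_vec_lambda continuous_on_component assms)

lemma continuous_on_det [continuous_intros]:
  fixes f :: "'a::topological_space \<Rightarrow> real^'n^'n"
  assumes "continuous_on S f"
  shows "continuous_on S (\<lambda>x. det (f x))"
  unfolding det_def
  by (intro continuous_on_sum continuous_on_mult continuous_on_const continuous_on_prod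
      continuous_on_component assms)

text \<open>The square of the norm of \<open>T\<close> is the trace of \<open>T\<^sup>t T\<close>.\<close>

lemma norm_gram_le:
  fixes T :: "real^'n^'n"
  shows "(norm T)\<^sup>2 \<le> CARD('n) * norm (transpose T ** T)"
proof -
  have "(norm T)\<^sup>2 = (\<Sum>i\<in>UNIV. \<Sum>j\<in>UNIV. (T $ i $ j)\<^sup>2)"
    by (simp add: norm_vec_def L2_set_def sum_nonneg)
  also have "\<dots> = (\<Sum>j\<in>UNIV. \<Sum>i\<in>UNIV. (T $ i $ j)\<^sup>2)" by (rule sum.swap)
  also have "\<dots> = (\<Sum>j\<in>UNIV. (transpose T ** T) $ j $ j)"
    by (simp add: matrix_matrix_mult_def transpose_def power2_eq_square)
  also have "\<dots> \<le> (\<Sum>j\<in>(UNIV :: 'n set). norm (transpose T ** T))"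
  proof (rule sum_mono)
    fix j
    have "(transpose T ** T) $ j $ j \<le> norm ((transpose T ** T) $ j $ j)" by simp
    also have "\<dots> \<le> norm ((transpose T ** T) $ j)" by (rule Finite_Cartesian_Product.norm_nth_le)
    also have "\<dots> \<le> norm (transpose T ** T)" by (rule Finite_Cartesian_Product.norm_nth_le)
    finally show "(transpose T ** T) $ j $ j \<le> norm (transpose T ** T)" .
  qed
  finally show ?thesis by simp
qed

text \<open>A convergent sequence of Gram matrices \<open>T\<^sup>t T\<close> comes from a bounded sequence of matrices \<open>T\<close>, so the
  map is closed; the determinant keeps limits inside the group. The factor \<open>L\<close> is \<open>1\<close> for
  metrics and \<open>Jstd\<close> for complex structures.\<close>

lemma quotient_map_gram:
  fixes C :: "(real^'n^'n) set" and L :: "real^'n^'n"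
  assumes C: "closedin (top_of_set {T. det T > 0}) C" and L: "invertible L"
  defines "q \<equiv> \<lambda>T. L ** (transpose T ** T)"
  shows "quotient_map (top_of_set C) (top_of_set (q ` C)) q"
proof (rule continuous_closed_imp_quotient_map)
  have cont: "continuous_on UNIV q" unfolding q_def by (intro continuous_intros)
  then show "continuous_map (top_of_set C) (top_of_set (q ` C)) q"
    by (auto intro: continuous_on_subset)
  have Lq: "matrix_inv L ** q T = transpose T ** T" for T
    by (simp add: q_def matrix_inv_cancel[OF L])
  have CG: "C \<subseteq> {T. det T > 0}" using closedin_subset[OF C] by simp
  show "closed_map (top_of_set C) (top_of_set (q ` C)) q"
    unfolding closed_map_def
  proof (intro allI impI)
    fix U assume U: "closedin (top_of_set C) U"
    have UC: "U \<subseteq> C" using closedin_subset[OF U] by simp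
    have "P \<in> q ` U" if P: "P \<in> q ` C" "P \<in> closure (q ` U)" for P
    proof -
      obtain s where s: "\<And>k. s k \<in> q ` U" "s \<longlonglongrightarrow> P"
        using P(2) unfolding closure_sequential by blast
      then obtain T where T: "\<And>k. T k \<in> U" "\<And>k. s k = q (T k)" unfolding image_iff by metis
      have "continuous_on UNIV (\<lambda>M :: real^'n^'n. matrix_inv L ** M)"
        using continuous_on_matrix_mult[of UNIV "\<lambda>_. matrix_inv L" "\<lambda>M. M"] by simp
      then have "(\<lambda>k. matrix_inv L ** s k) \<longlonglongrightarrow> matrix_inv L ** P"
        by (rule continuous_on_tendsto_compose[OF _ s(2)]) auto
      then have "Bseq (\<lambda>k. transpose (T k) ** T k)"
        unfolding T(2) Lq by (intro convergent_imp_Bseq convergentI)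
      then obtain B where B: "\<And>k. norm (transpose (T k) ** T k) \<le> B" by (auto simp: Bseq_def)
      have "norm (T k) \<le> sqrt (CARD('n) * B)" for k
      proof (rule real_le_rsqrt)
        show "(norm (T k))\<^sup>2 \<le> CARD('n) * B"
          by (rule order_trans[OF norm_gram_le mult_left_mono[OF B]]) simp
      qed
      then have "bounded (range T)" by (intro boundedI) auto
      then obtain l r where r: "strict_mono r" and l: "(T \<circ> r) \<longlonglongrightarrow> l"
        using bounded_imp_convergent_subsequence by blast
      have "(\<lambda>k. q ((T \<circ> r) k)) \<longlonglongrightarrow> q l"
        using continuous_on_tendsto_compose[OF cont l] by simp
      moreover have "(\<lambda>k. q ((T \<circ> r) k)) \<longlonglongrightarrow> P"
        using LIMSEQ_subseq_LIMSEQ[OF s(2) r] by (simp add: o_def T(2))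
      ultimately have ql: "q l = P" using LIMSEQ_unique by blast
      have "(\<lambda>k. det ((T \<circ> r) k)) \<longlonglongrightarrow> det l"
        using continuous_on_tendsto_compose[OF continuous_on_det[OF continuous_on_id[of UNIV]] l] by simp
      moreover have "det ((T \<circ> r) k) \<ge> 0" for k
      proof -
        have "T (r k) \<in> {T. det T > 0}" using T(1) UC CG by (meson subsetD)
        then show ?thesis by simp
      qed
      ultimately have "det l \<ge> 0" by (meson LIMSEQ_le_const)
      moreover have "det l \<noteq> 0"
      proof
        assume "det l = 0"
        then have "det P = 0" by (simp add: ql[symmetric] q_def det_mul)
        moreover obtain T where "T \<in> C" "P = q T" using P(1) by blast
        then have "det T > 0" "det P = det L * (det T * det T)"
          using CG by (auto simp: q_def det_mul det_transpose)
        ultimately show False using L by (simp add: invertible_det_nz)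
      qed
      ultimately have "l \<in> {T. det T > 0}" by simp
      moreover obtain Z where Z: "closed Z" "C = {T. det T > 0} \<inter> Z" using C by (auto simp: closedin_closed)
      moreover obtain Y where Y: "closed Y" "U = C \<inter> Y" using U by (auto simp: closedin_closed)
      moreover have "l \<in> Z \<inter> Y"
        using closed_sequentially[OF closed_Int[OF Z(1) Y(1)] _ l] T(1) Y(2) Z(2) by auto
      ultimately have "l \<in> U" by blast
      then show "P \<in> q ` U" using ql by blast
    qed
    then have "q ` C \<inter> closure (q ` U) \<subseteq> q ` U" by (intro subsetI) (elim IntE)
    moreover have "q ` U \<subseteq> q ` C \<inter> closure (q ` U)"
      using image_mono[OF UC] closure_subset by (rule Int_greatest)
    ultimately have eq: "q ` C \<inter> closure (q ` U) = q ` U" by (intro equalityI)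
    have "closedin (top_of_set (q ` C)) (q ` C \<inter> closure (q ` U))"
      by (rule closedin_closed_Int) (rule closed_closure)
    then show "closedin (top_of_set (q ` C)) (q ` U)" by (simp only: eq)
  qed
qed simp

lemma quotient_map_pullback_topology:
  assumes q: "quotient_map X (top_of_set (m ` S)) (m \<circ> f)" and inj: "inj_on m S"
    and f: "f ` topspace X \<subseteq> S"
  shows "quotient_map X (pullback_topology S m euclidean) f"
proof -
  have surj: "m ` f ` topspace X = m ` S" using q by (simp add: quotient_map_def image_comp)
  have "f ` topspace X = S"
  proof
    show "S \<subseteq> f ` topspace X"
    proof
      fix s assume s: "s \<in> S"
      then have "m s \<in> m ` f ` topspace X" by (simp add: surj)
      then obtain x where x: "x \<in> topspace X" "m (f x) = m s" by auto
      then have "f x = s" using f s by (intro inj_onD[OF inj x(2)]) auto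
      then show "s \<in> f ` topspace X" using x(1) by blast
    qed
  qed (rule f)
  moreover have "openin X {x \<in> topspace X. f x \<in> U} \<longleftrightarrow> openin (pullback_topology S m euclidean) U"
    if U: "U \<subseteq> S" for U
  proof -
    have "{x \<in> topspace X. f x \<in> U} = {x \<in> topspace X. (m \<circ> f) x \<in> m ` U}"
      using inj U f by (auto simp: inj_on_def)
    then have "openin X {x \<in> topspace X. f x \<in> U} \<longleftrightarrow> openin (top_of_set (m ` S)) (m ` U)"
      using q U by (simp add: quotient_map_def image_mono)
    also have "\<dots> \<longleftrightarrow> (\<exists>V. open V \<and> m ` U = m ` S \<inter> V)" by (rule openin_open)
    also have "\<dots> \<longleftrightarrow> (\<exists>V. open V \<and> U = m -` V \<inter> S)"
    proof -
      have "m ` U = m ` S \<inter> V \<longleftrightarrow> U = m -` V \<inter> S" for V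
      proof -
        have "m ` (m -` V \<inter> S) = m ` S \<inter> V" by blast
        then show ?thesis using inj_on_image_eq_iff[OF inj U, of "m -` V \<inter> S"] by simp
      qed
      then show ?thesis by simp
    qed
    finally show ?thesis by (simp add: openin_pullback_topology)
  qed
  ultimately show ?thesis by (simp add: quotient_map_def topspace_pullback_topology)
qed

lemma openin_coset_topology:
  "openin (coset_topology G H) U \<longleftrightarrow> U \<subseteq> rcosets\<^bsub>G\<^esub> H \<and>
     openin (top_of_set (carrier G)) {T \<in> carrier G. H #>\<^bsub>G\<^esub> T \<in> U}"
proof -
  let ?P = "\<lambda>U. U \<subseteq> rcosets\<^bsub>G\<^esub> H \<and> openin (top_of_set (carrier G)) {T \<in> carrier G. H #>\<^bsub>G\<^esub> T \<in> U}"
  have "istopology ?P"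
    unfolding istopology_def
  proof (intro conjI allI impI)
    fix S T assume S: "?P S" and T: "?P T"
    have "{x \<in> carrier G. H #>\<^bsub>G\<^esub> x \<in> S \<inter> T} =
        {x \<in> carrier G. H #>\<^bsub>G\<^esub> x \<in> S} \<inter> {x \<in> carrier G. H #>\<^bsub>G\<^esub> x \<in> T}" by blast
    with S T show "openin (top_of_set (carrier G)) {x \<in> carrier G. H #>\<^bsub>G\<^esub> x \<in> S \<inter> T}"
      by (simp add: openin_Int)
    show "S \<inter> T \<subseteq> rcosets\<^bsub>G\<^esub> H" using S by blast
  next
    fix K assume K: "\<forall>S\<in>K. ?P S"
    have "{x \<in> carrier G. H #>\<^bsub>G\<^esub> x \<in> \<Union>K} = \<Union>((\<lambda>S. {x \<in> carrier G. H #>\<^bsub>G\<^esub> x \<in> S}) ` K)" by blast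
    with K show "openin (top_of_set (carrier G)) {x \<in> carrier G. H #>\<^bsub>G\<^esub> x \<in> \<Union>K}"
      by (auto intro: openin_Union)
    show "\<Union>K \<subseteq> rcosets\<^bsub>G\<^esub> H" using K by blast
  qed
  then show ?thesis unfolding coset_topology_def by (simp add: topology_inverse')
qed

lemma quotient_map_coset:
  "quotient_map (top_of_set (carrier G)) (coset_topology G H) (\<lambda>T. H #>\<^bsub>G\<^esub> T)"
proof -
  have im: "(\<lambda>T. H #>\<^bsub>G\<^esub> T) ` carrier G = rcosets\<^bsub>G\<^esub> H" by (auto simp: RCOSETS_def)
  have "topspace (coset_topology G H) = rcosets\<^bsub>G\<^esub> H"
  proof
    show "topspace (coset_topology G H) \<subseteq> rcosets\<^bsub>G\<^esub> H"
      by (auto simp: topspace_def openin_coset_topology)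
    have "{T \<in> carrier G. H #>\<^bsub>G\<^esub> T \<in> rcosets\<^bsub>G\<^esub> H} = carrier G" using im by blast
    then have "openin (coset_topology G H) (rcosets\<^bsub>G\<^esub> H)"
      by (simp add: openin_coset_topology)
    then show "rcosets\<^bsub>G\<^esub> H \<subseteq> topspace (coset_topology G H)" by (rule openin_subset)
  qed
  then show ?thesis by (simp add: quotient_map_def im openin_coset_topology)
qed

text \<open>Comparing two quotient maps makes it unnecessary to show that the square root of a positive definite
  matrix depends continuously on it.\<close>

lemma homeomorphic_map_same_fibres:
  assumes q: "quotient_map X Y q" and p: "quotient_map X Z p"
    and \<Phi>: "\<And>x. x \<in> topspace X \<Longrightarrow> \<Phi> (q x) = p x"
    and fibres: "\<And>x y. x \<in> topspace X \<Longrightarrow> y \<in> topspace X \<Longrightarrow> p x = p y \<Longrightarrow> q x = q y"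
  shows "homeomorphic_map Y Z \<Phi>"
proof -
  have "quotient_map X Z (\<Phi> \<circ> q)" by (rule quotient_map_eq[OF p]) (simp add: \<Phi>)
  then have "quotient_map Y Z \<Phi>" using quotient_map_compose_eq[OF q] by blast
  moreover have "topspace Y = q ` topspace X" using q by (simp add: quotient_map_def)
  then have "inj_on \<Phi> (topspace Y)"
  proof (elim ssubst, intro inj_onI, elim imageE)
    fix a b x y assume "\<Phi> a = \<Phi> b" "a = q x" "x \<in> topspace X" "b = q y" "y \<in> topspace X"
    then show "a = b" using \<Phi>[of x] \<Phi>[of y] fibres[of x y] by simp
  qed
  ultimately show ?thesis by (simp add: homeomorphic_map_def)
qed

section \<open>The cone of positive definite Hermitian matrices\<close>

lemma hermitian_iff: "hermitian Z \<longleftrightarrow> transpose (Re_mat Z) = Re_mat Z \<and> transpose (Im_mat Z) = - Im_mat Z"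
proof -
  have "hermitian Z \<longleftrightarrow> (\<forall>i j. Re (Z $ j $ i) = Re (Z $ i $ j) \<and> - Im (Z $ j $ i) = Im (Z $ i $ j))"
    by (simp add: hermitian_def vec_eq_iff complex_eq_iff)
  also have "\<dots> \<longleftrightarrow> (\<forall>i j. Re (Z $ j $ i) = Re (Z $ i $ j)) \<and> (\<forall>i j. - Im (Z $ j $ i) = Im (Z $ i $ j))" by blast
  also have "(\<forall>i j. - Im (Z $ j $ i) = Im (Z $ i $ j)) \<longleftrightarrow> transpose (Im_mat Z) = - Im_mat Z"
    by (simp add: vec_eq_iff transpose_def Im_mat_def) (metis minus_minus)
  also have "(\<forall>i j. Re (Z $ j $ i) = Re (Z $ i $ j)) \<longleftrightarrow> transpose (Re_mat Z) = Re_mat Z"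
    by (simp add: vec_eq_iff transpose_def Re_mat_def)
  finally show ?thesis .
qed

definition hform :: "complex^'n^'n \<Rightarrow> complex^'n \<Rightarrow> real" where
  "hform Z z = Re (\<Sum>i\<in>UNIV. cnj (z $ i) * (Z *v z) $ i)"

lemma herm_pos_cone_hform: "Z \<in> herm_pos_cone \<longleftrightarrow> hermitian Z \<and> (\<forall>z. z \<noteq> 0 \<longrightarrow> hform Z z > 0)"
  by (simp only: herm_pos_cone_def hform_def mem_Collect_eq)

lemma hform_sum:
  "hform Z z = (\<Sum>i\<in>UNIV. \<Sum>j\<in>UNIV. Re_mat Z $ i $ j * (Re (z $ i) * Re (z $ j) + Im (z $ i) * Im (z $ j))
     + Im_mat Z $ i $ j * (Im (z $ i) * Re (z $ j) - Re (z $ i) * Im (z $ j)))"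
  unfolding hform_def
  by (simp add: matrix_vector_mult_def sum_distrib_left Re_mat_def Im_mat_def)
    (intro sum.cong refl, simp add: algebra_simps)

text \<open>The real vector \<open>(u, v)\<close> corresponds to \<open>u - \<i> v\<close>; the sign is forced by the position of \<open>- Im Z\<close> in \<open>realify Z\<close>.\<close>

lemma realify_form:
  fixes Z :: "complex^'n^'n"
  shows "x \<bullet> (realify Z *v x) = hform Z (\<chi> i. Complex (x $ Inl i) (- x $ Inr i))"
proof -
  have "x \<bullet> (realify Z *v x) =
      (\<Sum>i\<in>UNIV. \<Sum>j\<in>UNIV. Re_mat Z $ i $ j * (x $ Inl i * x $ Inl j) + Im_mat Z $ i $ j * (x $ Inl i * x $ Inr j))
    + (\<Sum>i\<in>UNIV. \<Sum>j\<in>UNIV. - Im_mat Z $ i $ j * (x $ Inr i * x $ Inl j) + Re_mat Z $ i $ j * (x $ Inr i * x $ Inr j))"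
    by (simp add: inner_vec_def matrix_vector_mult_def sum_UNIV_Plus realify_def distrib_left
        sum_distrib_left sum.distrib sum_subtractf sum_negf algebra_simps)
  also have "\<dots> = hform Z (\<chi> i. Complex (x $ Inl i) (- x $ Inr i))"
    unfolding hform_sum sum.distrib[symmetric]
    by (intro sum.cong refl) (simp add: algebra_simps)
  finally show ?thesis .
qed

lemma realify_symmetric_iff: "transpose (realify Z) = realify Z \<longleftrightarrow> hermitian Z"
proof -
  have "transpose (- Im_mat Z) = Im_mat Z \<longleftrightarrow> transpose (Im_mat Z) = - Im_mat Z"
    by (metis minus_minus transpose_minus)
  then show ?thesis by (auto simp: realify_def transpose_block hermitian_iff)
qed

lemma range_realify:
  "range (realify :: complex^'n::finite^'n \<Rightarrow> _) = {M. M ** Jstd = Jstd ** M}"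
proof -
  have "block A B (- B) A = realify (\<chi> i j. Complex (A $ i $ j) (B $ i $ j))" for A B :: "real^'n^'n"
    by (simp add: realify_def vec_eq_iff Re_mat_def Im_mat_def)
  then have "block A B (- B) A \<in> range realify" for A B :: "real^'n^'n" by (metis rangeI)
  then show ?thesis by (auto simp: commutes_Jstd_iff realify_def)
qed

lemma herm_pos_cone_iff: "Z \<in> herm_pos_cone \<longleftrightarrow> posdef (realify Z)"
proof
  assume Z: "Z \<in> herm_pos_cone"
  have "hform Z (\<chi> i. Complex (x $ Inl i) (- x $ Inr i)) > 0" if "x \<noteq> 0" for x
  proof -
    have "(\<chi> i. Complex (x $ Inl i) (- x $ Inr i)) \<noteq> 0"
      using that by (auto simp: vec_eq_iff_Plus vec_eq_iff complex_eq_iff)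
    then show ?thesis using Z by (simp add: herm_pos_cone_hform)
  qed
  then show "posdef (realify Z)"
    using Z by (simp add: posdef_def realify_form realify_symmetric_iff herm_pos_cone_hform)
next
  assume Z: "posdef (realify Z)"
  have "hform Z z > 0" if z: "z \<noteq> 0" for z
  proof -
    let ?x = "(\<chi> i. case i of Inl k \<Rightarrow> Re (z $ k) | Inr k \<Rightarrow> - Im (z $ k)) :: real^('a + 'a)"
    obtain k where "z $ k \<noteq> 0" using z by (auto simp: vec_eq_iff)
    then have "?x $ Inl k \<noteq> 0 \<or> ?x $ Inr k \<noteq> 0" by (auto simp: complex_eq_iff)
    then have "?x \<noteq> 0" by (metis zero_index)
    then have "?x \<bullet> (realify Z *v ?x) > 0" using Z by (simp add: posdef_def)
    then show ?thesis by (simp add: realify_form)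
  qed
  then show "Z \<in> herm_pos_cone"
    using Z by (simp add: herm_pos_cone_hform posdef_def realify_symmetric_iff)
qed

lemma realify_herm_pos_cone: "realify ` herm_pos_cone = {M. posdef M \<and> M ** Jstd = Jstd ** M}"
proof (intro equalityI subsetI)
  fix M :: "real^('a + 'a)^('a + 'a)" assume "M \<in> {M. posdef M \<and> M ** Jstd = Jstd ** M}"
  then have "posdef M" "M \<in> range realify" by (auto simp: range_realify)
  then show "M \<in> realify ` herm_pos_cone" by (auto simp: herm_pos_cone_iff)
qed (use range_realify in \<open>auto simp: herm_pos_cone_iff\<close>)

lemma posdef_add: "posdef M \<Longrightarrow> posdef N \<Longrightarrow> posdef (M + N)"
  by (auto simp: posdef_def transpose_add matrix_vector_mult_add_rdistrib inner_add_right add_pos_pos)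

lemma posdef_scaleR: "posdef M \<Longrightarrow> t > 0 \<Longrightarrow> posdef (t *\<^sub>R M)"
  by (auto simp: posdef_def transpose_scalar scaleR_matrix_vector_assoc[symmetric])

lemma commutes_Jstd_subspace: "subspace {M. M ** Jstd = Jstd ** M}"
  by (auto simp: subspace_def matrix_add_rdistrib matrix_add_ldistrib scalar_matrix_assoc[symmetric] matrix_scalar_ac)

lemma blunt_convex_cone_herm_pos: "blunt_convex_cone (realify ` herm_pos_cone)"
  unfolding blunt_convex_cone_def realify_herm_pos_cone
proof (intro conjI ballI allI impI)
  let ?C = "{M. posdef M \<and> M ** Jstd = Jstd ** M} :: (real^('a + 'a)^('a + 'a)) set"
  have "mat 1 \<in> ?C" by (simp add: posdef_mat1)
  then show "?C \<noteq> {}" by blast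
  show scale: "t *\<^sub>R M \<in> ?C" if "M \<in> ?C" "t > 0" for M t
    using that posdef_scaleR subspace_scale[OF commutes_Jstd_subspace] by auto
  show "convex ?C"
    unfolding convex_alt
  proof (intro ballI allI impI)
    fix M N :: "real^('a + 'a)^('a + 'a)" and u :: real
    assume M: "M \<in> ?C" and N: "N \<in> ?C" and u: "0 \<le> u \<and> u \<le> 1"
    consider "u = 0" | "u = 1" | "0 < u" "u < 1" using u by linarith
    then show "(1 - u) *\<^sub>R M + u *\<^sub>R N \<in> ?C"
    proof cases
      case 3
      then have "(1 - u) *\<^sub>R M \<in> ?C" "u *\<^sub>R N \<in> ?C" using scale M N by auto
      then show ?thesis using posdef_add subspace_add[OF commutes_Jstd_subspace] by auto
    qed (use M N in auto)
  qed
qed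

text \<open>A real \<open>n \<times> n\<close> matrix encodes a Hermitian one, the symmetric part of the first giving the real and
  the antisymmetric part the imaginary part of the second. The cone spans this space because
  adding a large multiple of the identity makes any symmetric matrix positive.\<close>

lemma dim_herm_pos_cone:
  "dim (realify ` (herm_pos_cone :: (complex^'n::finite^'n) set)) = CARD('n) ^ 2"
proof -
  let ?C = "{M. posdef M \<and> M ** Jstd = Jstd ** M} :: (real^('n + 'n)^('n + 'n)) set"
  let ?H = "{M. transpose M = M \<and> M ** Jstd = Jstd ** M} :: (real^('n + 'n)^('n + 'n)) set"
  define \<phi> where "\<phi> X = block (X + transpose X) (X - transpose X) (- (X - transpose X)) (X + transpose X)"
    for X :: "real^'n^'n"
  have lin: "linear \<phi>"
    by (rule linearI) (auto simp: \<phi>_def vec_eq_iff_Plus transpose_def algebra_simps)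
  have "X = 0" if "\<phi> X = 0" for X
  proof -
    have "\<phi> X = block 0 0 0 0" using that by (simp add: vec_eq_iff_Plus)
    then have "X + transpose X = 0" "X - transpose X = 0" unfolding \<phi>_def block_eq_iff by blast+
    then have "X + X = 0" by simp
    then show ?thesis by (simp add: vec_eq_iff)
  qed
  then have "inj \<phi>" using linear_injective_0[OF lin] by blast
  then have "dim (range \<phi>) = dim (UNIV :: (real^'n^'n) set)"
    by (intro dim_image_eq[OF lin]) (simp add: span_UNIV)
  then have dim: "dim (range \<phi>) = CARD('n) ^ 2" by (simp add: power2_eq_square)
  have range: "range \<phi> = ?H"
  proof (intro equalityI subsetI)
    fix M assume "M \<in> range \<phi>"
    then obtain X where X: "M = \<phi> X" by blast
    have "transpose M = M"
      by (simp add: X \<phi>_def transpose_block transpose_add transpose_diff add.commute)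
    moreover have "M ** Jstd = Jstd ** M" unfolding commutes_Jstd_iff X \<phi>_def by blast
    ultimately show "M \<in> ?H" by simp
  next
    fix M assume M: "M \<in> ?H"
    then obtain A B where AB: "M = block A B (- B) A" using commutes_Jstd_iff by blast
    have "transpose M = M" using M by blast
    then have sym: "transpose A = A" "transpose B = - B"
      unfolding AB transpose_block block_eq_iff by blast+
    have "\<phi> ((1/2) *\<^sub>R (A + B)) = M"
      by (simp add: \<phi>_def AB transpose_scalar transpose_add sym) (simp add: vec_eq_iff field_simps)
    then show "M \<in> range \<phi>" by blast
  qed
  have sub: "subspace ?H" unfolding range[symmetric] by (rule linear_subspace_image[OF lin subspace_UNIV])
  have "span ?C = ?H"
  proof
    show "span ?C \<subseteq> ?H" by (rule span_minimal[OF _ sub]) (auto simp: posdef_def)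
    show "?H \<subseteq> span ?C"
    proof
      fix M assume M: "M \<in> ?H"
      obtain K where K: "K > 0" "\<And>x. norm (M *v x) \<le> K * norm x"
        by (rule linear_bounded_pos[OF matrix_vector_mul_linear[of M]]) blast
      have one: "mat 1 \<in> ?C" by (simp add: posdef_mat1)
      have "posdef (M + (K + 1) *\<^sub>R mat 1)"
        unfolding posdef_def
      proof (intro conjI allI impI)
        show "transpose (M + (K + 1) *\<^sub>R mat 1) = M + (K + 1) *\<^sub>R mat 1"
          using M by (simp add: transpose_add transpose_scalar)
        fix x :: "real^('n + 'n)" assume x: "x \<noteq> 0"
        have "\<bar>x \<bullet> (M *v x)\<bar> \<le> norm x * norm (M *v x)" by (rule Cauchy_Schwarz_ineq2)
        also have "\<dots> \<le> norm x * (K * norm x)" by (intro mult_left_mono K) simp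
        also have "\<dots> = K * (x \<bullet> x)" by (simp add: dot_square_norm power2_eq_square)
        finally have "- (K * (x \<bullet> x)) \<le> x \<bullet> (M *v x)" by linarith
        moreover have "x \<bullet> x > 0" using x by simp
        moreover have "x \<bullet> ((M + (K + 1) *\<^sub>R mat 1) *v x) = x \<bullet> (M *v x) + K * (x \<bullet> x) + x \<bullet> x"
          by (simp add: matrix_vector_mult_add_rdistrib scaleR_matrix_vector_assoc[symmetric]
              inner_add_right algebra_simps)
        ultimately show "x \<bullet> ((M + (K + 1) *\<^sub>R mat 1) *v x) > 0" by linarith
      qed
      moreover have "(M + (K + 1) *\<^sub>R mat 1) ** Jstd = Jstd ** (M + (K + 1) *\<^sub>R mat 1)"
        using M by (simp add: matrix_add_rdistrib matrix_add_ldistrib scalar_matrix_assoc[symmetric] matrix_scalar_ac)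
      ultimately have "M + (K + 1) *\<^sub>R mat 1 \<in> span ?C" by (intro span_base) simp
      moreover have "(K + 1) *\<^sub>R mat 1 \<in> span ?C" using one by (intro span_scale span_base)
      ultimately have "(M + (K + 1) *\<^sub>R mat 1) - (K + 1) *\<^sub>R mat 1 \<in> span ?C" by (rule span_diff)
      then show "M \<in> span ?C" by simp
    qed
  qed
  then show ?thesis
    unfolding realify_herm_pos_cone using dim range dim_span[of ?C] by simp
qed

subsection \<open>Comparison with \<open>Kcone\<close>\<close>

definition imscale :: "real \<Rightarrow> complex^'n^'n \<Rightarrow> complex^'n^'n" where
  "imscale s Z = (\<chi> i j. of_real (Re (Z $ i $ j)) + \<i> * of_real (s * Im (Z $ i $ j)))"

lemma Re_mat_imscale [simp]: "Re_mat (imscale s Z) = Re_mat Z"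
  by (simp add: Re_mat_def imscale_def)

lemma Im_mat_imscale [simp]: "Im_mat (imscale s Z) = s *\<^sub>R Im_mat Z"
  by (simp add: Im_mat_def imscale_def vec_eq_iff)

lemma imscale_imscale [simp]: "imscale s (imscale t Z) = imscale (s * t) Z"
  by (simp add: imscale_def vec_eq_iff mult_ac)

lemma imscale_1 [simp]: "imscale 1 Z = Z"
  by (simp add: imscale_def vec_eq_iff complex_eq_iff)

lemma imscale_scaleR: "imscale s (t *\<^sub>R Z) = t *\<^sub>R imscale s Z"
  by (simp add: imscale_def vec_eq_iff complex_eq_iff)

lemma hform_imscale: "hform (imscale s Z) z = hform (imscale 0 Z) z + s * (hform Z z - hform (imscale 0 Z) z)"
  unfolding hform_sum by (simp add: sum.distrib sum_subtractf sum_distrib_left algebra_simps)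

lemma hform_scaleR: "hform (t *\<^sub>R Z) z = t * hform Z z"
  unfolding hform_sum by (simp add: sum_distrib_left Re_mat_def Im_mat_def algebra_simps)

lemma hform_scaleR_vector: "hform Z (t *\<^sub>R z) = t\<^sup>2 * hform Z z"
  unfolding hform_sum by (simp add: sum_distrib_left power2_eq_square algebra_simps)

lemma hermitian_imscale: "hermitian Z \<Longrightarrow> hermitian (imscale s Z)"
  by (simp add: hermitian_iff transpose_scalar)

lemma imscale_Kcone: "Z \<in> Kcone \<Longrightarrow> imscale s Z \<in> Kcone"
  by (simp add: Kcone_def hermitian_imscale)

lemma hform_real_part_pos:
  assumes Z: "Z \<in> Kcone" and z: "z \<noteq> 0"
  shows "hform (imscale 0 Z) z > 0"
proof -
  let ?u = "\<chi> i. Re (z $ i)" and ?v = "\<chi> i. Im (z $ i)"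
  have "hform (imscale 0 Z) z = ?u \<bullet> (Re_mat Z *v ?u) + ?v \<bullet> (Re_mat Z *v ?v)"
    unfolding hform_sum
    by (simp add: inner_vec_def matrix_vector_mult_def sum.distrib sum_distrib_left algebra_simps)
  moreover have "?u \<noteq> 0 \<or> ?v \<noteq> 0" using z by (simp add: vec_eq_iff complex_eq_iff) metis
  moreover have pos: "x \<noteq> 0 \<Longrightarrow> x \<bullet> (Re_mat Z *v x) > 0" for x using Z by (simp add: Kcone_def)
  moreover have "x \<bullet> (Re_mat Z *v x) \<ge> 0" for x using pos[of x] by (cases "x = 0") auto
  ultimately show ?thesis by (metis add_nonneg_pos add_pos_nonneg)
qed

text \<open>For \<open>Z = A + \<i> B\<close> in \<open>Kcone\<close>, \<open>1 - margin Z\<close> is the norm of \<open>\<i> B\<close> relative to \<open>A\<close>. It is less than \<open>1\<close>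
  exactly on the smaller cone, and the radial stretching of the unit ball to the whole
  space in the \<open>B\<close>-direction gives the homeomorphism of the two cones.\<close>

definition margin :: "complex^'n^'n \<Rightarrow> real" where
  "margin Z = Inf ((\<lambda>z. hform Z z / hform (imscale 0 Z) z) ` sphere 0 1)"

lemma continuous_on_hform:
  "continuous_on UNIV (\<lambda>p :: (complex^'n^'n) \<times> (complex^'n). hform (fst p) (snd p))"
  unfolding hform_sum Re_mat_def Im_mat_def by (simp, intro continuous_intros)

lemma continuous_on_imscale [continuous_intros]:
  assumes "continuous_on S s" "continuous_on S f"
  shows "continuous_on S (\<lambda>x. imscale (s x) (f x))"
  unfolding imscale_def by (intro continuous_intros assms)

lemma continuous_on_hform_ratio:
  "continuous_on ((Kcone :: (complex^'n::finite^'n) set) \<times> sphere 0 1)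
     (\<lambda>p. hform (fst p) (snd p) / hform (imscale 0 (fst p)) (snd p))"
proof (rule continuous_on_divide)
  show "continuous_on ((Kcone :: (complex^'n^'n) set) \<times> sphere 0 1) (\<lambda>p. hform (fst p) (snd p))"
    using continuous_on_hform by (rule continuous_on_subset) simp
  have "continuous_on (Kcone \<times> sphere 0 1)
      ((\<lambda>p :: (complex^'n^'n) \<times> (complex^'n). hform (fst p) (snd p)) \<circ> (\<lambda>p. (imscale 0 (fst p), snd p)))"
    by (intro continuous_on_compose continuous_intros continuous_on_subset[OF continuous_on_hform]) auto
  then show "continuous_on ((Kcone :: (complex^'n^'n) set) \<times> sphere 0 1) (\<lambda>p. hform (imscale 0 (fst p)) (snd p))"
    by (simp add: o_def)
  show "\<forall>p\<in>(Kcone :: (complex^'n^'n) set) \<times> sphere 0 1. hform (imscale 0 (fst p)) (snd p) \<noteq> 0"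
  proof
    fix p :: "(complex^'n^'n) \<times> (complex^'n)" assume "p \<in> Kcone \<times> sphere 0 1"
    then have "fst p \<in> Kcone" "snd p \<noteq> 0" by auto
    from hform_real_part_pos[OF this] show "hform (imscale 0 (fst p)) (snd p) \<noteq> 0" by simp
  qed
qed

lemma margin_attained:
  assumes Z: "(Z :: complex^'n::finite^'n) \<in> Kcone"
  obtains w where "norm w = 1" "margin Z = hform Z w / hform (imscale 0 Z) w"
    and "\<And>z. norm z = 1 \<Longrightarrow> margin Z \<le> hform Z z / hform (imscale 0 Z) z"
proof -
  let ?f = "\<lambda>z. hform Z z / hform (imscale 0 Z) z"
  have "continuous_on (sphere 0 1) ((\<lambda>p. hform (fst p) (snd p) / hform (imscale 0 (fst p)) (snd p)) \<circ> (\<lambda>z. (Z, z)))"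
    by (intro continuous_on_compose continuous_intros continuous_on_subset[OF continuous_on_hform_ratio])
      (use Z in auto)
  then have "continuous_on (sphere 0 1) ?f" by (simp add: o_def)
  moreover have "axis undefined 1 \<in> (sphere 0 1 :: (complex^'n) set)" by simp
  ultimately obtain w where w: "w \<in> sphere 0 1" "\<And>z. z \<in> sphere 0 1 \<Longrightarrow> ?f w \<le> ?f z"
    using continuous_attains_inf[OF compact_sphere, of 0 1 ?f] by blast
  then have "margin Z = ?f w" unfolding margin_def by (intro cInf_eq_minimum) auto
  with w that[of w] show ?thesis by simp
qed

lemma margin_le_1:
  assumes Z: "(Z :: complex^'n::finite^'n) \<in> Kcone"
  shows "margin Z \<le> 1"
proof -
  let ?z = "axis undefined 1 :: complex^'n"
  have "hform Z ?z = hform (imscale 0 Z) ?z"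
    unfolding hform_sum by (intro sum.cong refl) (simp add: axis_def)
  moreover have "hform (imscale 0 Z) ?z > 0" by (rule hform_real_part_pos[OF Z]) (simp add: axis_eq_0_iff)
  ultimately have "hform Z ?z / hform (imscale 0 Z) ?z = 1" by simp
  moreover have "margin Z \<le> hform Z ?z / hform (imscale 0 Z) ?z"
    by (rule margin_attained[OF Z]) simp
  ultimately show ?thesis by simp
qed

lemma continuous_on_margin: "continuous_on (Kcone :: (complex^'n::finite^'n) set) margin"
  unfolding continuous_on_iff
proof (intro ballI allI impI)
  fix Z0 :: "complex^'n^'n" and \<epsilon> :: real assume Z0: "Z0 \<in> Kcone" and \<epsilon>: "\<epsilon> > 0"
  let ?f = "\<lambda>Z z. hform Z z / hform (imscale 0 Z) z"
  have "continuous_on (Kcone \<times> sphere 0 1) (\<lambda>(Z :: complex^'n^'n, z). ?f Z z)"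
    using continuous_on_hform_ratio by (simp add: case_prod_unfold)
  moreover have "\<epsilon> / 2 > 0" using \<epsilon> by simp
  ultimately obtain X where X: "Z0 \<in> X" "open X"
      and close: "\<forall>Z\<in>X \<inter> Kcone. \<forall>z\<in>sphere 0 1. dist (case (Z, z) of (Z, z) \<Rightarrow> ?f Z z)
        (case (Z0, z) of (Z, z) \<Rightarrow> ?f Z z) \<le> \<epsilon> / 2"
    by (rule continuous_on_prod_compactE[OF _ compact_sphere Z0])
  obtain d where d: "d > 0" "ball Z0 d \<subseteq> X" by (rule openE[OF X(2,1)])
  have "dist (margin Z) (margin Z0) < \<epsilon>" if Z: "Z \<in> Kcone" and dZ: "dist Z Z0 < d" for Z
  proof -
    have "Z \<in> ball Z0 d" using dZ by (simp add: dist_commute)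
    then have ZX: "Z \<in> X \<inter> Kcone" using Z d(2) by blast
    have c: "\<bar>?f Z z - ?f Z0 z\<bar> \<le> \<epsilon> / 2" if "norm z = 1" for z
      using bspec[OF bspec[OF close ZX], of z] that unfolding dist_real_def by simp
    obtain w where w: "norm w = 1" "margin Z = ?f Z w" "\<And>z. norm z = 1 \<Longrightarrow> margin Z \<le> ?f Z z"
      by (rule margin_attained[OF Z]) blast
    obtain v where v: "norm v = 1" "margin Z0 = ?f Z0 v" "\<And>z. norm z = 1 \<Longrightarrow> margin Z0 \<le> ?f Z0 z"
      by (rule margin_attained[OF Z0]) blast
    show ?thesis
      using c[OF w(1)] c[OF v(1)] w(3)[OF v(1)] v(3)[OF w(1)] w(2) v(2) \<epsilon>
      unfolding dist_real_def by linarith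
  qed
  then show "\<exists>d>0. \<forall>Z\<in>Kcone. dist Z Z0 < d \<longrightarrow> dist (margin Z) (margin Z0) < \<epsilon>"
    using d(1) by blast
qed

text \<open>Scaling the imaginary part by \<open>s\<close> scales the relative norm \<open>1 - margin Z\<close> by \<open>s\<close>.\<close>

lemma margin_imscale:
  assumes Z: "(Z :: complex^'n::finite^'n) \<in> Kcone" and s: "s \<ge> 0"
  shows "margin (imscale s Z) = 1 - s * (1 - margin Z)"
proof -
  obtain w where w: "norm w = 1" "margin Z = hform Z w / hform (imscale 0 Z) w"
    "\<And>z. norm z = 1 \<Longrightarrow> margin Z \<le> hform Z z / hform (imscale 0 Z) z"
    by (rule margin_attained[OF Z]) blast
  have eq: "hform (imscale s Z) z / hform (imscale 0 (imscale s Z)) z =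
      1 - s * (1 - hform Z z / hform (imscale 0 Z) z)" if "norm z = 1" for z
  proof -
    have "hform (imscale 0 Z) z > 0" by (rule hform_real_part_pos[OF Z]) (use that in auto)
    then show ?thesis unfolding hform_imscale[of s] by (simp add: field_simps)
  qed
  show ?thesis
    unfolding margin_def[of "imscale s Z"]
  proof (rule cInf_eq_minimum)
    have "1 - s * (1 - margin Z) = hform (imscale s Z) w / hform (imscale 0 (imscale s Z)) w"
      by (simp only: eq[OF w(1)] w(2))
    then show "1 - s * (1 - margin Z) \<in> (\<lambda>z. hform (imscale s Z) z / hform (imscale 0 (imscale s Z)) z) ` sphere 0 1"
      using w(1) by (intro image_eqI[of _ _ w]) simp_all
  next
    fix x assume "x \<in> (\<lambda>z. hform (imscale s Z) z / hform (imscale 0 (imscale s Z)) z) ` sphere 0 1"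
    then obtain z where z: "norm z = 1" "x = 1 - s * (1 - hform Z z / hform (imscale 0 Z) z)"
      using eq by auto
    show "1 - s * (1 - margin Z) \<le> x"
      unfolding z(2) using mult_left_mono[OF w(3)[OF z(1)] s] by (simp add: algebra_simps)
  qed
qed

lemma margin_scaleR: "t > 0 \<Longrightarrow> margin (t *\<^sub>R Z) = margin Z"
  by (simp add: margin_def imscale_scaleR hform_scaleR)

lemma herm_pos_cone_eq_margin: "herm_pos_cone = {Z \<in> Kcone. margin Z > 0}"
proof (intro equalityI subsetI)
  fix Z :: "complex^'n^'n" assume Z: "Z \<in> herm_pos_cone"
  then have pos: "z \<noteq> 0 \<Longrightarrow> hform Z z > 0" for z by (simp add: herm_pos_cone_hform)
  have "x \<bullet> (Re_mat Z *v x) > 0" if "x \<noteq> 0" for x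
  proof -
    have "hform Z (\<chi> i. of_real (x $ i)) > 0" by (rule pos) (use that in \<open>auto simp: vec_eq_iff\<close>)
    also have "hform Z (\<chi> i. of_real (x $ i)) = x \<bullet> (Re_mat Z *v x)"
      unfolding hform_sum by (simp add: inner_vec_def matrix_vector_mult_def sum_distrib_left mult_ac)
    finally show ?thesis .
  qed
  then have K: "Z \<in> Kcone" using Z by (simp add: Kcone_def herm_pos_cone_hform)
  obtain w where w: "norm w = 1" "margin Z = hform Z w / hform (imscale 0 Z) w"
    by (rule margin_attained[OF K]) blast
  have "w \<noteq> 0" using w(1) by auto
  then have "margin Z > 0" using pos hform_real_part_pos[OF K] w(2) by simp
  with K show "Z \<in> {Z \<in> Kcone. margin Z > 0}" by simp
next
  fix Z :: "complex^'n^'n" assume "Z \<in> {Z \<in> Kcone. margin Z > 0}"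
  then have K: "Z \<in> Kcone" and m: "margin Z > 0" by auto
  have "hform Z z > 0" if z: "z \<noteq> 0" for z
  proof -
    let ?z = "(1 / norm z) *\<^sub>R z"
    have "norm ?z = 1" "?z \<noteq> 0" using z by auto
    then have "hform Z ?z / hform (imscale 0 Z) ?z > 0"
      using m margin_attained[OF K] by (metis order_less_le_trans)
    then have "hform Z ?z > 0"
      using hform_real_part_pos[OF K \<open>?z \<noteq> 0\<close>] by (simp add: zero_less_divide_iff)
    then show ?thesis unfolding hform_scaleR_vector using z by (simp add: zero_less_mult_iff)
  qed
  then show "Z \<in> herm_pos_cone" using K by (simp add: herm_pos_cone_hform Kcone_def)
qed

text \<open>The relative norm \<open>p = 1 - margin Z\<close> is stretched to \<open>p / (1 - p)\<close>, whose inverse is \<open>q \<mapsto> q / (1 + q)\<close>.\<close>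

lemma homeomorphism_herm_pos_cone_Kcone:
  "homeomorphism (herm_pos_cone :: (complex^'n::finite^'n) set) Kcone
     (\<lambda>Z. imscale (1 / margin Z) Z) (\<lambda>Z. imscale (1 / (2 - margin Z)) Z)"
proof -
  have sub: "herm_pos_cone \<subseteq> (Kcone :: (complex^'n^'n) set)"
    by (auto simp: herm_pos_cone_eq_margin)
  have pos: "Z \<in> Kcone" "margin Z > 0" if "Z \<in> herm_pos_cone" for Z :: "complex^'n^'n"
    using that by (auto simp: herm_pos_cone_eq_margin)
  have mG: "margin (imscale (1 / (2 - margin Z)) Z) = 1 / (2 - margin Z)"
    if "Z \<in> Kcone" for Z :: "complex^'n^'n"
    using margin_le_1[OF that] by (simp add: margin_imscale[OF that] field_simps)
  have mF: "2 - margin (imscale (1 / margin Z) Z) = 1 / margin Z"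
    if "Z \<in> herm_pos_cone" for Z :: "complex^'n^'n"
    using pos[OF that] by (simp add: margin_imscale field_simps)
  have contm: "continuous_on (herm_pos_cone :: (complex^'n^'n) set) margin"
    by (rule continuous_on_subset[OF continuous_on_margin sub])
  show ?thesis
  proof (rule homeomorphismI)
    show "continuous_on (herm_pos_cone :: (complex^'n^'n) set) (\<lambda>Z. imscale (1 / margin Z) Z)"
      by (intro continuous_intros contm) (auto dest: pos)
    show "continuous_on (Kcone :: (complex^'n^'n) set) (\<lambda>Z. imscale (1 / (2 - margin Z)) Z)"
      by (intro continuous_intros continuous_on_margin) (auto dest: margin_le_1)
    show "(\<lambda>Z. imscale (1 / margin Z) Z) ` herm_pos_cone \<subseteq> (Kcone :: (complex^'n^'n) set)"
      using pos by (auto intro: imscale_Kcone)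
    show "(\<lambda>Z. imscale (1 / (2 - margin Z)) Z) ` Kcone \<subseteq> (herm_pos_cone :: (complex^'n^'n) set)"
    proof (intro image_subsetI)
      fix Z :: "complex^'n^'n" assume Z: "Z \<in> Kcone"
      then show "imscale (1 / (2 - margin Z)) Z \<in> herm_pos_cone"
        using margin_le_1[OF Z] by (simp add: herm_pos_cone_eq_margin mG imscale_Kcone)
    qed
    show "imscale (1 / (2 - margin (imscale (1 / margin Z) Z))) (imscale (1 / margin Z) Z) = Z"
      if "Z \<in> herm_pos_cone" for Z :: "complex^'n^'n"
      using pos[OF that] by (simp add: mF[OF that])
    show "imscale (1 / margin (imscale (1 / (2 - margin Z)) Z)) (imscale (1 / (2 - margin Z)) Z) = Z"
      if "Z \<in> Kcone" for Z :: "complex^'n^'n"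
      using margin_le_1[OF that] by (simp add: mG[OF that])
  qed
qed

lemma cone_isomorphic_Kcone:
  "cone_isomorphic (realify ` (herm_pos_cone :: (complex^'n::finite^'n) set)) (Kcone :: (complex^'n^'n) set)"
proof -
  define u where "u M = (\<chi> i j. of_real (M $ Inl i $ Inl j) + \<i> * of_real (M $ Inl i $ Inr j))"
    for M :: "real^('n + 'n)^('n + 'n)"
  have ur: "u (realify Z) = Z" for Z
    by (simp add: u_def realify_def Re_mat_def Im_mat_def vec_eq_iff complex_eq_iff)
  have "homeomorphism (realify ` herm_pos_cone) herm_pos_cone u realify"
  proof (rule homeomorphismI)
    show "continuous_on (realify ` herm_pos_cone) u" unfolding u_def by (intro continuous_intros)
    have "linear (realify :: complex^'n^'n \<Rightarrow> _)"
      by (rule linearI) (simp_all add: realify_def vec_eq_iff_Plus Re_mat_def Im_mat_def)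
    then show "continuous_on (herm_pos_cone :: (complex^'n^'n) set) realify"
      by (intro linear_continuous_on) (simp add: linear_conv_bounded_linear)
  qed (auto simp: ur)
  from homeomorphism_compose[OF this homeomorphism_herm_pos_cone_Kcone]
  have "homeomorphism (realify ` herm_pos_cone) Kcone ((\<lambda>Z. imscale (1 / margin Z) Z) \<circ> u)
      (realify \<circ> (\<lambda>Z. imscale (1 / (2 - margin Z)) Z))" .
  moreover have "u (t *\<^sub>R M) = t *\<^sub>R u M" for t M
    by (simp add: u_def vec_eq_iff complex_eq_iff)
  then have "\<forall>M\<in>realify ` herm_pos_cone. \<forall>t>0. ((\<lambda>Z. imscale (1 / margin Z) Z) \<circ> u) (t *\<^sub>R M) =
      t *\<^sub>R ((\<lambda>Z. imscale (1 / margin Z) Z) \<circ> u) M"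
    by (simp add: margin_scaleR imscale_scaleR)
  ultimately show ?thesis unfolding cone_isomorphic_def by blast
qed

section \<open>The fibres of the retraction\<close>

text \<open>Conjugation by \<open>T\<close> moves the given complex structure to \<open>Jstd\<close>. With the standard symplectic form, \<open>Jstd\<close> is
  compatible with a metric iff it is orthogonal for it, that is, iff it commutes with its matrix.\<close>

lemma fibre_rmap:
  fixes e :: "'n::finite + 'n \<Rightarrow> 'v::real_vector"
  assumes b: "symplectic_basis \<omega> e" and \<omega>: "\<omega> \<in> Symp" and T: "symplectic T"
  shows "{p \<in> Met \<times> {\<omega>}. rmap p = endo e (matrix_inv T ** Jstd ** T)} =
    (\<lambda>M. (form_of e (transpose T ** M ** T), \<omega>)) ` realify ` herm_pos_cone"
proof -
  have e: "is_basis e" and om: "\<omega> = form_of e (- Jstd)" using b by (auto simp: symplectic_basis_iff)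
  note invT = symplectic_inv(1)[OF T]
  let ?Ti = "matrix_inv T" and ?J = "matrix_inv T ** Jstd ** T"
  have iTi: "invertible ?Ti" by (rule invertible_matrix_inv[OF invT])
  have TJT: "transpose T ** (- Jstd) ** T = - Jstd" using T by (simp add: symplectic_def)
  have TiJTi: "transpose ?Ti ** (- Jstd) ** ?Ti = - Jstd"
    using symplectic_matrix_inv[OF T] by (simp add: symplectic_def)
  have std: "compatible_matrix M (- Jstd) Jstd \<longleftrightarrow> M ** Jstd = Jstd ** M" for M
  proof -
    have "transpose Jstd ** M ** Jstd = M \<longleftrightarrow> M ** Jstd = Jstd ** M"
    proof
      assume "transpose Jstd ** M ** Jstd = M"
      then have "Jstd ** (- (Jstd ** M ** Jstd)) = Jstd ** M" by simp
      then show "M ** Jstd = Jstd ** M" by (simp add: matrix_mul_assoc Jstd_square)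
    next
      assume "M ** Jstd = Jstd ** M"
      then have "Jstd ** (M ** Jstd) = Jstd ** (Jstd ** M)" by simp
      then show "transpose Jstd ** M ** Jstd = M" by (simp add: matrix_mul_assoc Jstd_square)
    qed
    then show ?thesis by (simp add: compatible_matrix_def Jstd_square posdef_mat1)
  qed
  have iff: "rmap (form_of e B, \<omega>) = endo e ?J \<longleftrightarrow> compatible_matrix B (- Jstd) ?J"
    if "posdef B" for B
    using that \<omega> rmap_eq_iff[OF e, of "form_of e B" \<omega>] compatible_endo_iff[OF e]
    by (simp add: form_of_in_Met_iff[OF e] om)
  show ?thesis
    unfolding realify_herm_pos_cone
  proof (intro equalityI subsetI)
    fix p assume p: "p \<in> {p \<in> Met \<times> {\<omega>}. rmap p = endo e ?J}"
    then have "fst p \<in> Met" by auto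
    then obtain B where B: "posdef B" "fst p = form_of e B" by (rule Met_cases[OF e])
    then have p': "p = (form_of e B, \<omega>)" using p by auto
    then have "compatible_matrix B (- Jstd) ?J" using p iff[OF B(1)] by simp
    from compatible_matrix_congruence[OF iTi this]
    have "compatible_matrix (transpose ?Ti ** B ** ?Ti) (- Jstd) Jstd"
      unfolding TiJTi matrix_inv_matrix_inv[OF invT]
      by (simp add: matrix_mul_assoc matrix_inv_mult[OF invT] matrix_inv_cancel[OF invT])
    then have M: "transpose ?Ti ** B ** ?Ti \<in> {M. posdef M \<and> M ** Jstd = Jstd ** M}"
      using posdef_congruence[OF B(1) iTi] std by blast
    have "transpose T ** (transpose ?Ti ** B ** ?Ti) ** T = B"
      by (simp add: matrix_mul_assoc matrix_inv_cancel[OF invT] transpose_matrix_inv[OF invT]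
          matrix_inv_mult[OF transpose_invertible[OF invT]])
    then have "p = (form_of e (transpose T ** (transpose ?Ti ** B ** ?Ti) ** T), \<omega>)" by (simp only: p')
    with M show "p \<in> (\<lambda>M. (form_of e (transpose T ** M ** T), \<omega>)) ` {M. posdef M \<and> M ** Jstd = Jstd ** M}"
      by (intro image_eqI)
  next
    fix p assume "p \<in> (\<lambda>M. (form_of e (transpose T ** M ** T), \<omega>)) ` {M. posdef M \<and> M ** Jstd = Jstd ** M}"
    then obtain M where M: "posdef M" "M ** Jstd = Jstd ** M" "p = (form_of e (transpose T ** M ** T), \<omega>)" by blast
    have P: "posdef (transpose T ** M ** T)" by (rule posdef_congruence[OF M(1) invT])
    have "compatible_matrix (transpose T ** M ** T) (- Jstd) ?J"
      using compatible_matrix_congruence[OF invT, of M "- Jstd" Jstd] M(2) std unfolding TJT by blast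
    then have "rmap p = endo e ?J" using iff[OF P] M(3) by simp
    moreover have "p \<in> Met \<times> {\<omega>}" using P by (simp add: M(3) form_of_in_Met_iff[OF e])
    ultimately show "p \<in> {p \<in> Met \<times> {\<omega>}. rmap p = endo e ?J}" by blast
  qed
qed

section \<open>Coset descriptions\<close>

lemma bij_betw_same_fibres:
  assumes A: "A = q ` C" and D: "D = p ` C"
    and \<Phi>: "\<And>x. x \<in> C \<Longrightarrow> \<Phi> (q x) = p x"
    and fibres: "\<And>x y. x \<in> C \<Longrightarrow> y \<in> C \<Longrightarrow> p x = p y \<Longrightarrow> q x = q y"
  shows "bij_betw \<Phi> A D"
  unfolding bij_betw_def
proof
  show "inj_on \<Phi> A"
    unfolding A
  proof (intro inj_onI, elim imageE)
    fix a b x y assume "\<Phi> a = \<Phi> b" "a = q x" "x \<in> C" "b = q y" "y \<in> C"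
    then show "a = b" using \<Phi>[of x] \<Phi>[of y] fibres[of x y] by simp
  qed
  show "\<Phi> ` A = D" unfolding A D by (auto simp: \<Phi> image_iff)
qed

lemma rcosets_eq_image: "rcosets\<^bsub>G\<^esub> H = (\<lambda>T. H #>\<^bsub>G\<^esub> T) ` carrier G"
  by (auto simp: RCOSETS_def)


text \<open>The coset of a metric and that of a complex structure are defined as the fibres of the two
  parametrisations, so that no representative has to be chosen.\<close>

definition metric_coset :: "('m::finite \<Rightarrow> 'v::real_vector) \<Rightarrow> 'v form \<Rightarrow> (real^'m^'m) set" where
  "metric_coset e b = {T \<in> carrier GLp. form_of e (transpose T ** T) = b}"

definition structure_coset :: "('n::finite + 'n \<Rightarrow> 'v::real_vector) \<Rightarrow> ('v \<Rightarrow> 'v) \<Rightarrow> (real^('n + 'n)^('n + 'n)) set" where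
  "structure_coset e J = {T \<in> carrier Sp. endo e (matrix_inv T ** Jstd ** T) = J}"

lemma metric_coset_gram:
  assumes e: "is_basis e" and T: "T \<in> carrier GLp"
  shows "metric_coset e (form_of e (transpose T ** T)) = SO #>\<^bsub>GLp\<^esub> T"
  using T SO_coset[of T] by (simp add: metric_coset_def form_of_eq_iff[OF e])

lemma structure_coset_conj:
  assumes e: "is_basis e" and T: "T \<in> carrier Sp"
  shows "structure_coset e (endo e (matrix_inv T ** Jstd ** T)) = Ugrp #>\<^bsub>Sp\<^esub> T"
proof -
  have "endo e (matrix_inv S ** Jstd ** S) = endo e (matrix_inv T ** Jstd ** T) \<longleftrightarrow>
      transpose S ** S = transpose T ** T" if S: "symplectic S" for S
  proof -
    have "Jstd ** (transpose S ** S) = Jstd ** (transpose T ** T) \<longleftrightarrow> transpose S ** S = transpose T ** T"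
      by (metis Jstd_cancel(2) minus_minus)
    then show ?thesis using S T by (simp add: endo_eq_iff[OF e] conj_Jstd)
  qed
  then have "structure_coset e (endo e (matrix_inv T ** Jstd ** T)) =
      {S \<in> carrier Sp. transpose S ** S = transpose T ** T}"
    unfolding structure_coset_def by (intro Collect_cong conj_cong refl) simp
  then show ?thesis using T Ugrp_coset[of T] by simp
qed

lemma Met_eq_image_GLp:
  fixes \<omega> :: "'v::real_vector form" and e :: "'m::finite \<Rightarrow> 'v"
  assumes e: "is_basis e"
  shows "Met \<times> {\<omega>} = (\<lambda>T. (form_of e (transpose T ** T), \<omega>)) ` carrier GLp"
proof (intro equalityI subsetI)
  fix p :: "'v form \<times> 'v form" assume p: "p \<in> Met \<times> {\<omega>}"
  then have "fst p \<in> Met" by auto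
  then obtain B where B: "posdef B" "fst p = form_of e B" by (rule Met_cases[OF e])
  obtain T where T: "det T > 0" "B = transpose T ** T" using B(1) posdef_iff_gram by blast
  then have "p = (form_of e (transpose T ** T), \<omega>)" using p B(2) by auto
  then show "p \<in> (\<lambda>T. (form_of e (transpose T ** T), \<omega>)) ` carrier GLp"
    using T(1) by (intro image_eqI[of _ _ T]) simp_all
qed (auto simp: form_of_in_Met_iff[OF e] posdef_gram det_pos_invertible)

lemma tamed_eq_image_Sp:
  assumes b: "symplectic_basis \<omega> e" and \<omega>: "\<omega> \<in> Symp"
  shows "tamed \<omega> = (\<lambda>T. endo e (matrix_inv T ** Jstd ** T)) ` carrier Sp"
proof (intro equalityI subsetI)
  fix J assume "J \<in> tamed \<omega>"
  then obtain T where T: "symplectic T" "J = endo e (matrix_inv T ** Jstd ** T)"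
    by (rule tamed_cases[OF b \<omega>])
  then show "J \<in> (\<lambda>T. endo e (matrix_inv T ** Jstd ** T)) ` carrier Sp"
    by (intro image_eqI[of _ _ T]) simp_all
next
  fix J assume "J \<in> (\<lambda>T. endo e (matrix_inv T ** Jstd ** T)) ` carrier Sp"
  then obtain T where T: "symplectic T" "J = endo e (matrix_inv T ** Jstd ** T)" by auto
  have "posdef (transpose T ** T) \<and> symplectic (transpose T ** T)"
    using T(1) symplectic_posdef_iff_gram by blast
  then show "J \<in> tamed \<omega>"
    unfolding T(2) conj_Jstd[OF T(1)] using tamed_symplectic_basis(1)[OF b \<omega>] by blast
qed

lemma quotient_map_met:
  fixes \<omega> :: "'v::real_vector form" and e :: "'m::finite \<Rightarrow> 'v"
  assumes e: "is_basis e"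
  shows "quotient_map (top_of_set (carrier GLp)) (met_topology e (Met \<times> {\<omega>}))
    (\<lambda>T. (form_of e (transpose T ** T), \<omega>))"
  unfolding met_topology_def
proof (rule quotient_map_pullback_topology)
  let ?m = "\<lambda>p. (\<chi> i j. fst p (e i) (e j)) :: real^'m^'m"
  let ?q = "\<lambda>T. (form_of e (transpose T ** T), \<omega>)"
  have m: "?m (form_of e P, \<omega>) = P" for P
    by (simp add: vec_eq_iff form_of_entry[OF e])
  have "carrier GLp = {T :: real^'m^'m. det T > 0}" by auto
  then have "closedin (top_of_set {T :: real^'m^'m. det T > 0}) (carrier GLp)" by simp
  from quotient_map_gram[OF this, of "mat 1"]
  have quot: "quotient_map (top_of_set (carrier GLp)) (top_of_set ((\<lambda>T. transpose T ** T) ` carrier GLp))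
      (\<lambda>T :: real^'m^'m. transpose T ** T)"
    using posdef_invertible[OF posdef_mat1] by simp
  have comp: "?m \<circ> ?q = (\<lambda>T. transpose T ** T)" by (simp only: o_def m)
  have "?m ` (Met \<times> {\<omega>}) = (\<lambda>T. transpose T ** T) ` carrier GLp"
    unfolding Met_eq_image_GLp[OF e] image_comp comp ..
  then show "quotient_map (top_of_set (carrier GLp)) (top_of_set (?m ` (Met \<times> {\<omega>}))) (?m \<circ> ?q)"
    using quot unfolding comp by simp
  show "inj_on ?m (Met \<times> {\<omega>})"
    unfolding Met_eq_image_GLp[OF e] by (intro inj_onI, elim imageE) (simp only: m)
  show "?q ` topspace (top_of_set (carrier GLp)) \<subseteq> Met \<times> {\<omega>}"
    unfolding Met_eq_image_GLp[OF e] by simp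
qed

lemma closedin_carrier_Sp: "closedin (top_of_set {T. det T > 0}) (carrier Sp)"
proof -
  have "closed {T :: real^('a + 'a)^('a + 'a). transpose T ** Jstd ** T = Jstd}"
    by (intro closed_Collect_eq continuous_intros)
  then have "closedin (top_of_set {T. det T > 0})
      ({T. det T > 0} \<inter> {T :: real^('a + 'a)^('a + 'a). transpose T ** Jstd ** T = Jstd})"
    by (rule closedin_closed_Int)
  moreover have "{T. det T > 0} \<inter> {T :: real^('a + 'a)^('a + 'a). transpose T ** Jstd ** T = Jstd} = carrier Sp"
    using symplectic_det_pos by (auto simp: symplectic_def)
  ultimately show ?thesis by simp
qed

lemma quotient_map_tamed:
  fixes \<omega> :: "'v::real_vector form" and e :: "'n::finite + 'n \<Rightarrow> 'v"
  assumes b: "symplectic_basis \<omega> e" and \<omega>: "\<omega> \<in> Symp"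
  shows "quotient_map (top_of_set (carrier Sp)) (endo_topology e (tamed \<omega>))
    (\<lambda>T. endo e (matrix_inv T ** Jstd ** T))"
proof -
  have e: "is_basis e" using b by (simp add: symplectic_basis_iff)
  let ?m = "\<lambda>J. matrix (\<lambda>x. coords e (J (frame e x)))"
  let ?q = "\<lambda>T. endo e (matrix_inv T ** Jstd ** T)"
  let ?q' = "\<lambda>T. endo e (Jstd ** (transpose T ** T))"
  have m: "?m (endo e K) = K" for K by (rule matrix_endo[OF e])
  have qq: "?q T = ?q' T" if "T \<in> carrier Sp" for T using that by (simp add: conj_Jstd)
  have "invertible (Jstd :: real^('n + 'n)^('n + 'n))"
    by (rule symplectic_inv(1)) (simp add: symplectic_def Jstd_square)
  from quotient_map_gram[OF closedin_carrier_Sp this]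
  have quot: "quotient_map (top_of_set (carrier Sp)) (top_of_set ((\<lambda>T. Jstd ** (transpose T ** T)) ` carrier Sp))
      (\<lambda>T :: real^('n + 'n)^('n + 'n). Jstd ** (transpose T ** T))" .
  have comp: "?m \<circ> ?q' = (\<lambda>T. Jstd ** (transpose T ** T))" by (simp only: o_def m)
  have tamed: "tamed \<omega> = ?q' ` carrier Sp"
    unfolding tamed_eq_image_Sp[OF b \<omega>] by (rule image_cong[OF refl qq])
  have "quotient_map (top_of_set (carrier Sp)) (endo_topology e (tamed \<omega>)) ?q'"
    unfolding endo_topology_def
  proof (rule quotient_map_pullback_topology)
    have "?m ` tamed \<omega> = (\<lambda>T. Jstd ** (transpose T ** T)) ` carrier Sp"
      unfolding tamed image_comp comp ..
    then show "quotient_map (top_of_set (carrier Sp)) (top_of_set (?m ` tamed \<omega>)) (?m \<circ> ?q')"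
      using quot unfolding comp by simp
    show "inj_on ?m (tamed \<omega>)"
      unfolding tamed by (intro inj_onI, elim imageE) (simp only: m)
    show "?q' ` topspace (top_of_set (carrier Sp)) \<subseteq> tamed \<omega>"
      unfolding tamed by simp
  qed
  then show ?thesis by (rule quotient_map_eq) (simp add: qq)
qed

lemma metric_coset_homeomorphism:
  fixes \<omega> :: "'v::real_vector form" and e :: "'m::finite \<Rightarrow> 'v"
  assumes e: "is_basis e"
  shows "homeomorphic_map (met_topology e (Met \<times> {\<omega>})) (coset_topology GLp SO) (\<lambda>p. metric_coset e (fst p))"
    and "bij_betw (\<lambda>p. metric_coset e (fst p)) (Met \<times> {\<omega>}) (rcosets\<^bsub>GLp\<^esub> SO)"
proof -
  let ?q = "\<lambda>T. (form_of e (transpose T ** T), \<omega>)"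
  have fib: "?q S = ?q T" if "S \<in> carrier GLp" "T \<in> carrier GLp" "SO #>\<^bsub>GLp\<^esub> S = SO #>\<^bsub>GLp\<^esub> T" for S T
    using that SO_coset_eq_iff[of S T] by simp
  have val: "metric_coset e (fst (?q T)) = SO #>\<^bsub>GLp\<^esub> T" if "T \<in> carrier GLp" for T
    unfolding fst_conv by (rule metric_coset_gram[OF e that])
  show "homeomorphic_map (met_topology e (Met \<times> {\<omega>})) (coset_topology GLp SO) (\<lambda>p. metric_coset e (fst p))"
    by (rule homeomorphic_map_same_fibres[OF quotient_map_met[OF e] quotient_map_coset])
      (simp_all only: topspace_euclidean_subtopology val, rule fib)
  show "bij_betw (\<lambda>p. metric_coset e (fst p)) (Met \<times> {\<omega>}) (rcosets\<^bsub>GLp\<^esub> SO)"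
    by (rule bij_betw_same_fibres[OF Met_eq_image_GLp[OF e] rcosets_eq_image])
      (simp_all only: val, rule fib)
qed

lemma structure_coset_homeomorphism:
  fixes \<omega> :: "'v::real_vector form" and e :: "'n::finite + 'n \<Rightarrow> 'v"
  assumes b: "symplectic_basis \<omega> e" and \<omega>: "\<omega> \<in> Symp"
  shows "homeomorphic_map (endo_topology e (tamed \<omega>)) (coset_topology Sp Ugrp) (structure_coset e)"
    and "bij_betw (structure_coset e) (tamed \<omega>) (rcosets\<^bsub>Sp\<^esub> Ugrp)"
proof -
  have e: "is_basis e" using b by (simp add: symplectic_basis_iff)
  let ?q = "\<lambda>T. endo e (matrix_inv T ** Jstd ** T)"
  have fib: "?q S = ?q T" if "S \<in> carrier Sp" "T \<in> carrier Sp" "Ugrp #>\<^bsub>Sp\<^esub> S = Ugrp #>\<^bsub>Sp\<^esub> T" for S T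
    using that Ugrp_coset_eq_iff[of S T] by (simp add: conj_Jstd)
  show "homeomorphic_map (endo_topology e (tamed \<omega>)) (coset_topology Sp Ugrp) (structure_coset e)"
    by (rule homeomorphic_map_same_fibres[OF quotient_map_tamed[OF b \<omega>] quotient_map_coset])
      (simp_all only: topspace_euclidean_subtopology structure_coset_conj[OF e], rule fib)
  show "bij_betw (structure_coset e) (tamed \<omega>) (rcosets\<^bsub>Sp\<^esub> Ugrp)"
    by (rule bij_betw_same_fibres[OF tamed_eq_image_Sp[OF b \<omega>] rcosets_eq_image])
      (simp_all only: structure_coset_conj[OF e], rule fib)
qed

lemma metric_coset_equivariant:
  assumes e: "is_basis e" and g: "g \<in> carrier GLp" and b: "b \<in> Met"
  shows "metric_coset e (pull (endo e g) b) = metric_coset e b #>\<^bsub>GLp\<^esub> g"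
proof -
  have "(b, b) \<in> (\<lambda>T. (form_of e (transpose T ** T), b)) ` carrier GLp"
    using b by (simp add: Met_eq_image_GLp[OF e, symmetric])
  then obtain T where T: "T \<in> carrier GLp" "b = form_of e (transpose T ** T)" by blast
  have Tg: "T ** g \<in> carrier GLp" using T(1) g by (simp add: det_mul)
  have "pull (endo e g) b = form_of e (transpose (T ** g) ** (T ** g))"
    unfolding T(2) pull_form_of[OF e] by (simp add: matrix_transpose_mul matrix_mul_assoc)
  then have "metric_coset e (pull (endo e g) b) = SO #>\<^bsub>GLp\<^esub> (T ** g)"
    by (simp only: metric_coset_gram[OF e Tg])
  also have "\<dots> = (SO #>\<^bsub>GLp\<^esub> T) #>\<^bsub>GLp\<^esub> g"
    using group.coset_mult_assoc[OF group_GLp subgroup.subset[OF subgroup_SO] T(1) g] by simp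
  finally show ?thesis unfolding T(2) metric_coset_gram[OF e T(1)] .
qed

lemma structure_coset_equivariant:
  fixes \<omega> :: "'v::real_vector form" and e :: "'n::finite + 'n \<Rightarrow> 'v"
  assumes b: "symplectic_basis \<omega> e" and \<omega>: "\<omega> \<in> Symp" and g: "g \<in> carrier Sp" and J: "J \<in> tamed \<omega>"
  shows "structure_coset e (conj_cs (endo e g) J) = structure_coset e J #>\<^bsub>Sp\<^esub> g"
proof -
  have e: "is_basis e" using b by (simp add: symplectic_basis_iff)
  have ig: "invertible g" using g symplectic_inv(1) by simp
  obtain T where T: "T \<in> carrier Sp" "J = endo e (matrix_inv T ** Jstd ** T)"
    using J unfolding tamed_eq_image_Sp[OF b \<omega>] by blast
  then have iT: "invertible T" using symplectic_inv(1) by simp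
  have Tg: "T ** g \<in> carrier Sp" using T(1) g by (simp add: symplectic_mult)
  have "conj_cs (endo e g) J = endo e (matrix_inv (T ** g) ** Jstd ** (T ** g))"
    unfolding T(2) conj_cs_endo[OF e ig] matrix_inv_mul[OF iT ig] by (simp add: matrix_mul_assoc)
  then have "structure_coset e (conj_cs (endo e g) J) = Ugrp #>\<^bsub>Sp\<^esub> (T ** g)"
    by (simp only: structure_coset_conj[OF e Tg])
  also have "\<dots> = (Ugrp #>\<^bsub>Sp\<^esub> T) #>\<^bsub>Sp\<^esub> g"
    using group.coset_mult_assoc[OF group_Sp subgroup.subset[OF subgroup_Ugrp] T(1) g] by simp
  finally show ?thesis unfolding T(2) structure_coset_conj[OF e T(1)] .
qed

lemma beta_corresponds_jmap:
  fixes \<omega> :: "'v::real_vector form" and e :: "'n::finite + 'n \<Rightarrow> 'v"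
  assumes b: "symplectic_basis \<omega> e" and \<omega>: "\<omega> \<in> Symp" and J: "J \<in> tamed \<omega>"
  shows "metric_coset e (fst (beta \<omega> J)) = jmap (structure_coset e J)"
proof -
  have e: "is_basis e" using b by (simp add: symplectic_basis_iff)
  obtain T where T: "T \<in> carrier Sp" "J = endo e (matrix_inv T ** Jstd ** T)"
    using J unfolding tamed_eq_image_Sp[OF b \<omega>] by blast
  then have s: "symplectic T" by simp
  have "fst (beta \<omega> J) = form_of e (transpose T ** T)"
    unfolding beta_def fst_conv T(2) conj_Jstd[OF s] by (rule tamed_symplectic_basis(2)[OF b \<omega>])
  moreover have "T \<in> carrier GLp" using s by (simp add: symplectic_det_pos)
  ultimately show ?thesis
    by (simp only: metric_coset_gram[OF e] T(2) structure_coset_conj[OF e T(1)] jmap_coset[OF s])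
qed

section \<open>Group actions on columns\<close>

lemma right_action_pair_act:
  fixes e :: "'m::finite \<Rightarrow> 'v::real_vector"
  assumes e: "is_basis e"
  shows "right_action (GLp \<times>\<times> GLp) (Met \<times> Symp) (pair_act e)"
  unfolding right_action_def
proof (intro conjI ballI)
  have inv: "endo e (matrix_inv g) (endo e g x) = x" "endo e g (endo e (matrix_inv g) x) = x"
    if "g \<in> carrier GLp" for g x
    using endo_inverse[OF e det_pos_invertible, of g] that by (auto simp: fun_eq_iff)
  show "Group.group (GLp \<times>\<times> (GLp :: (real, 'm) sqmat monoid))" by (intro DirProd_group group_GLp)
  show "pair_act e \<one>\<^bsub>GLp \<times>\<times> GLp\<^esub> x = x" for x
    by (simp add: pair_act_def endo_mat1[OF e] pull_def split: prod.split)
  show "pair_act e g x \<in> Met \<times> Symp" if "g \<in> carrier (GLp \<times>\<times> GLp)" "x \<in> Met \<times> Symp" for g x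
    using that inv by (auto simp: pair_act_def intro!: pull_Met[of _ "endo e (matrix_inv _)"]
        pull_Symp[of _ "endo e (matrix_inv _)"] linear_endo[OF e])
  show "pair_act e (g \<otimes>\<^bsub>GLp \<times>\<times> GLp\<^esub> h) x = pair_act e h (pair_act e g x)" for g h x
    by (cases g; cases h; cases x) (simp add: pair_act_def endo_mult[OF e] pull_def)
qed

lemma subgroup_diagonal:
  assumes "Group.group G" shows "subgroup {(g, g) | g. g \<in> carrier G} (G \<times>\<times> G)"
proof -
  interpret Group.group G by fact
  show ?thesis by unfold_locales (auto simp: inv_DirProd[OF assms assms])
qed

lemma column_act_diagonal:
  assumes e: "is_basis e" and g: "det g > 0"
  shows "column_act e (g, g) (form_column \<sigma>) = form_column (pull (endo e g) \<sigma>)"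
proof -
  have inv: "endo e (matrix_inv g) (endo e g x) = x" "endo e g (endo e (matrix_inv g) x) = x" for x
    using endo_inverse[OF e det_pos_invertible[OF g]] by (auto simp: fun_eq_iff)
  note c = column_pull[of "endo e g" "endo e (matrix_inv g)", OF linear_endo[OF e] linear_endo[OF e] inv]
  have pa: "pair_act e (g, g) = (\<lambda>(b, \<tau>). (pull (endo e g) b, pull (endo e g) \<tau>))"
    by (simp add: pair_act_def)
  have "pair_act e (g, g) ` (Met \<times> {\<sigma>}) = (pull (endo e g) ` Met) \<times> {pull (endo e g) \<sigma>}"
    unfolding pa by force
  then show ?thesis by (simp add: column_act_def form_column_def pa c)
qed

text \<open>A symplectic \<open>T\<close> fixes \<open>\<omega>\<close>, so on the column of \<open>\<omega>\<close> the pair \<open>(T, 1)\<close> acts like the diagonal element \<open>(T, T)\<close>.\<close>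

lemma column_act_symplectic:
  fixes \<omega> :: "'v::real_vector form" and e :: "'n::finite + 'n \<Rightarrow> 'v"
  assumes b: "symplectic_basis \<omega> e" and T: "symplectic T"
  shows "column_act e (T, mat 1) (form_column \<omega>) = form_column \<omega>"
proof -
  have e: "is_basis e" and om: "\<omega> = form_of e (- Jstd)" using b by (auto simp: symplectic_basis_iff)
  have pullT: "pull (endo e T) \<omega> = \<omega>"
    unfolding om pull_form_of[OF e] using T by (simp add: symplectic_def)
  have pull1: "pull (endo e (mat 1)) \<omega> = \<omega>" by (simp add: pull_def endo_mat1[OF e])
  have pa: "pair_act e (T, mat 1) p = pair_act e (T, T) p" if "snd p = \<omega>" for p
    using that pullT pull1 by (cases p) (simp add: pair_act_def)
  have "pair_act e (T, mat 1) ` (Met \<times> {\<omega>}) = pair_act e (T, T) ` (Met \<times> {\<omega>})"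
    by (rule image_cong) (auto intro: pa)
  moreover have "pair_act e (T, mat 1) ` beta \<omega> ` tamed \<omega> = pair_act e (T, T) ` beta \<omega> ` tamed \<omega>"
    by (rule image_cong) (auto intro: pa simp: beta_def)
  ultimately have "column_act e (T, mat 1) (form_column \<omega>) = column_act e (T, T) (form_column \<omega>)"
    by (simp add: column_act_def form_column_def)
  also have "\<dots> = form_column \<omega>"
    using column_act_diagonal[OF e symplectic_det_pos[OF T], of \<omega>] pullT by simp
  finally show ?thesis .
qed

section \<open>Metrics, tamed structures and coset spaces\<close>

theorem theorem6p13:
  fixes \<omega> :: "'v::real_vector form"
  assumes dimV: "dim (UNIV :: 'v set) = 2 * CARD('n::finite)"
    and symp: "\<omega> \<in> Symp"
  shows
    \<comment> \<open>the maps r, beta, rho and j are well defined\<close>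
    "((\<forall>b\<in>Met. \<forall>\<sigma>\<in>(Symp :: 'v form set). \<exists>!J. compatible b \<sigma> J) \<and>
      rmap \<in> Met \<times> {\<omega>} \<rightarrow> tamed \<omega> \<and>
      beta \<omega> \<in> tamed \<omega> \<rightarrow> Met \<times> {\<omega>} \<and>
      rho \<in> Met \<times> (Symp :: 'v form set) \<rightarrow> CohPair \<and>
      Group.group (GLp :: (real, 'n + 'n) sqmat monoid) \<and>
      subgroup (SO :: (real, 'n + 'n) sqmat set) GLp \<and>
      subgroup (carrier (Sp :: (real, 'n + 'n) sqmat monoid)) GLp \<and>
      subgroup (Ugrp :: (real, 'n + 'n) sqmat set) Sp \<and>
      jmap \<in> rcosets\<^bsub>Sp\<^esub> (Ugrp :: (real, 'n + 'n) sqmat set) \<rightarrow> rcosets\<^bsub>GLp\<^esub> SO \<and>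
      (\<forall>T\<in>carrier (Sp :: (real, 'n + 'n) sqmat monoid). jmap (Ugrp #>\<^bsub>Sp\<^esub> T) = SO #>\<^bsub>GLp\<^esub> T))
   \<and> \<comment> \<open>(a)\<close>
     (beta \<omega> ` tamed \<omega> \<subseteq> CohPair \<and>
      bij_betw (beta \<omega>) (tamed \<omega>) (beta \<omega> ` tamed \<omega>) \<and>
      bij_betw jmap (rcosets\<^bsub>Sp\<^esub> (Ugrp :: (real, 'n + 'n) sqmat set)) (jmap ` (rcosets\<^bsub>Sp\<^esub> Ugrp)) \<and>
      (\<exists>e :: 'n + 'n \<Rightarrow> 'v. symplectic_basis \<omega> e) \<and>
      (\<forall>e :: 'n + 'n \<Rightarrow> 'v. symplectic_basis \<omega> e \<longrightarrow>
        (\<exists>\<Phi> \<Psi>.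
          bij_betw \<Phi> (Met \<times> {\<omega>}) (rcosets\<^bsub>GLp\<^esub> SO) \<and>
          bij_betw \<Psi> (tamed \<omega>) (rcosets\<^bsub>Sp\<^esub> Ugrp) \<and>
          (\<forall>T\<in>carrier GLp. (form_of e (transpose T ** T), \<omega>) \<in> Met \<times> {\<omega>} \<and>
             \<Phi> (form_of e (transpose T ** T), \<omega>) = SO #>\<^bsub>GLp\<^esub> T) \<and>
          (\<forall>T\<in>carrier Sp. endo e (matrix_inv T ** Jstd ** T) \<in> tamed \<omega> \<and>
             \<Psi> (endo e (matrix_inv T ** Jstd ** T)) = Ugrp #>\<^bsub>Sp\<^esub> T) \<and>
          \<comment> \<open>isomorphisms of homogeneous spaces\<close>
          homeomorphic_map (met_topology e (Met \<times> {\<omega>})) (coset_topology GLp SO) \<Phi> \<and>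
          homeomorphic_map (endo_topology e (tamed \<omega>)) (coset_topology Sp Ugrp) \<Psi> \<and>
          (\<forall>g\<in>carrier GLp. \<forall>b\<in>Met. \<Phi> (pull (endo e g) b, \<omega>) = \<Phi> (b, \<omega>) #>\<^bsub>GLp\<^esub> g) \<and>
          (\<forall>g\<in>carrier Sp. \<forall>J\<in>tamed \<omega>. \<Psi> (conj_cs (endo e g) J) = \<Psi> J #>\<^bsub>Sp\<^esub> g) \<and>
          \<comment> \<open>beta corresponds to j\<close>
          (\<forall>J\<in>tamed \<omega>. \<Phi> (beta \<omega> J) = jmap (\<Psi> J)) \<and>
          \<Phi> ` (beta \<omega> ` tamed \<omega>) = jmap ` (rcosets\<^bsub>Sp\<^esub> Ugrp))) \<and>
      \<comment> \<open>the remaining inclusions and commutativities of the diagram\<close>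
      beta \<omega> ` tamed \<omega> \<subseteq> Met \<times> {\<omega>} \<and>
      Met \<times> {\<omega>} \<subseteq> Met \<times> Symp \<and>
      (CohPair :: ('v form \<times> 'v form) set) \<subseteq> Met \<times> Symp \<and>
      jmap ` (rcosets\<^bsub>Sp\<^esub> (Ugrp :: (real, 'n + 'n) sqmat set)) \<subseteq> rcosets\<^bsub>GLp\<^esub> SO \<and>
      (\<forall>p\<in>Met \<times> {\<omega>}. rho p = beta \<omega> (rmap p)))
   \<and> \<comment> \<open>(b)\<close>
     ((\<forall>e :: 'n + 'n \<Rightarrow> 'v. is_basis e \<longrightarrow>
        right_action (GLp \<times>\<times> GLp) (Met \<times> Symp) (pair_act e) \<and>
        subgroup {(g, g) | g. g \<in> carrier GLp} (GLp \<times>\<times> (GLp :: (real, 'n + 'n) sqmat monoid)) \<and>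
        (\<forall>g\<in>carrier GLp.
          bij_betw (column_act e (g, g)) (form_column ` Symp) (form_column ` Symp) \<and>
          (\<forall>\<sigma>\<in>Symp.
            column_act e (g, g) (form_column \<sigma>) = form_column (pull (endo e g) \<sigma>) \<and>
            (\<forall>J\<in>tamed \<sigma>. beta (pull (endo e g) \<sigma>) (conj_cs (endo e g) J)
                             = pair_act e (g, g) (beta \<sigma> J)) \<and>
            (\<forall>b\<in>Met. rmap (pair_act e (g, g) (b, \<sigma>)) = conj_cs (endo e g) (rmap (b, \<sigma>)))))) \<and>
      (\<forall>e :: 'n + 'n \<Rightarrow> 'v. symplectic_basis \<omega> e \<longrightarrow>
        subgroup (carrier Sp \<times> {mat 1}) (GLp \<times>\<times> (GLp :: (real, 'n + 'n) sqmat monoid)) \<and>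
        (\<forall>T\<in>carrier Sp. column_act e (T, mat 1) (form_column \<omega>) = form_column \<omega>)))
   \<and> \<comment> \<open>(c)\<close>
     ((\<forall>J\<in>tamed \<omega>. rmap (beta \<omega> J) = J) \<and>
      blunt_convex_cone (realify ` (herm_pos_cone :: (complex, 'n) sqmat set)) \<and>
      dim (realify ` (herm_pos_cone :: (complex, 'n) sqmat set)) = CARD('n) ^ 2 \<and>
      cone_isomorphic (realify ` (herm_pos_cone :: (complex, 'n) sqmat set))
                      (Kcone :: (complex, 'n) sqmat set) \<and>
      (\<forall>e :: 'n + 'n \<Rightarrow> 'v. symplectic_basis \<omega> e \<longrightarrow>
        (\<forall>J\<in>tamed \<omega>. \<exists>T\<in>carrier Sp.
          J = endo e (matrix_inv T ** Jstd ** T) \<and>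
          {p \<in> Met \<times> {\<omega>}. rmap p = J} =
            (\<lambda>M. (form_of e (transpose T ** M ** T), \<omega>)) ` realify ` herm_pos_cone)))"
proof -
  obtain e0 :: "'n + 'n \<Rightarrow> 'v" where e0: "symplectic_basis \<omega> e0"
    using symplectic_basis_exists[OF symp dimV] by (elim exE)
  have e: "is_basis e0" using e0 by (simp add: symplectic_basis_iff)
  have beta_Met: "beta \<omega> J \<in> Met \<times> {\<omega>}" if "J \<in> tamed \<omega>" for J
    using bform_tamed_Met[OF that symp] by (simp add: beta_def)
  have retr: "rmap (beta \<sigma> J) = J" if "\<sigma> \<in> Symp" "J \<in> tamed \<sigma>" for \<sigma> :: "'v form" and J
    by (rule rmap_beta[OF e that])
  have jmap_rcosets: "jmap C \<in> rcosets\<^bsub>GLp\<^esub> SO"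
    if C: "C \<in> rcosets\<^bsub>Sp\<^esub> Ugrp" for C :: "(real^('n + 'n)^('n + 'n)) set"
  proof -
    obtain T where T: "symplectic T" "C = Ugrp #>\<^bsub>Sp\<^esub> T" using C by (auto simp: RCOSETS_def)
    then show ?thesis
      using jmap_coset[OF T(1)] symplectic_det_pos[OF T(1)] by (auto simp: rcosets_eq_image)
  qed
  have well_defined:
    "(\<forall>b\<in>Met. \<forall>\<sigma>\<in>(Symp :: 'v form set). \<exists>!J. compatible b \<sigma> J) \<and>
      rmap \<in> Met \<times> {\<omega>} \<rightarrow> tamed \<omega> \<and>
      beta \<omega> \<in> tamed \<omega> \<rightarrow> Met \<times> {\<omega>} \<and>
      rho \<in> Met \<times> (Symp :: 'v form set) \<rightarrow> CohPair \<and>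
      Group.group (GLp :: (real, 'n + 'n) sqmat monoid) \<and>
      subgroup (SO :: (real, 'n + 'n) sqmat set) GLp \<and>
      subgroup (carrier (Sp :: (real, 'n + 'n) sqmat monoid)) GLp \<and>
      subgroup (Ugrp :: (real, 'n + 'n) sqmat set) Sp \<and>
      jmap \<in> rcosets\<^bsub>Sp\<^esub> (Ugrp :: (real, 'n + 'n) sqmat set) \<rightarrow> rcosets\<^bsub>GLp\<^esub> SO \<and>
      (\<forall>T\<in>carrier (Sp :: (real, 'n + 'n) sqmat monoid). jmap (Ugrp #>\<^bsub>Sp\<^esub> T) = SO #>\<^bsub>GLp\<^esub> T)"
  proof (intro conjI ballI group_GLp subgroup_SO subgroup_Sp subgroup_Ugrp)
    show "\<exists>!J. compatible b \<sigma> J" if "b \<in> Met" "\<sigma> \<in> Symp" for b \<sigma> :: "'v form"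
      by (rule compatible_ex1[OF e that])
    show "rmap \<in> Met \<times> {\<omega>} \<rightarrow> tamed \<omega>" using rmap_tamed[OF e _ symp] by auto
    show "beta \<omega> \<in> tamed \<omega> \<rightarrow> Met \<times> {\<omega>}" using beta_Met by (rule Pi_I)
    show "rho \<in> Met \<times> (Symp :: 'v form set) \<rightarrow> CohPair"
    proof (rule Pi_I)
      fix p :: "'v form \<times> 'v form" assume "p \<in> Met \<times> (Symp :: 'v form set)"
      then obtain b \<sigma> where p: "p = (b, \<sigma>)" "b \<in> Met" "\<sigma> \<in> Symp" by auto
      then show "rho p \<in> CohPair"
        using beta_CohPair[OF e p(3) rmap_tamed[OF e p(2,3)]] rho_eq_beta_rmap[OF e, of b \<sigma>] by simp
    qed
    show "jmap \<in> rcosets\<^bsub>Sp\<^esub> (Ugrp :: (real, 'n + 'n) sqmat set) \<rightarrow> rcosets\<^bsub>GLp\<^esub> SO"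
      using jmap_rcosets by (rule Pi_I)
    show "jmap (Ugrp #>\<^bsub>Sp\<^esub> T) = SO #>\<^bsub>GLp\<^esub> T" if "T \<in> carrier Sp" for T :: "(real, 'n + 'n) sqmat"
      using that by (simp add: jmap_coset)
  qed
  have isos: "\<exists>\<Phi> \<Psi>.
          bij_betw \<Phi> (Met \<times> {\<omega>}) (rcosets\<^bsub>GLp\<^esub> SO) \<and>
          bij_betw \<Psi> (tamed \<omega>) (rcosets\<^bsub>Sp\<^esub> Ugrp) \<and>
          (\<forall>T\<in>carrier GLp. (form_of e (transpose T ** T), \<omega>) \<in> Met \<times> {\<omega>} \<and>
             \<Phi> (form_of e (transpose T ** T), \<omega>) = SO #>\<^bsub>GLp\<^esub> T) \<and>
          (\<forall>T\<in>carrier Sp. endo e (matrix_inv T ** Jstd ** T) \<in> tamed \<omega> \<and>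
             \<Psi> (endo e (matrix_inv T ** Jstd ** T)) = Ugrp #>\<^bsub>Sp\<^esub> T) \<and>
          homeomorphic_map (met_topology e (Met \<times> {\<omega>})) (coset_topology GLp SO) \<Phi> \<and>
          homeomorphic_map (endo_topology e (tamed \<omega>)) (coset_topology Sp Ugrp) \<Psi> \<and>
          (\<forall>g\<in>carrier GLp. \<forall>b\<in>Met. \<Phi> (pull (endo e g) b, \<omega>) = \<Phi> (b, \<omega>) #>\<^bsub>GLp\<^esub> g) \<and>
          (\<forall>g\<in>carrier Sp. \<forall>J\<in>tamed \<omega>. \<Psi> (conj_cs (endo e g) J) = \<Psi> J #>\<^bsub>Sp\<^esub> g) \<and>
          (\<forall>J\<in>tamed \<omega>. \<Phi> (beta \<omega> J) = jmap (\<Psi> J)) \<and>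
          \<Phi> ` (beta \<omega> ` tamed \<omega>) = jmap ` (rcosets\<^bsub>Sp\<^esub> Ugrp)"
    if sb: "symplectic_basis \<omega> e" for e :: "'n + 'n \<Rightarrow> 'v"
  proof (intro exI[of _ "\<lambda>p. metric_coset e (fst p)"] exI[of _ "structure_coset e"] conjI ballI)
    have e: "is_basis e" using sb by (simp add: symplectic_basis_iff)
    show "bij_betw (\<lambda>p. metric_coset e (fst p)) (Met \<times> {\<omega>}) (rcosets\<^bsub>GLp\<^esub> SO)"
      by (rule metric_coset_homeomorphism(2)[OF e])
    show bij: "bij_betw (structure_coset e) (tamed \<omega>) (rcosets\<^bsub>Sp\<^esub> Ugrp)"
      by (rule structure_coset_homeomorphism(2)[OF sb symp])
    show "(form_of e (transpose T ** T), \<omega>) \<in> Met \<times> {\<omega>}" if "T \<in> carrier GLp" for T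
      unfolding Met_eq_image_GLp[OF e] using that by (rule imageI)
    show "metric_coset e (fst (form_of e (transpose T ** T), \<omega>)) = SO #>\<^bsub>GLp\<^esub> T" if "T \<in> carrier GLp" for T
      unfolding fst_conv by (rule metric_coset_gram[OF e that])
    show "endo e (matrix_inv T ** Jstd ** T) \<in> tamed \<omega>" if "T \<in> carrier Sp" for T
      unfolding tamed_eq_image_Sp[OF sb symp] using that by (rule imageI)
    show "structure_coset e (endo e (matrix_inv T ** Jstd ** T)) = Ugrp #>\<^bsub>Sp\<^esub> T" if "T \<in> carrier Sp" for T
      by (rule structure_coset_conj[OF e that])
    show "homeomorphic_map (met_topology e (Met \<times> {\<omega>})) (coset_topology GLp SO) (\<lambda>p. metric_coset e (fst p))"
      by (rule metric_coset_homeomorphism(1)[OF e])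
    show "homeomorphic_map (endo_topology e (tamed \<omega>)) (coset_topology Sp Ugrp) (structure_coset e)"
      by (rule structure_coset_homeomorphism(1)[OF sb symp])
    show "metric_coset e (fst (pull (endo e g) b, \<omega>)) = metric_coset e (fst (b, \<omega>)) #>\<^bsub>GLp\<^esub> g"
      if "g \<in> carrier GLp" "b \<in> Met" for g b
      unfolding fst_conv by (rule metric_coset_equivariant[OF e that])
    show "structure_coset e (conj_cs (endo e g) J) = structure_coset e J #>\<^bsub>Sp\<^esub> g"
      if "g \<in> carrier Sp" "J \<in> tamed \<omega>" for g J
      by (rule structure_coset_equivariant[OF sb symp that])
    show beta: "metric_coset e (fst (beta \<omega> J)) = jmap (structure_coset e J)" if "J \<in> tamed \<omega>" for J
      by (rule beta_corresponds_jmap[OF sb symp that])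
    have "(\<lambda>p. metric_coset e (fst p)) ` (beta \<omega> ` tamed \<omega>) = jmap ` structure_coset e ` tamed \<omega>"
      unfolding image_image by (rule image_cong[OF refl beta])
    also have "structure_coset e ` tamed \<omega> = rcosets\<^bsub>Sp\<^esub> Ugrp" using bij by (simp add: bij_betw_def)
    finally show "(\<lambda>p. metric_coset e (fst p)) ` (beta \<omega> ` tamed \<omega>) = jmap ` (rcosets\<^bsub>Sp\<^esub> Ugrp)" .
  qed
  have part_a_maps: "beta \<omega> ` tamed \<omega> \<subseteq> CohPair"
      "bij_betw (beta \<omega>) (tamed \<omega>) (beta \<omega> ` tamed \<omega>)"
      "bij_betw jmap (rcosets\<^bsub>Sp\<^esub> (Ugrp :: (real, 'n + 'n) sqmat set)) (jmap ` (rcosets\<^bsub>Sp\<^esub> Ugrp))"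
  proof -
    show "beta \<omega> ` tamed \<omega> \<subseteq> CohPair" using beta_CohPair[OF e symp] by (rule image_subsetI)
    show "bij_betw (beta \<omega>) (tamed \<omega>) (beta \<omega> ` tamed \<omega>)"
      by (intro inj_on_imp_bij_betw inj_on_inverseI[where g = rmap] retr[OF symp])
    show "bij_betw jmap (rcosets\<^bsub>Sp\<^esub> (Ugrp :: (real, 'n + 'n) sqmat set)) (jmap ` (rcosets\<^bsub>Sp\<^esub> Ugrp))"
      by (rule inj_on_imp_bij_betw[OF jmap_inj_on])
  qed
  have part_a_diagram: "beta \<omega> ` tamed \<omega> \<subseteq> Met \<times> {\<omega>}" "Met \<times> {\<omega>} \<subseteq> Met \<times> Symp"
      "(CohPair :: ('v form \<times> 'v form) set) \<subseteq> Met \<times> Symp"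
      "jmap ` (rcosets\<^bsub>Sp\<^esub> (Ugrp :: (real, 'n + 'n) sqmat set)) \<subseteq> rcosets\<^bsub>GLp\<^esub> SO"
      "\<forall>p\<in>Met \<times> {\<omega>}. rho p = beta \<omega> (rmap p)"
  proof -
    show "beta \<omega> ` tamed \<omega> \<subseteq> Met \<times> {\<omega>}" using beta_Met by (rule image_subsetI)
    show "Met \<times> {\<omega>} \<subseteq> Met \<times> Symp" using symp by blast
    show "(CohPair :: ('v form \<times> 'v form) set) \<subseteq> Met \<times> Symp" by (auto simp: CohPair_def)
    show "jmap ` (rcosets\<^bsub>Sp\<^esub> (Ugrp :: (real, 'n + 'n) sqmat set)) \<subseteq> rcosets\<^bsub>GLp\<^esub> SO"
      using jmap_rcosets by (rule image_subsetI)
    show "\<forall>p\<in>Met \<times> {\<omega>}. rho p = beta \<omega> (rmap p)" using rho_eq_beta_rmap[OF e] by auto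
  qed
  have diagonal: "right_action (GLp \<times>\<times> GLp) (Met \<times> Symp) (pair_act e) \<and>
        subgroup {(g, g) | g. g \<in> carrier GLp} (GLp \<times>\<times> (GLp :: (real, 'n + 'n) sqmat monoid)) \<and>
        (\<forall>g\<in>carrier GLp.
          bij_betw (column_act e (g, g)) (form_column ` Symp) (form_column ` Symp) \<and>
          (\<forall>\<sigma>\<in>Symp.
            column_act e (g, g) (form_column \<sigma>) = form_column (pull (endo e g) \<sigma>) \<and>
            (\<forall>J\<in>tamed \<sigma>. beta (pull (endo e g) \<sigma>) (conj_cs (endo e g) J)
                             = pair_act e (g, g) (beta \<sigma> J)) \<and>
            (\<forall>b\<in>Met. rmap (pair_act e (g, g) (b, \<sigma>)) = conj_cs (endo e g) (rmap (b, \<sigma>)))))"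
    if e: "is_basis e" for e :: "'n + 'n \<Rightarrow> 'v"
  proof (intro conjI ballI right_action_pair_act[OF e] subgroup_diagonal[OF group_GLp])
    fix g :: "(real, 'n + 'n) sqmat" assume "g \<in> carrier GLp"
    then have g: "det g > 0" by simp
    note ig = det_pos_invertible[OF g]
    let ?\<gamma> = "endo e g" and ?\<delta> = "endo e (matrix_inv g)"
    have inv: "?\<delta> (?\<gamma> x) = x" "?\<gamma> (?\<delta> x) = x" for x
      using endo_inverse[OF e ig] by (auto simp: fun_eq_iff)
    note aut = linear_endo[OF e, of g] linear_endo[OF e, of "matrix_inv g"] inv
    note aut' = linear_endo[OF e, of "matrix_inv g"] linear_endo[OF e, of g] inv(2,1)
    show col: "column_act e (g, g) (form_column \<sigma>) = form_column (pull ?\<gamma> \<sigma>)" for \<sigma>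
      by (rule column_act_diagonal[OF e g])
    have col': "column_act e (matrix_inv g, matrix_inv g) (form_column \<sigma>) = form_column (pull ?\<delta> \<sigma>)" for \<sigma>
      by (rule column_act_diagonal[OF e det_matrix_inv_pos[OF g]])
    have pull_pull: "pull ?\<delta> (pull ?\<gamma> \<sigma>) = \<sigma>" "pull ?\<gamma> (pull ?\<delta> \<sigma>) = \<sigma>" for \<sigma>
      by (rule pull_inverse[OF aut], rule pull_inverse[OF aut'])
    have Sy: "pull ?\<gamma> \<sigma> \<in> Symp" "pull ?\<delta> \<sigma> \<in> Symp" if "\<sigma> \<in> Symp" for \<sigma>
      using pull_Symp[OF aut that] pull_Symp[OF aut' that] by simp_all
    show "bij_betw (column_act e (g, g)) (form_column ` Symp) (form_column ` Symp)"
      by (rule bij_betw_byWitness[where f' = "column_act e (matrix_inv g, matrix_inv g)"])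
        (auto simp: col col' pull_pull Sy)
    show "beta (pull ?\<gamma> \<sigma>) (conj_cs ?\<gamma> J) = pair_act e (g, g) (beta \<sigma> J)" for \<sigma> J
      by (simp add: beta_def pair_act_def bform_pull[OF aut])
    show "rmap (pair_act e (g, g) (b, \<sigma>)) = conj_cs ?\<gamma> (rmap (b, \<sigma>))"
      if "\<sigma> \<in> Symp" "b \<in> Met" for \<sigma> b
    proof -
      have "compatible (pull ?\<gamma> b) (pull ?\<gamma> \<sigma>) (conj_cs ?\<gamma> (rmap (b, \<sigma>)))"
        by (rule compatible_conj_cs[OF aut rmap_compatible[OF e that(2,1)]])
      then show ?thesis
        using rmap_eq_iff[OF e pull_Met[OF aut that(2)] Sy(1)[OF that(1)]] by (simp add: pair_act_def)
    qed
  qed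
  have symplectic_part: "subgroup (carrier Sp \<times> {mat 1}) (GLp \<times>\<times> (GLp :: (real, 'n + 'n) sqmat monoid))"
      "\<And>(e :: 'n + 'n \<Rightarrow> 'v) T. symplectic_basis \<omega> e \<Longrightarrow> T \<in> carrier Sp \<Longrightarrow>
        column_act e (T, mat 1) (form_column \<omega>) = form_column \<omega>"
  proof -
    have "subgroup {mat 1} (GLp :: (real, 'n + 'n) sqmat monoid)"
      using group.triv_subgroup[OF group_GLp] by simp
    then show "subgroup (carrier Sp \<times> {mat 1}) (GLp \<times>\<times> (GLp :: (real, 'n + 'n) sqmat monoid))"
      by (rule DirProd_subgroups[OF group_GLp subgroup_Sp group_GLp])
    show "column_act e (T, mat 1) (form_column \<omega>) = form_column \<omega>"
      if "symplectic_basis \<omega> e" "T \<in> carrier Sp" for e :: "'n + 'n \<Rightarrow> 'v" and T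
      using column_act_symplectic[OF that(1)] that(2) by simp
  qed
  have fibres: "\<exists>T\<in>carrier Sp. J = endo e (matrix_inv T ** Jstd ** T) \<and>
          {p \<in> Met \<times> {\<omega>}. rmap p = J} =
            (\<lambda>M. (form_of e (transpose T ** M ** T), \<omega>)) ` realify ` herm_pos_cone"
    if sb: "symplectic_basis \<omega> e" and J: "J \<in> tamed \<omega>" for e :: "'n + 'n \<Rightarrow> 'v" and J
  proof -
    obtain T where T: "symplectic T" "J = endo e (matrix_inv T ** Jstd ** T)"
      by (rule tamed_cases[OF sb symp J])
    then have "T \<in> carrier Sp" by simp
    moreover note T(2)
    moreover have "{p \<in> Met \<times> {\<omega>}. rmap p = J} =
        (\<lambda>M. (form_of e (transpose T ** M ** T), \<omega>)) ` realify ` herm_pos_cone"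
      unfolding T(2) by (rule fibre_rmap[OF sb symp T(1)])
    ultimately show ?thesis by (intro bexI conjI)
  qed
  show ?thesis
    by (rule conjI[OF well_defined], intro conjI,
        rule part_a_maps(1), rule part_a_maps(2), rule part_a_maps(3),
        rule symplectic_basis_exists[OF symp dimV], intro allI impI, erule isos,
        rule part_a_diagram(1), rule part_a_diagram(2), rule part_a_diagram(3),
        rule part_a_diagram(4), rule part_a_diagram(5),
        intro allI impI, erule diagonal,
        intro allI impI conjI ballI, rule symplectic_part(1), erule symplectic_part(2), assumption,
        rule ballI, erule retr[OF symp],
        rule blunt_convex_cone_herm_pos, rule dim_herm_pos_cone, rule cone_isomorphic_Kcone,
        intro allI impI ballI, erule fibres, assumption)
qed

end
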